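(* Let $F\subset\mathrm{Sym}^2(\mathbb{R}^n)$ be a cone subequation satisfying $-P_e\notin F$ for every unit vector $e\in\mathbb{R}^n$. Let $\Omega\subset\mathbb{R}^n$ be a bounded domain with smooth, strictly $F$-convex boundary, let $x_1,\dots,x_k\in\Omega$ be distinct, let $\varphi\in C(\partial\Omega)$, and for each $j$ let $h_j$ be a downward-pointing singular $F$-harmonic of polar type at $x_j$. Assume there exists a continuous function $\psi:\overline\Omega\to[-\infty,\infty)$, $F$-subharmonic on $\Omega$, finite except at $x_1,\dots,x_k$, such that for each $j$ there is a constant $C_j$ with $h_j-C_j\le\psi\le h_j+C_j$ near $x_j$. Then there exists a function $H\in C(\overline\Omega\setminus\{x_1,\dots,x_k\})$ which is $F$-harmonic on $\Omega\setminus\{x_1,\dots,x_k\}$, satisfies $H|_{\partial\Omega}=\varphi$, and for which there is a constant $C>0$ with $h_j-C\le H\le h_j+C$ near $x_j$ for each $j$. Moreover this $H$ is uniquely determined and equals the Perron function $$H(x)=\sup_{v\in\mathcal F}v(x),$$ where $\mathcal F$ is the family of all $v\in \mathrm{USC}(\overline\Omega)$ that are $F$-subharmonic on $\Omega$, satisfy $v\le\varphi$ on $\partial\Omega$, and such that $v-h_j$ is bounded above near each $x_j$.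
   Context: $\mathrm{Sym}^2(\mathbb{R}^n)$ denotes real symmetric $n\times n$ matrices; $P_e$ is orthogonal projection onto the line $\mathbb{R}e$. A cone subequation is a closed set $F\subset\mathrm{Sym}^2(\mathbb{R}^n)$ with $A\in F,\ P\ge0\Rightarrow A+P\in F$, and $tF=F$ for all $t>0$; its dual is $\tilde F=\{A:-A\notin\mathrm{Int}\,F\}$. An upper semicontinuous $u:X\to[-\infty,\infty)$ on an open set $X$ is $F$-subharmonic if for every $x_0\in X$ and every $C^2$ function $\phi$ with $u\le\phi$ near $x_0$ and $u(x_0)=\phi(x_0)$ (a test function), $D^2\phi(x_0)\in F$; $u$ is $F$-harmonic if it is finite, continuous, $F$-subharmonic and $-u$ is $\tilde F$-subharmonic. A bounded domain $\Omega$ with smooth boundary has strictly $F$-convex boundary if for each $x\in\partial\Omega$ and a local defining function $\rho$ (smooth, $\Omega=\{\rho<0\}$ near $x$, $\nabla\rho\neq0$), $D^2\rho(x)+tP_{\nu}\in\mathrm{Int}\,F$ for all sufficiently large $t$, where $\nu$ is the unit normal at $x$. A downward-pointing singular $F$-harmonic of polar type at $x_0$ is a continuous $[-\infty,\infty)$-valued $F$-subharmonic function $h$ on a neighborhood $U$ of $x_0$, $F$-harmonic on $U\setminus\{x_0\}$, with $h(x_0)=-\infty$ and $h(x)>-\infty$ for $x\ne x_0$. *)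

theory Defs
  imports "HOL-Analysis.Analysis" "HOL-Library.Extended_Real"
begin

definition Sym2 :: "(real^'n^'n) set" where
  "Sym2 = {A. transpose A = A}"

definition psd :: "real^'n^'n \<Rightarrow> bool" where
  "psd P \<longleftrightarrow> (\<forall>v. 0 \<le> v \<bullet> (P *v v))"

definition proj_line :: "real^'n \<Rightarrow> real^'n^'n" where
  "proj_line e = (\<chi> i j. e$i * e$j)"

definition IntF :: "(real^'n^'n) set \<Rightarrow> (real^'n^'n) set" where
  "IntF F = {A \<in> Sym2. \<exists>e>0. \<forall>B\<in>Sym2. dist B A < e \<longrightarrow> B \<in> F}"

definition cone_subequation :: "(real^'n^'n) set \<Rightarrow> bool" where
  "cone_subequation F \<longleftrightarrow> F \<subseteq> Sym2 \<and> closed F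
     \<and> (\<forall>A\<in>F. \<forall>P\<in>Sym2. psd P \<longrightarrow> A + P \<in> F)
     \<and> (\<forall>t>0. (\<lambda>A. t *\<^sub>R A) ` F = F)"

definition dual :: "(real^'n^'n) set \<Rightarrow> (real^'n^'n) set" where
  "dual F = {A \<in> Sym2. - A \<notin> IntF F}"

definition C2_hess :: "(real^'n) set \<Rightarrow> (real^'n \<Rightarrow> real) \<Rightarrow> (real^'n \<Rightarrow> real^'n)
     \<Rightarrow> (real^'n \<Rightarrow> real^'n^'n) \<Rightarrow> bool" where
  "C2_hess U \<phi> g Hs \<longleftrightarrow> open U
     \<and> (\<forall>y\<in>U. (\<phi> has_derivative (\<lambda>h. g y \<bullet> h)) (at y))
     \<and> (\<forall>y\<in>U. (g has_derivative (\<lambda>h. Hs y *v h)) (at y))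
     \<and> continuous_on U Hs"

primrec Ck :: "nat \<Rightarrow> (real^'n) set \<Rightarrow> (real^'n \<Rightarrow> real) \<Rightarrow> bool" where
  "Ck 0 U f = continuous_on U f"
| "Ck (Suc k) U f = ((\<forall>x\<in>U. f differentiable (at x))
      \<and> (\<forall>i. Ck k U (\<lambda>x. frechet_derivative f (at x) (axis i 1))))"

definition smooth_on :: "(real^'n) set \<Rightarrow> (real^'n \<Rightarrow> real) \<Rightarrow> bool" where
  "smooth_on U f \<longleftrightarrow> (\<forall>k. Ck k U f)"

definition usc_on :: "(real^'n) set \<Rightarrow> (real^'n \<Rightarrow> ereal) \<Rightarrow> bool" where
  "usc_on S u \<longleftrightarrow> (\<forall>x\<in>S. \<forall>c. u x < c \<longrightarrow> (\<forall>\<^sub>F y in at x within S. u y < c))"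

definition F_sub :: "(real^'n^'n) set \<Rightarrow> (real^'n) set \<Rightarrow> (real^'n \<Rightarrow> ereal) \<Rightarrow> bool" where
  "F_sub F X u \<longleftrightarrow> (\<forall>x\<in>X. u x < \<infinity>) \<and> usc_on X u
     \<and> (\<forall>x0\<in>X. \<forall>U \<phi> g Hs. x0 \<in> U \<and> U \<subseteq> X \<and> C2_hess U \<phi> g Hs
           \<and> (\<forall>y\<in>U. u y \<le> ereal (\<phi> y)) \<and> u x0 = ereal (\<phi> x0) \<longrightarrow> Hs x0 \<in> F)"

definition F_harm :: "(real^'n^'n) set \<Rightarrow> (real^'n) set \<Rightarrow> (real^'n \<Rightarrow> ereal) \<Rightarrow> bool" where
  "F_harm F X u \<longleftrightarrow> (\<forall>x\<in>X. \<bar>u x\<bar> \<noteq> \<infinity>) \<and> continuous_on X u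
     \<and> F_sub F X u \<and> F_sub (dual F) X (\<lambda>x. - u x)"

definition strictly_F_convex_domain :: "(real^'n^'n) set \<Rightarrow> (real^'n) set \<Rightarrow> bool" where
  "strictly_F_convex_domain F \<Omega> \<longleftrightarrow> open \<Omega> \<and> connected \<Omega> \<and> bounded \<Omega> \<and> \<Omega> \<noteq> {}
     \<and> (\<forall>x\<in>frontier \<Omega>. \<exists>U \<rho> g Hs. x \<in> U \<and> smooth_on U \<rho> \<and> C2_hess U \<rho> g Hs
          \<and> \<Omega> \<inter> U = {y\<in>U. \<rho> y < 0} \<and> (\<forall>y\<in>U. g y \<noteq> 0)
          \<and> (\<exists>t0. \<forall>t\<ge>t0. Hs x + t *\<^sub>R proj_line (g x /\<^sub>R norm (g x)) \<in> IntF F))"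

definition polar_singular :: "(real^'n^'n) set \<Rightarrow> (real^'n \<Rightarrow> ereal) \<Rightarrow> (real^'n) set
     \<Rightarrow> real^'n \<Rightarrow> bool" where
  "polar_singular F h U x0 \<longleftrightarrow> open U \<and> x0 \<in> U \<and> continuous_on U h
     \<and> F_sub F U h \<and> F_harm F (U - {x0}) h
     \<and> h x0 = -\<infinity> \<and> (\<forall>y\<in>U - {x0}. h y > -\<infinity>)"

definition perron_family :: "(real^'n^'n) set \<Rightarrow> (real^'n) set \<Rightarrow> (real^'n \<Rightarrow> real)
     \<Rightarrow> (nat \<Rightarrow> real^'n) \<Rightarrow> nat \<Rightarrow> (nat \<Rightarrow> real^'n \<Rightarrow> ereal) \<Rightarrow> (real^'n \<Rightarrow> ereal) set" where
  "perron_family F \<Omega> \<phi> x k h = {v.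
      (\<forall>y\<in>closure \<Omega>. v y < \<infinity>) \<and> usc_on (closure \<Omega>) v \<and> F_sub F \<Omega> v
      \<and> (\<forall>y\<in>frontier \<Omega>. v y \<le> ereal (\<phi> y))
      \<and> (\<forall>j<k. \<exists>C::real. \<forall>\<^sub>F y in at (x j). v y \<le> h j y + ereal C)}"

definition sing_dirichlet_sol :: "(real^'n^'n) set \<Rightarrow> (real^'n) set \<Rightarrow> (real^'n \<Rightarrow> real)
     \<Rightarrow> (nat \<Rightarrow> real^'n) \<Rightarrow> nat \<Rightarrow> (nat \<Rightarrow> real^'n \<Rightarrow> ereal) \<Rightarrow> (real^'n \<Rightarrow> real) \<Rightarrow> bool" where
  "sing_dirichlet_sol F \<Omega> \<phi> x k h H \<longleftrightarrow>
      continuous_on (closure \<Omega> - x ` {..<k}) H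
      \<and> F_harm F (\<Omega> - x ` {..<k}) (\<lambda>y. ereal (H y))
      \<and> (\<forall>y\<in>frontier \<Omega>. H y = \<phi> y)
      \<and> (\<exists>C>0. \<forall>j<k. \<forall>\<^sub>F y in at (x j).
            h j y - ereal C \<le> ereal (H y) \<and> ereal (H y) \<le> h j y + ereal C)"

end

(* Uniqueness and the Perron formula both follow from one comparison principle. F-subharmonic v and
dual-subharmonic w with v + w <= 0 on the boundary satisfy v + w <= 0 inside; if v <= h + C and
w <= -h + C near a point where h tends to -infinity, then (1 + eps) v + w tends to -infinity there,
so small balls around the singular points can be removed. Existence is Perron's method: h itself
gives bounds near the singular points that are uniform over the family, strict F-convexity gives
lower barriers, and the hypothesis on the projections makes every boundary strictly convex for the
dual, which gives upper barriers.

The comparison principle for merely semicontinuous functions is reduced to semiconvex ones by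
sup-convolution. In place of Alexandrov's theorem on second derivatives, blow-ups are taken at
points near which the contact set of the sum is dense at small scales; such points exist because
the contact set has positive measure. The blow-ups of one summand have two-sided quadratic bounds,
and a maximality argument for second differences shows that one of them is a quadratic polynomial. *)

theory Submission
  imports Defs
begin

subsection \<open>Symmetric matrices and cone subequations\<close>

text \<open>Comparison needs a strict gap that the two subequations do not provide. It is created by
  adding \<open>d\<close> times the squared norm to the sum of the two sup-convolutions: the limit
  Hessian \<open>A\<close> of one summand then lies in \<open>F\<close> while
  \<open>- A - 2 d I\<close> lies in the dual, and these exclude each other. At a contact point the
  sum lies below a plane and both summands are semiconvex, so each summand bounds the other from
  above; this yields the two-sided bounds, and it is why the limit of a single summand has to be
  identified. Density of contact points at small scales suffices because slopes at contact points
  vary in a Lipschitz way, so finitely many values control a whole ball.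

  The other recurrent device is the value minus infinity. Constants are subharmonic for
  \<open>F\<close> and for its dual, both of which contain 0, so truncation reduces comparison to
  bounded real functions. Conversely no test function touches a function where it is minus infinity,
  so functions on the punctured domain that are dominated by the singular ones extend across the
  singular points.\<close>

lemma Sym2_add: "A \<in> Sym2 \<Longrightarrow> B \<in> Sym2 \<Longrightarrow> A + B \<in> Sym2"
  by (auto simp: Sym2_def transpose_def vec_eq_iff)

lemma Sym2_scaleR: "A \<in> Sym2 \<Longrightarrow> c *\<^sub>R A \<in> Sym2"
  by (auto simp: Sym2_def transpose_def vec_eq_iff)

lemma Sym2_uminus: "A \<in> Sym2 \<Longrightarrow> - A \<in> Sym2"
  by (auto simp: Sym2_def transpose_def vec_eq_iff)

lemma Sym2_diff: "A \<in> Sym2 \<Longrightarrow> B \<in> Sym2 \<Longrightarrow> A - B \<in> Sym2"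
  by (auto simp: Sym2_def transpose_def vec_eq_iff)

lemma Sym2_mat: "mat c \<in> Sym2"
  by (auto simp: Sym2_def transpose_def vec_eq_iff mat_def)

lemma Sym2_proj_line: "proj_line e \<in> Sym2"
  by (auto simp: Sym2_def transpose_def vec_eq_iff proj_line_def mult.commute)

lemmas Sym2_intros = Sym2_add Sym2_scaleR Sym2_uminus Sym2_diff Sym2_mat Sym2_proj_line

lemma Sym2_inner_commute:
  assumes "A \<in> Sym2" shows "u \<bullet> (A *v v) = v \<bullet> (A *v u)"
proof -
  have "u v* A = A *v u" using assms transpose_matrix_vector[of A u] by (simp add: Sym2_def)
  then show ?thesis using dot_lmul_matrix[of u A v] by (simp add: inner_commute)
qed

lemma proj_line_mult: "proj_line e *v v = (e \<bullet> v) *\<^sub>R e"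
  by (simp add: proj_line_def matrix_vector_mult_def vec_eq_iff inner_vec_def sum_distrib_left
      sum_distrib_right ac_simps)

lemma matrix_vector_minus: "(- A) *v (v::real^'n) = - (A *v v)" for A :: "real^'n^'m"
  using matrix_vector_mult_diff_rdistrib[of 0 A v] by simp

lemma mat_mult_vec: "(c *\<^sub>R mat 1) *v (v::real^'n) = c *\<^sub>R v"
  by (metis matrix_vector_mul_lid scaleR_matrix_vector_assoc)

lemma quadratic_form_bound:
  fixes E :: "real^'n^'n"
  shows "\<bar>v \<bullet> (E *v v)\<bar> \<le> real (CARD('n))^2 * norm E * (norm v)\<^sup>2"
proof -
  have 1: "\<bar>v$i * (E$i$j * v$j)\<bar> \<le> norm E * (norm v)\<^sup>2" for i j
  proof -
    have "\<bar>E$i$j\<bar> \<le> norm E"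
      using component_le_norm_cart[of "E$i" j] Finite_Cartesian_Product.norm_nth_le[of E i] by linarith
    moreover have "\<bar>v$i\<bar> * \<bar>v$j\<bar> \<le> norm v * norm v"
      by (intro mult_mono component_le_norm_cart) auto
    ultimately have "\<bar>E$i$j\<bar> * (\<bar>v$i\<bar> * \<bar>v$j\<bar>) \<le> norm E * (norm v * norm v)"
      by (rule mult_mono) auto
    then show ?thesis by (simp add: abs_mult power2_eq_square ac_simps)
  qed
  have "\<bar>v \<bullet> (E *v v)\<bar> = \<bar>\<Sum>i\<in>UNIV. \<Sum>j\<in>UNIV. v$i * (E$i$j * v$j)\<bar>"
    by (simp add: inner_vec_def matrix_vector_mult_def sum_distrib_left)
  also have "\<dots> \<le> (\<Sum>i\<in>(UNIV::'n set). \<Sum>j\<in>(UNIV::'n set). norm E * (norm v)\<^sup>2)"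
    by (rule order_trans[OF sum_abs], rule sum_mono, rule order_trans[OF sum_abs], rule sum_mono, rule 1)
  finally show ?thesis by (simp add: power2_eq_square ac_simps)
qed

text \<open>The crude entrywise bound suffices: only the existence of some neighbourhood of
  \<open>c *\<^sub>R mat 1\<close> consisting of positive matrices matters, and this is what
  produces interior points of \<open>F\<close>.\<close>

lemma psd_near_scaled_id:
  fixes E :: "real^'n^'n"
  assumes "norm (E - c *\<^sub>R mat 1) * real (CARD('n))^2 \<le> c"
  shows "psd E"
  unfolding psd_def
proof
  fix v :: "real^'n"
  have "v \<bullet> (E *v v) = c * (norm v)\<^sup>2 + v \<bullet> ((E - c *\<^sub>R mat 1) *v v)"
    by (simp add: matrix_vector_mult_diff_rdistrib mat_mult_vec inner_diff_right power2_norm_eq_inner)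
  moreover have "\<bar>v \<bullet> ((E - c *\<^sub>R mat 1) *v v)\<bar> \<le> c * (norm v)\<^sup>2"
    using quadratic_form_bound[of v "E - c *\<^sub>R mat 1"] assms
    by (smt (verit) mult.commute mult_right_mono zero_le_power2)
  ultimately show "0 \<le> v \<bullet> (E *v v)" by linarith
qed

section \<open>Interior, cone property and duality\<close>

lemma IntF_subset: "IntF F \<subseteq> F"
  by (auto simp: IntF_def)

lemma IntF_Sym2: "IntF F \<subseteq> Sym2"
  by (auto simp: IntF_def)

lemma IntF_open:
  assumes "A \<in> IntF F"
  obtains e where "e > 0" "\<And>B. B \<in> Sym2 \<Longrightarrow> dist B A < e \<Longrightarrow> B \<in> IntF F"
proof -
  obtain e where e: "e > 0" "\<And>B. B\<in>Sym2 \<Longrightarrow> dist B A < e \<Longrightarrow> B \<in> F"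
    using assms by (auto simp: IntF_def)
  show ?thesis
  proof
    show "e/2 > 0" using e by simp
    fix B assume B: "B \<in> Sym2" "dist B A < e/2"
    have "C \<in> F" if "C \<in> Sym2" "dist C B < e/2" for C
      using e(2)[OF that(1)] that(2) B(2) dist_triangle[of C A B] by linarith
    then show "B \<in> IntF F" using B e by (auto simp: IntF_def intro!: exI[of _ "e/2"])
  qed
qed

lemma IntF_add_psd:
  assumes F: "cone_subequation F" and A: "A \<in> IntF F" and P: "P \<in> Sym2" "psd P"
  shows "A + P \<in> IntF F"
proof -
  obtain e where e: "e > 0" "\<And>B. B\<in>Sym2 \<Longrightarrow> dist B A < e \<Longrightarrow> B \<in> F"
    and AS: "A \<in> Sym2" using A by (auto simp: IntF_def)
  have "B \<in> F" if "B \<in> Sym2" "dist B (A+P) < e" for B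
  proof -
    have "B - P \<in> F" using that P by (intro e Sym2_diff) (auto simp: dist_norm algebra_simps)
    then have "(B - P) + P \<in> F" using F P unfolding cone_subequation_def by blast
    then show ?thesis by simp
  qed
  then show ?thesis using AS P e by (auto simp: IntF_def Sym2_add)
qed

lemma cone_scale:
  assumes "cone_subequation F" "A \<in> F" "t > 0" shows "t *\<^sub>R A \<in> F"
  using assms unfolding cone_subequation_def by blast

lemma IntF_scale:
  assumes F: "cone_subequation F" and A: "A \<in> IntF F" and t: "t > 0"
  shows "t *\<^sub>R A \<in> IntF F"
proof -
  obtain e where e: "e > 0" "\<And>B. B\<in>Sym2 \<Longrightarrow> dist B A < e \<Longrightarrow> B \<in> F"
    and AS: "A \<in> Sym2" using A by (auto simp: IntF_def)
  have "B \<in> F" if "B \<in> Sym2" "dist B (t *\<^sub>R A) < t * e" for B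
  proof -
    have "dist ((1/t) *\<^sub>R B) A = (1/t) * dist B (t *\<^sub>R A)"
    proof -
      have "(1/t) *\<^sub>R B - A = (1/t) *\<^sub>R (B - t *\<^sub>R A)" using t by (simp add: scaleR_diff_right)
      then show ?thesis using t by (simp add: dist_norm)
    qed
    then have "dist ((1/t) *\<^sub>R B) A < e" using that t by (simp add: divide_less_eq mult.commute)
    then have "(1/t) *\<^sub>R B \<in> F" using that by (intro e Sym2_scaleR)
    then have "t *\<^sub>R ((1/t) *\<^sub>R B) \<in> F" using t by (rule cone_scale[OF F])
    then show ?thesis using t by simp
  qed
  then show ?thesis using AS e t by (auto simp: IntF_def Sym2_scaleR intro!: exI[of _ "t*e"])
qed

text \<open>A neighbourhood of \<open>c *\<^sub>R mat 1\<close> consists of positive matrices, so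
  adding it to \<open>A\<close> stays in \<open>F\<close>. Every passage from \<open>F\<close> to
  its interior in the comparison arguments goes through this shift.\<close>

lemma add_scaled_id_IntF:
  fixes A :: "real^'n^'n"
  assumes F: "cone_subequation F" and A: "A \<in> F" and c: "c > 0"
  shows "A + c *\<^sub>R mat 1 \<in> IntF F"
proof -
  have AS: "A \<in> Sym2" using F A by (auto simp: cone_subequation_def)
  let ?N = "real (CARD('n))^2"
  have N: "?N > 0" by (simp add: zero_less_card_finite)
  have "B \<in> F" if B: "B \<in> Sym2" "dist B (A + c *\<^sub>R mat 1) < c / ?N" for B
  proof -
    have "norm ((B - A) - c *\<^sub>R mat 1) * ?N \<le> c"
      using B(2) N by (simp add: dist_norm field_simps)
    then have "psd (B - A)" by (rule psd_near_scaled_id)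
    then have "A + (B - A) \<in> F" using F A B AS Sym2_diff unfolding cone_subequation_def by blast
    then show ?thesis by simp
  qed
  then show ?thesis using AS c N
    by (auto simp: IntF_def Sym2_intros intro!: exI[of _ "c / ?N"])
qed

lemma in_cone_if_perturbed:
  assumes F: "cone_subequation F" and A: "\<And>e. e > 0 \<Longrightarrow> A + e *\<^sub>R mat 1 \<in> F"
  shows "A \<in> F"
proof -
  have "((\<lambda>e. A + e *\<^sub>R mat 1) \<longlongrightarrow> A + 0 *\<^sub>R mat 1) (at_right 0)"
    by (intro tendsto_intros)
  moreover have "\<forall>\<^sub>F e in at_right (0::real). A + e *\<^sub>R mat 1 \<in> F"
    using A by (auto simp: eventually_at_right_field intro!: exI[of _ 1])
  ultimately show ?thesis
    using F Lim_in_closed_set[of F _ "at_right (0::real)"] by (auto simp: cone_subequation_def)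
qed

text \<open>Each axiom for the dual is the contrapositive of a property of \<open>IntF F\<close>:
  openness gives closedness, and \<open>- A = - (A + P) + P\<close> turns upward stability of the
  interior into upward stability of the dual.\<close>

lemma dual_cone_subequation:
  fixes F :: "(real^'n^'n) set"
  assumes F: "cone_subequation F" shows "cone_subequation (dual F)"
  unfolding cone_subequation_def
proof (intro conjI ballI allI impI)
  show "dual F \<subseteq> Sym2" by (auto simp: dual_def)
  have clS: "closed (Sym2 :: (real^'n^'n) set)"
    unfolding Sym2_def transpose_def vec_eq_iff
    by (auto intro!: closed_Collect_all closed_Collect_eq continuous_intros)
  show "closed (dual F)"
    unfolding closed_sequential_limits
  proof (intro allI impI, elim conjE)
    fix X A assume X: "\<forall>n. X n \<in> dual F" and lim: "X \<longlonglongrightarrow> A"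
    have XS: "X n \<in> Sym2" for n using X by (auto simp: dual_def)
    then have AS: "A \<in> Sym2" using clS lim closed_sequentially by blast
    have False if A: "- A \<in> IntF F"
    proof -
      obtain e where e: "e > 0" "\<And>B. B \<in> Sym2 \<Longrightarrow> dist B (- A) < e \<Longrightarrow> B \<in> IntF F"
        using IntF_open[OF A] by blast
      obtain n where "dist (X n) A < e" using lim e(1) by (metis LIMSEQ_def order_refl)
      then have "dist (- X n) (- A) < e" by (simp add: dist_norm norm_minus_commute)
      then have "- X n \<in> IntF F" using XS Sym2_uminus e(2) by blast
      then show False using X by (auto simp: dual_def)
    qed
    then show "A \<in> dual F" using AS by (auto simp: dual_def)
  qed
next
  fix A P :: "real^'n^'n" assume A: "A \<in> dual F" and P: "P \<in> Sym2" "psd P"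
  have "- A \<in> IntF F" if "- (A + P) \<in> IntF F"
    using IntF_add_psd[OF F that P] by simp
  then show "A + P \<in> dual F" using A P by (auto simp: dual_def Sym2_add)
next
  fix t :: real assume t: "t > 0"
  have *: "s *\<^sub>R A \<in> dual F" if "s > 0" "A \<in> dual F" for s A
  proof -
    have "- A \<in> IntF F" if "- (s *\<^sub>R A) \<in> IntF F"
      using IntF_scale[OF F that, of "1/s"] \<open>s > 0\<close> by simp
    then show ?thesis using that by (auto simp: dual_def Sym2_scaleR)
  qed
  show "(*\<^sub>R) t ` dual F = dual F"
  proof
    show "(*\<^sub>R) t ` dual F \<subseteq> dual F" using * t by blast
    show "dual F \<subseteq> (*\<^sub>R) t ` dual F"
    proof
      fix A assume "A \<in> dual F"
      then have "(1/t) *\<^sub>R A \<in> dual F" using * t by simp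
      then show "A \<in> (*\<^sub>R) t ` dual F" using t by (intro image_eqI[of _ _ "(1/t) *\<^sub>R A"]) auto
    qed
  qed
qed

text \<open>By Cauchy-Schwarz \<open>mat 1 - proj_line e\<close> is positive, so a negative multiple
  of the identity in \<open>F\<close> would, after rescaling, put \<open>- proj_line e\<close> into
  \<open>F\<close>.\<close>

lemma neg_id_notin:
  fixes F :: "(real^'n^'n) set"
  assumes F: "cone_subequation F" and negP: "\<forall>e::real^'n. norm e = 1 \<longrightarrow> - proj_line e \<notin> F"
    and c: "c > 0"
  shows "- (c *\<^sub>R mat 1) \<notin> F"
proof
  assume A: "- (c *\<^sub>R mat 1) \<in> F"
  then have A: "- mat 1 \<in> F" using cone_scale[OF F A, of "1/c"] c by simp
  define e :: "real^'n" where "e = axis undefined 1"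
  have e: "norm e = 1" by (simp add: e_def)
  have "psd (mat 1 - proj_line e)"
    unfolding psd_def
  proof
    fix v :: "real^'n"
    have "(e \<bullet> v)\<^sup>2 \<le> (norm e * norm v)\<^sup>2"
      by (metis Cauchy_Schwarz_ineq2 abs_ge_zero power2_abs power_mono)
    then show "0 \<le> v \<bullet> ((mat 1 - proj_line e) *v v)"
      using e by (simp add: matrix_vector_mult_diff_rdistrib proj_line_mult inner_diff_right
          power2_eq_square power2_norm_eq_inner[symmetric] inner_commute)
  qed
  then have "- mat 1 + (mat 1 - proj_line e) \<in> F"
    using F A unfolding cone_subequation_def by (meson Sym2_intros)
  then show False using negP e by simp
qed

text \<open>If 0 were interior to \<open>F\<close>, a small negative multiple of the identity would
  belong to \<open>F\<close>. Together with \<open>zero_in_cone\<close> this makes constants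
  subharmonic on both sides of the duality.\<close>

lemma zero_in_dual:
  fixes F :: "(real^'n^'n) set"
  assumes F: "cone_subequation F" and negP: "\<forall>e::real^'n. norm e = 1 \<longrightarrow> - proj_line e \<notin> F"
  shows "0 \<in> dual F"
proof -
  have False if 0: "(0::real^'n^'n) \<in> IntF F"
  proof -
    obtain e where e: "e > 0" "\<And>B. B \<in> Sym2 \<Longrightarrow> dist B (0::real^'n^'n) < e \<Longrightarrow> B \<in> IntF F"
      using IntF_open[OF 0] by blast
    let ?m = "norm (mat 1 :: real^'n^'n)"
    define c where "c = e / (?m + 1)"
    have "?m + 1 > 0" by (simp add: add_nonneg_pos)
    then have c: "c > 0" "c * (?m + 1) = e" using e by (auto simp: c_def)
    then have "c * ?m < e" by (simp add: distrib_left)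
    then have "- (c *\<^sub>R mat 1) \<in> IntF F" using c by (intro e Sym2_intros) auto
    then show False using neg_id_notin[OF F negP c(1)] IntF_subset by blast
  qed
  then show ?thesis unfolding dual_def by (auto simp: Sym2_def transpose_def vec_eq_iff)
qed

lemma zero_in_cone:
  assumes F: "cone_subequation F" and ne: "A \<in> F" shows "0 \<in> F"
proof -
  have "((\<lambda>e. e *\<^sub>R A) \<longlongrightarrow> 0 *\<^sub>R A) (at_right 0)" by (intro tendsto_intros)
  moreover have "\<forall>\<^sub>F e in at_right (0::real). e *\<^sub>R A \<in> F"
    using cone_scale[OF F ne] by (auto simp: eventually_at_right_field intro!: exI[of _ 1])
  ultimately show ?thesis
    using F Lim_in_closed_set[of F _ "at_right (0::real)"] by (auto simp: cone_subequation_def)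
qed

text \<open>The hypothesis on projections makes every boundary strictly convex for the dual subequation.\<close>

lemma add_large_proj_in_dual_interior:
  fixes F :: "(real^'n^'n) set"
  assumes F: "cone_subequation F" and negP: "\<forall>e::real^'n. norm e = 1 \<longrightarrow> - proj_line e \<notin> F"
    and e: "norm e = 1" and A: "A \<in> Sym2"
  shows "\<exists>t0. \<forall>t\<ge>t0. A + t *\<^sub>R proj_line e \<in> IntF (dual F)"
proof -
  have "open (- F)" using F by (auto simp: cone_subequation_def)
  moreover have "- proj_line e \<in> - F" using negP e by auto
  ultimately obtain d where d: "d > 0" "ball (- proj_line e) d \<subseteq> - F"
    by (meson open_contains_ball)
  \<comment> \<open>All matrices near \<open>- proj_line e\<close> miss the closed set
    \<open>F\<close>, and hence its interior; this is membership of their negatives in the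
    dual.\<close>
  have "B \<in> dual F" if "B \<in> Sym2" "dist B (proj_line e) < d" for B
  proof -
    have "dist (- proj_line e) (- B) < d" using that by (simp add: dist_norm norm_minus_commute)
    then have "- B \<notin> F" using d by auto
    then show ?thesis using that IntF_subset by (auto simp: dual_def)
  qed
  then have P: "proj_line e \<in> IntF (dual F)" using d by (auto simp: IntF_def Sym2_proj_line)
  then obtain r where r: "r > 0"
    "\<And>B. B \<in> Sym2 \<Longrightarrow> dist B (proj_line e) < r \<Longrightarrow> B \<in> IntF (dual F)"
    using IntF_open by blast
  show ?thesis
  proof (intro exI allI impI)
    \<comment> \<open>Dividing by \<open>t\<close> turns the claim into a perturbation of
      \<open>proj_line e\<close> by \<open>A / t\<close>, which this threshold makes smaller than
      \<open>r\<close>; the cone property scales back.\<close>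
    fix t assume t: "norm A / r + 1 \<le> t"
    have t0: "t > 0" using t r by (smt (verit) divide_nonneg_pos norm_ge_zero)
    have "norm A < t * r" using t r by (smt (verit) divide_less_eq)
    then have "dist (proj_line e + (1/t) *\<^sub>R A) (proj_line e) < r"
      using t0 by (simp add: dist_norm field_simps)
    then have "proj_line e + (1/t) *\<^sub>R A \<in> IntF (dual F)" using A by (intro r Sym2_intros)
    from IntF_scale[OF dual_cone_subequation[OF F] this t0]
    show "A + t *\<^sub>R proj_line e \<in> IntF (dual F)" using t0 by (simp add: scaleR_add_right add.commute)
  qed
qed

subsection \<open>Functions of class \<open>C\<^sup>2\<close>\<close>

lemma C2_hess_subset: "C2_hess U f g H \<Longrightarrow> open V \<Longrightarrow> V \<subseteq> U \<Longrightarrow> C2_hess V f g H"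
  unfolding C2_hess_def
  by (elim conjE, intro conjI ballI)
     (assumption | drule bspec, erule (1) subsetD, assumption | erule (1) continuous_on_subset)+

lemma C2_hess_add:
  assumes "C2_hess U f g H" "C2_hess U f' g' H'"
  shows "C2_hess U (\<lambda>y. f y + f' y) (\<lambda>y. g y + g' y) (\<lambda>y. H y + H' y)"
  unfolding C2_hess_def
proof (intro conjI ballI)
  fix y assume y: "y \<in> U"
  show "((\<lambda>y. f y + f' y) has_derivative (\<lambda>h. (g y + g' y) \<bullet> h)) (at y)"
    by (rule has_derivative_eq_rhs[OF has_derivative_add])
       (use assms y in \<open>auto simp: C2_hess_def inner_add_left\<close>)
  show "((\<lambda>y. g y + g' y) has_derivative (\<lambda>h. (H y + H' y) *v h)) (at y)"
    by (rule has_derivative_eq_rhs[OF has_derivative_add])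
       (use assms y in \<open>auto simp: C2_hess_def matrix_vector_mult_add_rdistrib\<close>)
qed (use assms in \<open>auto simp: C2_hess_def intro!: continuous_on_add\<close>)

lemma C2_hess_scale:
  assumes "C2_hess U f g H"
  shows "C2_hess U (\<lambda>y. c * f y) (\<lambda>y. c *\<^sub>R g y) (\<lambda>y. c *\<^sub>R H y)"
  unfolding C2_hess_def
proof (intro conjI ballI)
  fix y assume y: "y \<in> U"
  show "((\<lambda>y. c * f y) has_derivative (\<lambda>h. (c *\<^sub>R g y) \<bullet> h)) (at y)"
    by (rule has_derivative_eq_rhs[OF has_derivative_mult_right])
       (use assms y in \<open>auto simp: C2_hess_def\<close>)
  show "((\<lambda>y. c *\<^sub>R g y) has_derivative (\<lambda>h. (c *\<^sub>R H y) *v h)) (at y)"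
    by (rule has_derivative_eq_rhs[OF has_derivative_scaleR_right])
       (use assms y in \<open>auto simp: C2_hess_def scaleR_matrix_vector_assoc\<close>)
qed (use assms in \<open>auto simp: C2_hess_def intro!: continuous_intros\<close>)

lemma C2_hess_minus:
  "C2_hess U f g H \<Longrightarrow> C2_hess U (\<lambda>y. - f y) (\<lambda>y. - g y) (\<lambda>y. - H y)"
  using C2_hess_scale[of U f g H "-1"] unfolding scaleR_minus1_left by simp

lemma C2_hess_quadratic:
  assumes "A \<in> Sym2" "open U"
  shows "C2_hess U (\<lambda>y. c + p \<bullet> (y - x) + (1/2) * ((y - x) \<bullet> (A *v (y - x))))
           (\<lambda>y. p + A *v (y - x)) (\<lambda>y. A)"
  unfolding C2_hess_def
proof (intro conjI ballI)
  have lin: "((*v) A has_derivative (*v) A) F" for F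
    by (rule bounded_linear_imp_has_derivative) (rule matrix_vector_mul_bounded_linear)
  have lin': "((\<lambda>y. A *v (y - x)) has_derivative (\<lambda>h. A *v h)) (at y)" for y
  proof -
    have "((\<lambda>y. A *v (y - x)) has_derivative (\<lambda>h. A *v (h - 0))) (at y)"
      by (rule has_derivative_compose[OF _ lin]) (intro derivative_intros)
    then show ?thesis by simp
  qed
  fix y
  have "((\<lambda>y. c + p \<bullet> (y - x) + (1/2) * ((y - x) \<bullet> (A *v (y - x)))) has_derivative
      (\<lambda>h. p \<bullet> h + (1/2) * ((y - x) \<bullet> (A *v h) + h \<bullet> (A *v (y - x))))) (at y)"
    by (auto intro!: derivative_eq_intros lin')
  moreover have "p \<bullet> h + (1/2) * ((y - x) \<bullet> (A *v h) + h \<bullet> (A *v (y - x))) = (p + A *v (y - x)) \<bullet> h" for h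
    unfolding Sym2_inner_commute[OF assms(1), of "y - x" h]
    by (simp add: inner_add_left inner_commute[of h])
  ultimately show "((\<lambda>y. c + p \<bullet> (y - x) + (1/2) * ((y - x) \<bullet> (A *v (y - x)))) has_derivative
      (\<lambda>h. (p + A *v (y - x)) \<bullet> h)) (at y)" by (simp only:)
  show "((\<lambda>y. p + A *v (y - x)) has_derivative (\<lambda>h. A *v h)) (at y)"
    by (auto intro!: derivative_eq_intros lin')
qed (use assms in auto)

lemma C2_hess_norm_square:
  assumes "open U"
  shows "C2_hess U (\<lambda>y. c + d * (norm (y - x))\<^sup>2) (\<lambda>y. (2 * d) *\<^sub>R (y - x)) (\<lambda>y. (2 * d) *\<^sub>R mat 1)"
  using C2_hess_quadratic[OF Sym2_scaleR[OF Sym2_mat] assms, of c 0 x "2 * d" 1]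
  unfolding mat_mult_vec by (simp add: power2_norm_eq_inner)

lemma C2_hess_const: "open U \<Longrightarrow> C2_hess U (\<lambda>y. c) (\<lambda>y. 0) (\<lambda>y. 0)"
  using C2_hess_norm_square[of U c 0] by simp

lemma C2_hess_continuous:
  assumes "C2_hess U f g H" shows "continuous_on U f"
proof (intro continuous_at_imp_continuous_on ballI)
  fix y assume "y \<in> U"
  then have "(f has_derivative (\<lambda>h. g y \<bullet> h)) (at y)" using assms by (simp add: C2_hess_def)
  then show "isCont f y" by (rule has_derivative_continuous)
qed

lemma C2_hess_continuous_grad:
  assumes "C2_hess U f g H" shows "continuous_on U g"
proof (intro continuous_at_imp_continuous_on ballI)
  fix y assume "y \<in> U"
  then have "(g has_derivative (\<lambda>h. H y *v h)) (at y)" using assms by (simp add: C2_hess_def)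
  then show "isCont g y" by (rule has_derivative_continuous)
qed

text \<open>Where \<open>f\<close> vanishes, the Hessian of its square is the rank one matrix
  \<open>2 *\<^sub>R proj_line (g y)\<close>. Adding a multiple of the square of a defining function
  thus adds a multiple of the normal projection at the boundary.\<close>

lemma C2_hess_square:
  assumes f: "C2_hess U f g H"
  shows "C2_hess U (\<lambda>y. (f y)\<^sup>2) (\<lambda>y. (2 * f y) *\<^sub>R g y)
           (\<lambda>y. (2 * f y) *\<^sub>R H y + 2 *\<^sub>R proj_line (g y))"
proof -
  have df: "(f has_derivative (\<lambda>h. g y \<bullet> h)) (at y)" and dg: "(g has_derivative (\<lambda>h. H y *v h)) (at y)"
    if "y \<in> U" for y using f that by (auto simp: C2_hess_def)
  have "((\<lambda>y. (f y)\<^sup>2) has_derivative (\<lambda>h. ((2 * f y) *\<^sub>R g y) \<bullet> h)) (at y)" if "y \<in> U" for y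
    using df[OF that] by (auto intro!: derivative_eq_intros simp: fun_eq_iff)
  moreover have "((\<lambda>y. (2 * f y) *\<^sub>R g y) has_derivative
      (\<lambda>h. ((2 * f y) *\<^sub>R H y + 2 *\<^sub>R proj_line (g y)) *v h)) (at y)" if "y \<in> U" for y
    using df[OF that] dg[OF that]
    by (auto intro!: derivative_eq_intros
        simp: fun_eq_iff matrix_vector_mult_add_rdistrib scaleR_matrix_vector_assoc[symmetric] proj_line_mult)
  moreover have "continuous_on U (\<lambda>y. (2 * f y) *\<^sub>R H y + 2 *\<^sub>R proj_line (g y))"
    unfolding proj_line_def
    using f C2_hess_continuous[OF f] C2_hess_continuous_grad[OF f]
    by (auto simp: C2_hess_def intro!: continuous_intros continuous_on_vec_lambda)
  ultimately show ?thesis using f by (simp add: C2_hess_def)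
qed

text \<open>The expression is symmetric in \<open>u\<close> and \<open>v\<close> although the limit
  is not visibly so. One limit therefore serves both the symmetry of the Hessian and its sign at a
  minimum.\<close>

lemma C2_second_difference_limit:
  assumes C2: "C2_hess U f g H" and x: "x \<in> U"
  shows "((\<lambda>s. (f (x + s *\<^sub>R u + s *\<^sub>R v) - f (x + s *\<^sub>R u) - f (x + s *\<^sub>R v) + f x) / s\<^sup>2)
            \<longlongrightarrow> v \<bullet> (H x *v u)) (at_right 0)"
proof (rule tendstoI)
  fix e :: real assume e: "e > 0"
  define N where "N = norm u + norm v + 1"
  have N: "N \<ge> 1" by (simp add: N_def)
  \<comment> \<open>Two gradient errors of size \<open>d * (s * N)\<close>, paired with
    \<open>v\<close> and divided by \<open>s\<close>, add up to at most
    \<open>2 * d * N\<^sup>2\<close>, which is half of \<open>e\<close>.\<close>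
  define d where "d = e / (4 * N\<^sup>2)"
  have d: "d > 0" using e N by (simp add: d_def)
  have "(g has_derivative (\<lambda>h. H x *v h)) (at x)" "open U"
    using C2 x by (auto simp: C2_hess_def)
  then obtain r where r: "r > 0" and
    rd: "\<And>y. norm (y - x) < r \<Longrightarrow> norm (g y - g x - H x *v (y - x)) \<le> d * norm (y - x)"
    using d unfolding has_derivative_at_alt by metis
  obtain r' where r': "r' > 0" "ball x r' \<subseteq> U" using \<open>open U\<close> x open_contains_ball by blast
  define s0 where "s0 = min r r' / N"
  have s0: "s0 > 0" using r r' N by (simp add: s0_def)
  have "dist ((f (x + s *\<^sub>R u + s *\<^sub>R v) - f (x + s *\<^sub>R u) - f (x + s *\<^sub>R v) + f x) / s\<^sup>2)
      (v \<bullet> (H x *v u)) < e" if s: "0 < s" "s < s0" for s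
  proof -
    have sN: "s * N < min r r'" using s N by (simp add: s0_def field_simps)
    have near: "norm (s *\<^sub>R w + t *\<^sub>R v) \<le> s * N" if "w = u \<or> w = 0" "0 \<le> t" "t \<le> s" for w t
    proof -
      have "norm (s *\<^sub>R w + t *\<^sub>R v) \<le> s * norm w + t * norm v"
        using norm_triangle_ineq[of "s *\<^sub>R w" "t *\<^sub>R v"] s that by simp
      also have "\<dots> \<le> s * norm u + s * norm v"
        using that s by (intro add_mono mult_mono) auto
      finally show ?thesis using s by (simp add: N_def distrib_left)
    qed
    \<comment> \<open>Differencing in direction \<open>u\<close> and applying the mean value theorem
      once in direction \<open>v\<close> leaves a difference of gradients, for which
      differentiability of \<open>g\<close> at the single point \<open>x\<close> suffices. The term
      \<open>s *\<^sub>R 0\<close> keeps both halves in one pattern.\<close>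
    define q where "q t = f (x + (s *\<^sub>R u + t *\<^sub>R v)) - f (x + (s *\<^sub>R 0 + t *\<^sub>R v))" for t
    have dq: "(q has_real_derivative (g (x + (s *\<^sub>R u + t *\<^sub>R v)) - g (x + (s *\<^sub>R 0 + t *\<^sub>R v))) \<bullet> v) (at t)"
      if t: "0 \<le> t" "t \<le> s" for t
    proof -
      have "((\<lambda>t. f (x + (s *\<^sub>R w + t *\<^sub>R v))) has_derivative (\<lambda>h. g (x + (s *\<^sub>R w + t *\<^sub>R v)) \<bullet> (h *\<^sub>R v))) (at t)"
        if w: "w = u \<or> w = 0" for w
      proof (rule has_derivative_compose[where f="\<lambda>t. x + (s *\<^sub>R w + t *\<^sub>R v)"])
        show "((\<lambda>t. x + (s *\<^sub>R w + t *\<^sub>R v)) has_derivative (\<lambda>h. h *\<^sub>R v)) (at t)"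
          by (auto intro!: derivative_eq_intros)
        have "x + (s *\<^sub>R w + t *\<^sub>R v) \<in> U"
          using near[OF w t] sN by (intro subsetD[OF r'(2)]) (simp add: mem_ball dist_commute[of x] dist_norm[of _ x])
        then show "(f has_derivative (\<lambda>h. g (x + (s *\<^sub>R w + t *\<^sub>R v)) \<bullet> h)) (at (x + (s *\<^sub>R w + t *\<^sub>R v)))"
          using C2 by (auto simp: C2_hess_def)
      qed
      from has_derivative_diff[OF this[of u] this[of 0]] show ?thesis
        unfolding q_def has_field_derivative_def
        by (auto elim!: has_derivative_eq_rhs simp: inner_diff_left algebra_simps)
    qed
    obtain t where t: "0 < t" "t < s" and
      qt: "q s - q 0 = (s - 0) * ((g (x + (s *\<^sub>R u + t *\<^sub>R v)) - g (x + (s *\<^sub>R 0 + t *\<^sub>R v))) \<bullet> v)"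
      using MVT2[of 0 s q, OF s(1) dq] by blast
    define R where "R w = g (x + (s *\<^sub>R w + t *\<^sub>R v)) - g x - H x *v (s *\<^sub>R w + t *\<^sub>R v)" for w
    have R: "norm (R w) \<le> d * (s * N)" if "w = u \<or> w = 0" for w
    proof -
      have n: "norm (s *\<^sub>R w + t *\<^sub>R v) \<le> s * N" using near[OF that] t by simp
      have "norm (R w) \<le> d * norm (s *\<^sub>R w + t *\<^sub>R v)"
        using rd[of "x + (s *\<^sub>R w + t *\<^sub>R v)"] n sN by (simp add: R_def)
      also have "\<dots> \<le> d * (s * N)" using n d by (intro mult_left_mono) auto
      finally show ?thesis .
    qed
    have "g (x + (s *\<^sub>R u + t *\<^sub>R v)) - g (x + (s *\<^sub>R 0 + t *\<^sub>R v)) = (R u - R 0) + s *\<^sub>R (H x *v u)"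
      by (simp add: R_def matrix_vector_mult_add_rdistrib matrix_vector_right_distrib matrix_vector_mult_scaleR)
    then have "q s - q 0 = s * ((R u - R 0) \<bullet> v) + s\<^sup>2 * (v \<bullet> (H x *v u))"
      using qt by (simp only: inner_add_left inner_scaleR_left)
        (simp add: inner_commute[of v] power2_eq_square algebra_simps)
    then have "(q s - q 0) / s\<^sup>2 - v \<bullet> (H x *v u) = ((R u - R 0) \<bullet> v) / s"
      using s by (simp add: field_simps power2_eq_square)
    moreover have "\<bar>((R u - R 0) \<bullet> v) / s\<bar> \<le> (2 * (d * (s * N))) * N / s"
    proof -
      have "\<bar>(R u - R 0) \<bullet> v\<bar> \<le> norm (R u - R 0) * norm v" by (rule Cauchy_Schwarz_ineq2)
      also have "\<dots> \<le> (2 * (d * (s * N))) * N"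
        using R[of u] R[of 0] norm_triangle_ineq4[of "R u" "R 0"] d s N
        by (intro mult_mono) (auto simp: N_def)
      finally have "\<bar>(R u - R 0) \<bullet> v\<bar> / s \<le> (2 * (d * (s * N))) * N / s"
        using s by (intro divide_right_mono) auto
      then show ?thesis using s by (simp only: abs_divide abs_of_pos)
    qed
    moreover have "(2 * (d * (s * N))) * N / s = e / 2"
      using s N by (simp add: d_def power2_eq_square field_simps)
    ultimately have "\<bar>(q s - q 0) / s\<^sup>2 - v \<bullet> (H x *v u)\<bar> < e" using e by linarith
    then show ?thesis by (simp add: q_def dist_real_def algebra_simps)
  qed
  then show "\<forall>\<^sub>F s in at_right 0. dist ((f (x + s *\<^sub>R u + s *\<^sub>R v) - f (x + s *\<^sub>R u) - f (x + s *\<^sub>R v) + f x) / s\<^sup>2)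
      (v \<bullet> (H x *v u)) < e"
    using s0 by (auto simp: eventually_at_right_field)
qed

text \<open>\<open>C2_hess\<close> does not postulate symmetry. It follows because interchanging
  \<open>u\<close> and \<open>v\<close> leaves the second difference unchanged and limits are
  unique.\<close>

lemma C2_hess_symmetric:
  assumes C2: "C2_hess U f g H" and x: "x \<in> U"
  shows "H x \<in> Sym2"
proof -
  have *: "v \<bullet> (H x *v u) = u \<bullet> (H x *v v)" for u v
  proof (rule tendsto_unique[OF _ C2_second_difference_limit[OF C2 x, of u v]])
    show "((\<lambda>s. (f (x + s *\<^sub>R u + s *\<^sub>R v) - f (x + s *\<^sub>R u) - f (x + s *\<^sub>R v) + f x) / s\<^sup>2)
            \<longlongrightarrow> u \<bullet> (H x *v v)) (at_right 0)"
      using C2_second_difference_limit[OF C2 x, of v u] by (simp add: algebra_simps)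
  qed simp
  have "H x $ i $ j = axis i 1 \<bullet> (H x *v axis j 1)" for i j
    by (simp add: inner_axis' matrix_vector_mult_basis column_def)
  then show ?thesis using * unfolding Sym2_def transpose_def by (simp add: vec_eq_iff)
qed

lemma C2_local_min_hess_psd:
  assumes C2: "C2_hess U f g H" and x: "x \<in> U" and min: "\<And>y. y \<in> U \<Longrightarrow> f x \<le> f y"
  shows "psd (H x)"
  unfolding psd_def
proof
  fix v
  text \<open>The centered second difference is the limit above with directions \<open>v\<close> and \<open>- v\<close>.\<close>
  let ?q = "\<lambda>s. (f (x + s *\<^sub>R v + s *\<^sub>R (- v)) - f (x + s *\<^sub>R v) - f (x + s *\<^sub>R (- v)) + f x) / s\<^sup>2"
  have "open U" using C2 by (simp add: C2_hess_def)
  have near: "\<forall>\<^sub>F s in at_right (0::real). x + s *\<^sub>R w \<in> U" for w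
  proof -
    have "((\<lambda>s. x + s *\<^sub>R w) \<longlongrightarrow> x + 0 *\<^sub>R w) (at_right 0)" by (intro tendsto_intros)
    then show ?thesis using topological_tendstoD[OF _ \<open>open U\<close>] x by simp
  qed
  have "\<forall>\<^sub>F s in at_right 0. ?q s \<le> 0"
    using near[of v] near[of "- v"]
  proof eventually_elim
    case (elim s)
    then have "f x \<le> f (x + s *\<^sub>R v)" "f x \<le> f (x + s *\<^sub>R (- v))" using min by blast+
    then show ?case by (intro divide_nonpos_nonneg) auto
  qed
  then have "(- v) \<bullet> (H x *v v) \<le> 0"
    by (rule tendsto_upperbound[OF C2_second_difference_limit[OF C2 x, of v "- v"]]) simp
  then show "0 \<le> v \<bullet> (H x *v v)" by simp
qed

subsection \<open>Sets of positive measure are not porous\<close>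

lemma emeasure_ball_ratio:
  fixes x y :: "'a::euclidean_space"
  assumes "0 \<le> r" "0 \<le> k"
  shows "emeasure lebesgue (ball y (k * r)) = ennreal (k ^ DIM('a)) * emeasure lebesgue (ball x r)"
proof -
  have "emeasure lebesgue (ball y (k * r)) = ennreal ((k * r) ^ DIM('a) * measure lborel (ball (0::'a) 1))"
    using assms by (subst emeasure_eq_measure2) (auto simp: content_ball_conv_unit_ball[of "k * r" y])
  moreover have "emeasure lebesgue (ball x r) = ennreal (r ^ DIM('a) * measure lborel (ball (0::'a) 1))"
    using assms by (subst emeasure_eq_measure2) (auto simp: content_ball_conv_unit_ball[of r x])
  ultimately show ?thesis using assms
    by (simp add: ennreal_mult[symmetric] power_mult_distrib ac_simps)
qed

text \<open>This stands in for the Lebesgue density theorem. If every point of \<open>K\<close> had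
  a hole of fixed relative size at all small scales, a Vitali family of disjoint balls would cover
  almost all of \<open>K\<close> while the holes take a fixed fraction of its measure. That is
  impossible inside an open set barely larger than \<open>K\<close>.\<close>

lemma nonporous_point:
  fixes K :: "'a::euclidean_space set"
  assumes K: "compact K" "\<not> negligible K" and \<eta>: "0 < \<eta>" and d: "0 < d"
  shows "\<exists>x\<in>K. \<exists>r. 0 < r \<and> r < d \<and> (\<forall>y\<in>cball x r. \<exists>z\<in>K. dist y z \<le> \<eta> * r)"
proof (rule ccontr)
  assume "\<not> ?thesis"
  then have por: "\<exists>y\<in>cball x r. \<forall>z\<in>K. \<eta> * r < dist y z" if "x \<in> K" "0 < r" "r < d" for x r
    using that by (force simp: not_less not_le)
  \<comment> \<open>A hole of radius \<open>k * (2 * r)\<close> centred within \<open>r\<close> of a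
    point stays in the ball of radius \<open>2 * r\<close> about it and avoids \<open>K\<close>. It
    occupies the fraction \<open>?c\<close> of that doubled ball.\<close>
  define k where "k = min \<eta> 1 / 2"
  have k: "0 < k" "2 * k \<le> 1" "2 * k \<le> \<eta>" using \<eta> by (auto simp: k_def)
  let ?c = "k ^ DIM('a)"
  have c: "0 < ?c" "?c \<le> 1" using k by (auto intro: power_le_one)
  have lK: "K \<in> lmeasurable" using K by (simp add: lmeasurable_compact)
  define m where "m = measure lebesgue K"
  have m: "m > 0" using K(2) lK by (simp add: m_def negligible_iff_measure0 zero_less_measure_iff)
  \<comment> \<open>The excess \<open>?c * m\<close> is small enough for the final contradiction,
    since \<open>(1 - ?c) * (1 + ?c)\<close> is less than 1.\<close>
  obtain U where U: "open U" "K \<subseteq> U" and U': "U - K \<in> lmeasurable"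
    "emeasure lebesgue (U - K) < ennreal (?c * m)"
    using sets_lebesgue_outer_open[OF fmeasurableD[OF lK], of "?c * m"] c m by auto
  have UK: "U = K \<union> (U - K)" using U by auto
  have lU: "U \<in> lmeasurable" by (subst UK) (intro fmeasurable.Un lK U'(1))
  have "measure lebesgue (U - K) < ?c * m"
    using U' c m by (simp add: emeasure_eq_measure2 ennreal_less_iff)
  moreover have "measure lebesgue U \<le> m + measure lebesgue (U - K)"
    unfolding m_def by (subst UK, rule measure_Un_le) (use lK U' in auto)
  ultimately have U: "open U" "K \<subseteq> U" "U \<in> lmeasurable" "measure lebesgue U < m + ?c * m"
    using U lU by auto
  define I where "I = {i. fst i \<in> K \<and> 0 < snd i \<and> snd i < d \<and> ball (fst i) (2 * snd i) \<subseteq> U}"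
  have "\<exists>i. i \<in> I \<and> x \<in> ball (fst i) (2 * snd i) \<and> 2 * snd i < e" if x: "x \<in> K" and e: "0 < e" for x e
  proof -
    obtain r where r: "r > 0" "ball x r \<subseteq> U" using U x open_contains_ball by blast
    define s where "s = min (min r e) d / 3"
    have s: "0 < s" "2 * s < e" "2 * s \<le> r" "s < d" using r e d by (auto simp: s_def)
    then have "(x, s) \<in> I" using x r subset_ball[of "2 * s" r x] by (auto simp: I_def)
    then show ?thesis using s by (intro exI[of _ "(x, s)"]) auto
  qed
  then obtain C where C: "countable C" "C \<subseteq> I"
    "pairwise (\<lambda>i j. disjnt (ball (fst i) (2 * snd i)) (ball (fst j) (2 * snd j))) C"
    "negligible (K - (\<Union>i\<in>C. ball (fst i) (2 * snd i)))"
    using Vitali_covering_theorem_balls[of K I fst "\<lambda>i. 2 * snd i"] by blast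
  have "\<forall>i\<in>C. \<exists>y\<in>cball (fst i) (snd i). \<forall>z\<in>K. \<eta> * snd i < dist y z"
    using por C(2) by (auto simp: I_def)
  then obtain y where y: "\<And>i. i \<in> C \<Longrightarrow> y i \<in> cball (fst i) (snd i)"
    "\<And>i z. i \<in> C \<Longrightarrow> z \<in> K \<Longrightarrow> \<eta> * snd i < dist (y i) z" by metis
  define A where "A = (\<Union>i\<in>C. ball (fst i) (2 * snd i))"
  define B where "B = (\<Union>i\<in>C. ball (y i) (k * (2 * snd i)))"
  have pos: "0 < snd i" if "i \<in> C" for i using that C(2) by (auto simp: I_def)
  have hole: "ball (y i) (k * (2 * snd i)) \<subseteq> ball (fst i) (2 * snd i)" if "i \<in> C" for i
  proof
    fix z assume z: "z \<in> ball (y i) (k * (2 * snd i))"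
    have "k * (2 * snd i) \<le> snd i" using k(2) pos[OF that] by (simp add: mult_right_mono[of "2*k" 1 "snd i", simplified] ac_simps)
    then show "z \<in> ball (fst i) (2 * snd i)"
      using z y(1)[OF that] dist_triangle[of "fst i" z "y i"] by (simp add: dist_commute)
  qed
  have BK: "B \<inter> K = {}"
  proof -
    have False if "i \<in> C" "z \<in> K" "z \<in> ball (y i) (k * (2 * snd i))" for i z
    proof -
      have "k * (2 * snd i) \<le> \<eta> * snd i"
        using mult_right_mono[OF k(3), of "snd i"] pos[OF that(1)] by (simp add: ac_simps)
      then show False using y(2)[OF that(1,2)] that(3) by simp
    qed
    then show ?thesis by (auto simp: B_def)
  qed
  have oA: "open A" and oB: "open B" by (auto simp: A_def B_def)
  have BA: "B \<subseteq> A" using hole by (auto simp: A_def B_def)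
  have AU: "A \<subseteq> U" using C(2) by (auto simp: A_def I_def)
  have disj: "disjoint_family_on (\<lambda>i. ball (fst i) (2 * snd i)) C"
    using C(3) by (auto simp: disjoint_family_on_def pairwise_def disjnt_def)
  have disj': "disjoint_family_on (\<lambda>i. ball (y i) (k * (2 * snd i))) C"
    using disj hole unfolding disjoint_family_on_def by blast
  have "emeasure lebesgue B = (\<integral>\<^sup>+i. emeasure lebesgue (ball (y i) (k * (2 * snd i))) \<partial>count_space C)"
    unfolding B_def by (rule emeasure_UN_countable[OF _ C(1) disj']) auto
  also have "\<dots> = (\<integral>\<^sup>+i. ennreal ?c * emeasure lebesgue (ball (fst i) (2 * snd i)) \<partial>count_space C)"
    using pos k by (intro nn_integral_cong emeasure_ball_ratio) (auto intro: less_imp_le)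
  also have "\<dots> = ennreal ?c * (\<integral>\<^sup>+i. emeasure lebesgue (ball (fst i) (2 * snd i)) \<partial>count_space C)"
    by (rule nn_integral_cmult) simp
  also have "(\<integral>\<^sup>+i. emeasure lebesgue (ball (fst i) (2 * snd i)) \<partial>count_space C) = emeasure lebesgue A"
    unfolding A_def by (rule emeasure_UN_countable[OF _ C(1) disj, symmetric]) auto
  finally have eB: "emeasure lebesgue B = ennreal ?c * emeasure lebesgue A" .
  have lA: "A \<in> lmeasurable" using fmeasurableI2[OF U(3) AU] oA by auto
  have lB: "B \<in> lmeasurable" using fmeasurableI2[OF lA BA] oB by auto
  have mB: "measure lebesgue B = ?c * measure lebesgue A"
    using eB c by (simp add: measure_def enn2real_mult)
  have "K \<subseteq> (A - B) \<union> (K - A)" using BK by auto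
  then have "m \<le> measure lebesgue ((A - B) \<union> (K - A))"
    unfolding m_def using lK lA lB by (intro measure_mono_fmeasurable) auto
  also have "\<dots> \<le> measure lebesgue (A - B) + measure lebesgue (K - A)"
    using lK lA lB by (intro measure_Un_le) auto
  also have "measure lebesgue (K - A) = 0"
    using C(4) by (simp add: A_def negligible_imp_measure0)
  also have "measure lebesgue (A - B) = measure lebesgue A - measure lebesgue B"
    using lA lB BA by (intro measurable_measure_Diff) auto
  finally have "m \<le> (1 - ?c) * measure lebesgue A" using mB by (simp add: algebra_simps)
  also have "\<dots> \<le> (1 - ?c) * (m + ?c * m)"
    using measure_mono_fmeasurable[OF AU _ U(3)] oA U(4) c by (intro mult_left_mono) auto
  also have "\<dots> = m - ?c\<^sup>2 * m" by (simp add: algebra_simps power2_eq_square)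
  finally show False using mult_pos_pos[OF zero_less_power[OF c(1)] m, of 2] by linarith
qed

subsection \<open>Quadratic blow-up limits\<close>

text \<open>Tychonoff's theorem: functions carry the product topology, so pointwise bounds alone
  give compactness.\<close>

lemma compact_pointwise_bounded:
  fixes b :: "'a \<Rightarrow> real"
  shows "compact {t. \<forall>y. \<bar>t y\<bar> \<le> b y}"
proof -
  have "compactin (product_topology (\<lambda>i. euclidean) UNIV) (PiE UNIV (\<lambda>y. {- b y..b y}))"
    by (subst compactin_PiE) (auto simp: compactin_euclidean_iff)
  moreover have "PiE UNIV (\<lambda>y. {- b y..b y}) = {t. \<forall>y. \<bar>t y\<bar> \<le> b y}"
    by (auto simp: PiE_UNIV_domain Pi_iff abs_le_iff minus_le_iff)
  ultimately show ?thesis by (simp add: euclidean_product_topology compactin_euclidean_iff)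
qed

text \<open>A product over all points of the space is compact but need not be sequentially compact,
  so a cluster point replaces the limit of a subsequence. It is tested by closed sets, which is
  enough for equations and inequalities involving finitely many values.\<close>

lemma compact_cluster_point:
  fixes s :: "nat \<Rightarrow> 'a::topological_space"
  assumes "compact C" "\<And>n. s n \<in> C"
  shows "\<exists>t\<in>C. \<forall>D. closed D \<longrightarrow> (\<forall>\<^sub>F n in sequentially. s n \<in> D) \<longrightarrow> t \<in> D"
proof -
  have "filtermap s sequentially \<noteq> bot" by (simp add: filtermap_bot_iff)
  moreover have "\<forall>\<^sub>F x in filtermap s sequentially. x \<in> C" using assms(2) by (simp add: eventually_filtermap)
  ultimately obtain t where t: "t \<in> C" "inf (nhds t) (filtermap s sequentially) \<noteq> bot"
    using assms(1) unfolding compact_filter by blast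
  have "t \<in> D" if D: "closed D" "\<forall>\<^sub>F n in sequentially. s n \<in> D" for D
  proof (rule ccontr)
    assume "t \<notin> D"
    then have 1: "eventually (\<lambda>x. x \<in> - D) (nhds t)" using D(1) by (auto simp: eventually_nhds intro!: exI[of _ "- D"])
    have 2: "eventually (\<lambda>x. x \<in> D) (filtermap s sequentially)" using D(2) by (simp add: eventually_filtermap)
    have "eventually (\<lambda>x. False) (inf (nhds t) (filtermap s sequentially))"
      unfolding eventually_inf using 1 2 by (intro exI[of _ "\<lambda>x. x \<in> - D"] exI[of _ "\<lambda>x. x \<in> D"]) auto
    then show False using t(2) by (simp add: trivial_limit_def)
  qed
  then show ?thesis using t(1) by blast
qed

text \<open>A global bound of class C^{1,1}, phrased through touching paraboloids instead of
  derivatives so that it can be checked on pointwise limits.\<close>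

definition paraboloid_bounded :: "real \<Rightarrow> ('a::real_inner \<Rightarrow> real) \<Rightarrow> bool" where
  "paraboloid_bounded L t \<longleftrightarrow> (\<forall>x. \<exists>p. \<forall>y. \<bar>t y - t x - p \<bullet> (y - x)\<bar> \<le> L * (norm (y - x))\<^sup>2)"

text \<open>The two expansions are compared at a point displaced from \<open>x'\<close> in the
  direction of \<open>p - p'\<close>, by a length comparable to the distance of the base
  points.\<close>

lemma gradients_lipschitz:
  fixes f :: "'a::real_inner \<Rightarrow> real"
  assumes L: "0 \<le> L" and x: "\<And>y. \<bar>f y - f x - p \<bullet> (y - x)\<bar> \<le> L * (norm (y - x))\<^sup>2"
    and x': "\<And>y. \<bar>f y - f x' - p' \<bullet> (y - x')\<bar> \<le> L * (norm (y - x'))\<^sup>2"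
  shows "norm (p - p') \<le> 6 * L * norm (x - x')"
proof -
  have bound: "norm (p - p') \<le> 6 * L * (norm (x - x') + s)" if s: "s > 0" for s
  proof (cases "p = p'")
    case True
    then show ?thesis using L s by simp
  next
    case False
    \<comment> \<open>The positive \<open>s\<close> keeps the displacement nonzero when
      \<open>x = x'\<close> and is sent to 0 at the end. The errors at distances at most
      \<open>D\<close>, \<open>2 * D\<close> and \<open>D\<close> contribute 1 + 4 + 1 = 6.\<close>
    define D where "D = norm (x - x') + s"
    have D: "D > 0" "norm (x - x') \<le> D" using s by (auto simp: D_def add_nonneg_pos)
    define w where "w = (D / norm (p - p')) *\<^sub>R (p - p')"
    have nw: "norm w = D" using False D by (simp add: w_def)
    have "norm (x' + w - x) \<le> 2 * D"
      using norm_triangle_ineq[of "x' - x" w] nw D by (simp add: norm_minus_commute algebra_simps)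
    then have sq: "(norm (x' + w - x))\<^sup>2 \<le> 4 * D\<^sup>2"
      using power_mono[of "norm (x' + w - x)" "2 * D" 2] by (simp add: power_mult_distrib)
    have sq': "(norm (x' - x))\<^sup>2 \<le> D\<^sup>2"
      using D by (simp add: norm_minus_commute power_mono)
    have "(p - p') \<bullet> w = (f x' - f x - p \<bullet> (x' - x)) - (f (x' + w) - f x - p \<bullet> (x' + w - x))
        + (f (x' + w) - f x' - p' \<bullet> (x' + w - x'))"
      by (simp add: algebra_simps inner_add_right inner_diff_right)
    also have "\<dots> \<le> L * (norm (x' - x))\<^sup>2 + L * (norm (x' + w - x))\<^sup>2 + L * D\<^sup>2"
      using x[of x'] x[of "x' + w"] x'[of "x' + w"] nw by simp
    also have "\<dots> \<le> L * D\<^sup>2 + L * (4 * D\<^sup>2) + L * D\<^sup>2"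
      using sq sq' L by (intro add_mono mult_left_mono) auto
    finally have "(p - p') \<bullet> w \<le> (6 * L * D) * D" by (simp add: power2_eq_square algebra_simps)
    moreover have "(p - p') \<bullet> w = norm (p - p') * D"
      using False by (simp add: w_def power2_norm_eq_inner[symmetric] power2_eq_square)
    ultimately show ?thesis using D by (simp add: D_def[symmetric])
  qed
  have "((\<lambda>s. 6 * L * (norm (x - x') + s)) \<longlongrightarrow> 6 * L * (norm (x - x') + 0)) (at_right 0)"
    by (intro tendsto_intros)
  then have "norm (p - p') \<le> 6 * L * (norm (x - x') + 0)"
    by (rule tendsto_lowerbound)
       (use bound in \<open>auto simp: eventually_at_right_field intro!: exI[of _ 1]\<close>)
  then show ?thesis by simp
qed

text \<open>These are the stability properties of the set of all blow-up limits of a function. The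
  aim is \<open>exists_quadratic\<close>: such a class cannot avoid the purely quadratic
  functions.\<close>

locale blowup_class =
  fixes T :: "(real^'n \<Rightarrow> real) set" and L :: real
  assumes closed_T: "closed T" and T_ne: "T \<noteq> {}" and L: "0 \<le> L"
    and bounded_T: "\<And>t. t \<in> T \<Longrightarrow> paraboloid_bounded L t"
    and affine_T: "\<And>t c p. t \<in> T \<Longrightarrow> (\<lambda>y. t y + c + p \<bullet> y) \<in> T"
    and translate_T: "\<And>t z. t \<in> T \<Longrightarrow> (\<lambda>y. t (z + y)) \<in> T"
    and zoom_T: "\<And>t s. t \<in> T \<Longrightarrow> 0 < s \<Longrightarrow> (\<lambda>y. t (s *\<^sub>R y) / s\<^sup>2) \<in> T"
begin

text \<open>The members with value and gradient 0 at the origin: the compact slice that remains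
  after affine functions are divided out.\<close>

definition N :: "(real^'n \<Rightarrow> real) set" where
  "N = {t \<in> T. \<forall>y. \<bar>t y\<bar> \<le> L * (norm y)\<^sup>2}"

lemma compact_N: "compact N"
proof -
  have "N = T \<inter> {t. \<forall>y. \<bar>t y\<bar> \<le> L * (norm y)\<^sup>2}" by (auto simp: N_def)
  then show ?thesis using closed_Int_compact[OF closed_T compact_pointwise_bounded] by simp
qed

lemma N_zero: "t \<in> N \<Longrightarrow> t 0 = 0"
  by (auto simp: N_def dest: spec[of _ 0])

text \<open>Every location and every scale of a member yields an element of the compact slice. A
  maximum over \<open>N\<close> therefore bounds second differences at all points and at all
  scales.\<close>

lemma renormalize:
  assumes t: "t \<in> T" and s: "0 < s"
  shows "\<exists>p. (\<lambda>y. (t (z + s *\<^sub>R y) - t z - s * (p \<bullet> y)) / s\<^sup>2) \<in> N"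
proof -
  obtain p where p: "\<And>y. \<bar>t y - t z - p \<bullet> (y - z)\<bar> \<le> L * (norm (y - z))\<^sup>2"
    using bounded_T[OF t] unfolding paraboloid_bounded_def by metis
  let ?r = "\<lambda>y. (t (z + s *\<^sub>R y) - t z - s * (p \<bullet> y)) / s\<^sup>2"
  have "(\<lambda>y. t (z + s *\<^sub>R y) / s\<^sup>2 + (- t z / s\<^sup>2) + ((- (1 / s)) *\<^sub>R p) \<bullet> y) \<in> T"
    by (intro affine_T zoom_T[OF translate_T[OF t, of z] s])
  also have "(\<lambda>y. t (z + s *\<^sub>R y) / s\<^sup>2 + (- t z / s\<^sup>2) + ((- (1 / s)) *\<^sub>R p) \<bullet> y) = ?r"
    using s by (auto simp: fun_eq_iff field_simps power2_eq_square)
  finally have "?r \<in> T" .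
  moreover have "\<bar>?r y\<bar> \<le> L * (norm y)\<^sup>2" for y
  proof -
    have "\<bar>t (z + s *\<^sub>R y) - t z - s * (p \<bullet> y)\<bar> \<le> L * (norm y)\<^sup>2 * s\<^sup>2"
      using p[of "z + s *\<^sub>R y"] s by (simp add: power_mult_distrib ac_simps)
    then show ?thesis using s by (simp add: abs_divide divide_le_eq)
  qed
  ultimately show ?thesis unfolding N_def by blast
qed

lemma N_lipschitz:
  assumes t: "t \<in> N"
  shows "\<bar>t y - t x\<bar> \<le> (6 * L * norm x + L * norm (y - x)) * norm (y - x)"
proof -
  have tT: "t \<in> T" using t by (simp add: N_def)
  obtain p where p: "\<And>y. \<bar>t y - t x - p \<bullet> (y - x)\<bar> \<le> L * (norm (y - x))\<^sup>2"
    using bounded_T[OF tT] unfolding paraboloid_bounded_def by metis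
  have 0: "\<bar>t y - t 0 - 0 \<bullet> (y - 0)\<bar> \<le> L * (norm (y - 0))\<^sup>2" for y
    using t N_zero[OF t] by (auto simp: N_def)
  have "norm (p - 0) \<le> 6 * L * norm (x - 0)" by (rule gradients_lipschitz[OF L p 0])
  then have "\<bar>p \<bullet> (y - x)\<bar> \<le> (6 * L * norm x) * norm (y - x)"
    by (intro order_trans[OF Cauchy_Schwarz_ineq2] mult_right_mono) auto
  then show ?thesis using p[of y] by (simp add: power2_eq_square algebra_simps)
qed

text \<open>The product topology gives continuity in \<open>t\<close> only for a fixed point. The
  locally uniform Lipschitz bound on \<open>N\<close> makes evaluation jointly continuous, as
  maximizing over functions and directions together requires.\<close>

lemma continuous_evaluation: "continuous_on (N \<times> UNIV) (\<lambda>(t, e). t e)"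
  unfolding continuous_on_def
proof
  fix te assume te: "te \<in> N \<times> (UNIV :: (real^'n) set)"
  obtain t e where [simp]: "te = (t, e)" by (cases te)
  let ?F = "at (t, e) within N \<times> UNIV"
  have fst: "((\<lambda>x. fst x) \<longlongrightarrow> t) ?F" and snd: "((\<lambda>x. snd x) \<longlongrightarrow> e) ?F"
    using tendsto_fst[OF tendsto_ident_at] tendsto_snd[OF tendsto_ident_at] by fastforce+
  have 1: "((\<lambda>x. fst x e) \<longlongrightarrow> t e) ?F"
    by (rule continuous_on_tendsto_compose[OF continuous_on_product_coordinates fst]) auto
  have "((\<lambda>x. (6 * L * norm e + L * norm (snd x - e)) * norm (snd x - e)) \<longlongrightarrow>
      (6 * L * norm e + L * norm (e - e)) * norm (e - e)) ?F"
    by (intro tendsto_intros snd)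
  then have "((\<lambda>x. (6 * L * norm e + L * norm (snd x - e)) * norm (snd x - e)) \<longlongrightarrow> 0) ?F" by simp
  then have "((\<lambda>x. fst x (snd x) - fst x e) \<longlongrightarrow> 0) ?F"
    by (rule Lim_null_comparison[rotated])
       (use N_lipschitz in \<open>auto simp: eventually_at_filter intro!: always_eventually\<close>)
  from tendsto_add[OF this 1] show "((\<lambda>(t, e). t e) \<longlongrightarrow> (case te of (t, e) \<Rightarrow> t e)) (at te within N \<times> UNIV)"
    unfolding case_prod_beta by simp
qed


lemma scale_shift_N:
  assumes t: "t \<in> N" and s: "0 < s"
  shows "(\<lambda>y. t (s *\<^sub>R y) / s\<^sup>2) \<in> N"
proof -
  have "\<bar>t (s *\<^sub>R y)\<bar> \<le> L * (norm y)\<^sup>2 * s\<^sup>2" for y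
    using t s by (auto simp: N_def power_mult_distrib ac_simps dest!: spec[of _ "s *\<^sub>R y"])
  then show ?thesis using t s zoom_T[of t s] by (simp add: N_def abs_divide divide_le_eq)
qed

text \<open>Along \<open>W\<close> the member \<open>t\<close> is already the quadratic with matrix
  \<open>A\<close>. The induction enlarges \<open>W\<close> until it is the whole space.\<close>

definition invariant :: "real^'n^'n \<Rightarrow> (real^'n) set \<Rightarrow> (real^'n \<Rightarrow> real) \<Rightarrow> bool" where
  "invariant A W t \<longleftrightarrow> (\<forall>y. \<forall>w\<in>W. t (y + w) - (y + w) \<bullet> (A *v (y + w)) / 2 = t y - y \<bullet> (A *v y) / 2)"

text \<open>Moving the base point changes \<open>t\<close> minus half the form of \<open>A\<close>
  by a term linear along \<open>W\<close>. The normalization at the new base point forces that term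
  to vanish.\<close>

lemma invariant_renormalized:
  assumes A: "A \<in> Sym2" and W: "subspace W" and t: "invariant A W t" and s: "0 < s"
    and r: "r = (\<lambda>y. (t (z + s *\<^sub>R y) - t z - s * (p \<bullet> y)) / s\<^sup>2)" and rN: "r \<in> N"
  shows "invariant A W r"
proof -
  let ?Q = "\<lambda>y. y \<bullet> (A *v y)"
  have Qadd: "?Q (u + v) = ?Q u + 2 * (u \<bullet> (A *v v)) + ?Q v" for u v
    using Sym2_inner_commute[OF A, of u v]
    by (simp add: matrix_vector_right_distrib inner_add_left inner_add_right)
  have Qs: "?Q (c *\<^sub>R u) = c\<^sup>2 * ?Q u" for c u
    by (simp add: matrix_vector_mult_scaleR power2_eq_square)
  define q where "q w = (A *v z - p) \<bullet> w" for w
  have key: "r (y + w) - ?Q (y + w) / 2 = r y - ?Q y / 2 + q w / s" if w: "w \<in> W" for y w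
  proof -
    have "t (z + s *\<^sub>R y + s *\<^sub>R w) - ?Q (z + s *\<^sub>R y + s *\<^sub>R w) / 2 = t (z + s *\<^sub>R y) - ?Q (z + s *\<^sub>R y) / 2"
      using t subspace_scale[OF W w] unfolding invariant_def by blast
    moreover have "?Q (z + s *\<^sub>R y + s *\<^sub>R w) = ?Q z + 2 * s * (z \<bullet> (A *v (y + w))) + s\<^sup>2 * ?Q (y + w)"
    proof -
      have "z + s *\<^sub>R y + s *\<^sub>R w = z + s *\<^sub>R (y + w)" by (simp add: scaleR_add_right)
      then show ?thesis
        using Qadd[of z "s *\<^sub>R (y + w)"]
        by (simp only: Qs) (simp only: matrix_vector_mult_scaleR inner_scaleR_right mult.assoc)
    qed
    moreover have "?Q (z + s *\<^sub>R y) = ?Q z + 2 * s * (z \<bullet> (A *v y)) + s\<^sup>2 * ?Q y"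
      using Qadd[of z "s *\<^sub>R y"] Qs[of s y] by (simp add: matrix_vector_mult_scaleR)
    moreover have "z \<bullet> (A *v (y + w)) = z \<bullet> (A *v y) + (A *v z) \<bullet> w"
      using Sym2_inner_commute[OF A, of z w]
      by (simp add: matrix_vector_right_distrib inner_add_right inner_commute)
    moreover have "t1 = t2 + s * q' + s\<^sup>2 * (b / 2 - c / 2)"
      if "t1 - Q1 / 2 = t2 - Q2 / 2" "Q1 = a + 2 * s * z1 + s\<^sup>2 * b" "Q2 = a + 2 * s * z2 + s\<^sup>2 * c" "z1 = z2 + q'"
      for t1 t2 Q1 Q2 a b c z1 z2 q' :: real
      using that by (simp add: field_simps)
    ultimately have "t (z + s *\<^sub>R y + s *\<^sub>R w) = t (z + s *\<^sub>R y) + s * ((A *v z) \<bullet> w)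
        + s\<^sup>2 * (?Q (y + w) / 2 - ?Q y / 2)"
      by metis
    then have "r (y + w) = (t (z + s *\<^sub>R y) + s * ((A *v z) \<bullet> w) + s\<^sup>2 * (?Q (y + w) / 2 - ?Q y / 2)
        - t z - s * (p \<bullet> y) - s * (p \<bullet> w)) / s\<^sup>2"
      by (simp add: r scaleR_add_right add.assoc inner_add_right diff_diff_eq distrib_left)
    also have "\<dots> = r y + (?Q (y + w) / 2 - ?Q y / 2) + q w / s"
      using s by (simp add: r q_def field_simps power2_eq_square inner_diff_left)
    finally show ?thesis by simp
  qed
  have "q w = 0" if w: "w \<in> W" for w
  proof -
    \<comment> \<open>Along \<open>c *\<^sub>R w\<close> the linear term scales like
      \<open>c\<close>, but \<open>r\<close> and the form are bounded by a multiple of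
      \<open>c\<^sup>2\<close>; letting \<open>c\<close> tend to 0 removes it.\<close>
    define B where "B = (L * (norm w)\<^sup>2 + \<bar>?Q w\<bar>) * s"
    have B: "\<bar>q w\<bar> \<le> c * B" if c: "c > 0" for c
    proof -
      have "q (c *\<^sub>R w) / s = r (c *\<^sub>R w) - ?Q (c *\<^sub>R w) / 2"
        using key[of "c *\<^sub>R w" 0] subspace_scale[OF W w] N_zero[OF rN] by simp
      then have "\<bar>q (c *\<^sub>R w) / s\<bar> \<le> \<bar>r (c *\<^sub>R w)\<bar> + \<bar>?Q (c *\<^sub>R w)\<bar>" by linarith
      then have "c * \<bar>q w\<bar> / s \<le> \<bar>r (c *\<^sub>R w)\<bar> + \<bar>?Q (c *\<^sub>R w)\<bar>"
        using c s by (simp add: q_def abs_mult abs_divide)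
      also have "\<dots> \<le> c\<^sup>2 * (L * (norm w)\<^sup>2 + \<bar>?Q w\<bar>)"
      proof -
        have "\<bar>r (c *\<^sub>R w)\<bar> \<le> L * (norm (c *\<^sub>R w))\<^sup>2" using rN unfolding N_def by blast
        moreover have "L * (norm (c *\<^sub>R w))\<^sup>2 = c\<^sup>2 * (L * (norm w)\<^sup>2)" by (simp add: power_mult_distrib)
        moreover have "\<bar>?Q (c *\<^sub>R w)\<bar> = c\<^sup>2 * \<bar>?Q w\<bar>" unfolding Qs by (simp add: abs_mult)
        ultimately show ?thesis by (simp only: distrib_left)
      qed
      finally have "c * \<bar>q w\<bar> \<le> c * (c * B)" using s by (simp add: B_def divide_le_eq power2_eq_square ac_simps)
      then show ?thesis using c by simp
    qed
    have "((\<lambda>c. c * B) \<longlongrightarrow> 0 * B) (at_right 0)" by (intro tendsto_intros)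
    then have "\<bar>q w\<bar> \<le> 0 * B"
      by (rule tendsto_lowerbound)
         (use B in \<open>auto simp: eventually_at_right_field intro!: exI[of _ 1]\<close>)
    then show ?thesis by simp
  qed
  then show ?thesis using key by (simp add: invariant_def)
qed


text \<open>Choose a member and a unit direction \<open>e\<close> orthogonal to \<open>W\<close> for
  which the second difference is maximal, with value \<open>m\<close>. After subtraction of
  \<open>m / 2\<close> times the squared norm, every member becomes concave and nonpositive on the
  complement of \<open>W\<close>, and the maximizer vanishes at \<open>e\<close> and
  \<open>- e\<close>. Zooming in spreads these zeros over the line through \<open>e\<close>, and a
  concave function with supporting planes that vanishes on a line is invariant along it.\<close>

lemma extremal_step:
  assumes A: "A \<in> Sym2" and W: "subspace W" "W \<noteq> UNIV" and t0: "t0 \<in> N" "invariant A W t0"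
  shows "\<exists>A' W' t. A' \<in> Sym2 \<and> subspace W' \<and> dim W < dim W' \<and> t \<in> N \<and> invariant A' W' t"
proof -
  let ?Q = "\<lambda>y. y \<bullet> (A *v y)"
  have Qadd: "?Q (u + v) = ?Q u + 2 * (u \<bullet> (A *v v)) + ?Q v" for u v
    using Sym2_inner_commute[OF A, of u v]
    by (simp add: matrix_vector_right_distrib inner_add_left inner_add_right)
  have Qs: "?Q (c *\<^sub>R u) = c\<^sup>2 * ?Q u" for c u
    by (simp add: matrix_vector_mult_scaleR power2_eq_square)
  have Qm: "?Q (- u) = ?Q u" for u using Qs[of "-1" u] by simp
  define V where "V = {y. \<forall>w\<in>W. w \<bullet> y = 0}"
  have V: "subspace V" by (auto simp: V_def subspace_def inner_add_right)
  have decomp: "\<exists>y1 y2. y1 \<in> W \<and> y2 \<in> V \<and> y = y1 + y2" for y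
  proof -
    obtain y1 y2 where "y1 \<in> span W" "\<And>w. w \<in> span W \<Longrightarrow> orthogonal y2 w" "y = y1 + y2"
      using orthogonal_subspace_decomp_exists[of W y] by blast
    moreover have "span W = W" using W(1) by simp
    ultimately show ?thesis by (auto simp: V_def orthogonal_def inner_commute)
  qed
  define S where "S = V \<inter> sphere 0 1"
  have compS: "compact S" unfolding S_def
    by (intro closed_Int_compact closed_subspace V) simp
  have "S \<noteq> {}"
  proof -
    obtain x where "x \<notin> W" using W(2) by blast
    then obtain y where y: "y \<in> V" "y \<noteq> 0" using decomp[of x] by (metis add.right_neutral)
    then have "(1 / norm y) *\<^sub>R y \<in> S" using subspace_scale[OF V] by (auto simp: S_def)
    then show ?thesis by blast
  qed
  define TW where "TW = {t \<in> N. invariant A W t}"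
  have "TW = N \<inter> (\<Inter>y. \<Inter>w\<in>W. {t. t (y + w) - ?Q (y + w) / 2 = t y - ?Q y / 2})"
    by (auto simp: TW_def invariant_def)
  moreover have "closed (\<Inter>y. \<Inter>w\<in>W. {t. t (y + w) - ?Q (y + w) / 2 = t y - ?Q y / 2})"
    by (intro closed_INT ballI closed_Collect_eq continuous_intros continuous_on_product_coordinates)
  ultimately have compTW: "compact TW" using compact_Int_closed[OF compact_N] by simp
  have TW_N: "t \<in> N" if "t \<in> TW" for t using that by (simp add: TW_def)
  have TW_0: "t 0 = 0" if "t \<in> TW" for t using N_zero that by (simp add: TW_def)
  have "t0 \<in> TW" using t0 by (simp add: TW_def)
  \<comment> \<open>For fixed \<open>e\<close> this is the centred second difference at 0 of
    \<open>t\<close> minus half the form of \<open>A\<close>; the centre contributes nothing because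
    \<open>t\<close> vanishes there.\<close>
  define M where "M = (\<lambda>(t, e). t e + t (- e) - ?Q e)"
  have ev1: "continuous_on (TW \<times> S) (\<lambda>x. fst x (snd x))"
    by (rule continuous_on_subset[OF continuous_evaluation[unfolded case_prod_beta]]) (auto simp: TW_def)
  have ev2: "continuous_on (TW \<times> S) (\<lambda>x. fst x (- snd x))"
  proof -
    have "continuous_on (TW \<times> S) (\<lambda>x. (fst x, - snd x))" by (intro continuous_intros)
    moreover have "(\<lambda>x. (fst x, - snd x)) ` (TW \<times> S) \<subseteq> N \<times> UNIV" by (auto simp: TW_def)
    ultimately show ?thesis
      using continuous_on_compose2[OF continuous_evaluation[unfolded case_prod_beta], of "TW \<times> S" "\<lambda>x. (fst x, - snd x)"]
      by simp
  qed
  have evQ: "continuous_on (TW \<times> S) (\<lambda>x. ?Q (snd x))"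
    by (intro continuous_intros bounded_linear.continuous_on[OF matrix_vector_mul_bounded_linear])
  have "continuous_on (TW \<times> S) M"
    unfolding M_def case_prod_beta by (intro continuous_intros ev1 ev2 evQ)
  moreover have "TW \<times> S \<noteq> {}" using \<open>t0 \<in> TW\<close> \<open>S \<noteq> {}\<close> by auto
  ultimately obtain x where x: "x \<in> TW \<times> S" "\<And>y. y \<in> TW \<times> S \<Longrightarrow> M y \<le> M x"
    using continuous_attains_sup[OF compact_Times[OF compTW compS]] by blast
  obtain t1 e where te: "x = (t1, e)" by (cases x)
  have t1: "t1 \<in> TW" and e: "e \<in> V" "norm e = 1" using x(1) by (auto simp: te S_def)
  define m where "m = t1 e + t1 (- e) - ?Q e"
  have max: "t v + t (- v) - ?Q v \<le> m" if "t \<in> TW" "v \<in> S" for t v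
    using x(2)[of "(t, v)"] that by (simp add: M_def te m_def)
  have renorm: "\<exists>p. (\<lambda>y. (t (z + s *\<^sub>R y) - t z - s * (p \<bullet> y)) / s\<^sup>2) \<in> TW" if t: "t \<in> TW" and s: "0 < s" for t z s
  proof -
    obtain p where p: "(\<lambda>y. (t (z + s *\<^sub>R y) - t z - s * (p \<bullet> y)) / s\<^sup>2) \<in> N"
      using renormalize[OF _ s, of t z] t by (auto simp: TW_def N_def)
    then show ?thesis
      using invariant_renormalized[OF A W(1) _ s refl p] t by (auto simp: TW_def)
  qed
  define \<kappa> where "\<kappa> t y = t y - ?Q y / 2 - m / 2 * (norm y)\<^sup>2" for t and y :: "real^'n"
  have n2: "(norm (u + v))\<^sup>2 = (norm u)\<^sup>2 + 2 * (u \<bullet> v) + (norm v)\<^sup>2" for u v :: "real^'n"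
    by (simp add: power2_norm_eq_inner inner_add_left inner_add_right inner_commute)
  \<comment> \<open>Maximality of \<open>m\<close> is applied to the renormalization of
    \<open>t\<close> at the midpoint of 0 and \<open>v\<close>, with half the length of
    \<open>v\<close> as scale.\<close>
  have half: "\<kappa> t v \<le> 2 * \<kappa> t ((1/2) *\<^sub>R v)" if t: "t \<in> TW" and v: "v \<in> V" for t v
  proof (cases "v = 0")
    case True then show ?thesis using TW_0[OF t] by (simp add: \<kappa>_def)
  next
    case False
    define s where "s = norm v / 2"
    have s: "s > 0" using False by (simp add: s_def)
    define w where "w = (1 / norm v) *\<^sub>R v"
    have w: "w \<in> S" using False subspace_scale[OF V v] by (auto simp: S_def w_def)
    have sw: "s *\<^sub>R w = (1/2) *\<^sub>R v" using False by (simp add: s_def w_def)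
    obtain p where "(\<lambda>y. (t ((1/2) *\<^sub>R v + s *\<^sub>R y) - t ((1/2) *\<^sub>R v) - s * (p \<bullet> y)) / s\<^sup>2) \<in> TW"
      using renorm[OF t s] by blast
    from max[OF this w] have "(t v + t 0 - 2 * t ((1/2) *\<^sub>R v)) / s\<^sup>2 - ?Q w \<le> m"
      using sw by (simp add: add_divide_distrib[symmetric] diff_divide_distrib[symmetric] scaleR_left.add[symmetric] algebra_simps)
    then have "t v + t 0 - 2 * t ((1/2) *\<^sub>R v) \<le> (m + ?Q w) * s\<^sup>2"
      using s by (simp add: field_simps)
    also have "\<dots> = m * (norm v)\<^sup>2 / 4 + ?Q ((1/2) *\<^sub>R v)"
      unfolding sw[symmetric] Qs by (simp add: s_def power_divide algebra_simps)
    finally show ?thesis using TW_0[OF t] Qs[of "1/2" v] by (simp add: \<kappa>_def power_mult_distrib power_divide)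
  qed
  define C where "C = L + real (CARD('n))^2 * norm A + \<bar>m\<bar>"
  have \<kappa>C: "\<kappa> t v \<le> C * (norm v)\<^sup>2" if "t \<in> TW" for t v
  proof -
    have "t v \<le> L * (norm v)\<^sup>2" using TW_N[OF that] unfolding N_def by (auto dest!: spec[of _ v])
    moreover have "- ?Q v / 2 \<le> real (CARD('n))^2 * norm A * (norm v)\<^sup>2"
      using quadratic_form_bound[of v A] by linarith
    moreover have "- (m / 2 * (norm v)\<^sup>2) \<le> \<bar>m\<bar> * (norm v)\<^sup>2"
    proof -
      have "(- (m / 2)) * (norm v)\<^sup>2 \<le> \<bar>m\<bar> * (norm v)\<^sup>2" by (rule mult_right_mono) auto
      then show ?thesis by simp
    qed
    ultimately show ?thesis by (simp add: \<kappa>_def C_def algebra_simps)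
  qed
  have \<kappa>_le: "\<kappa> t v \<le> 0" if t: "t \<in> TW" and v: "v \<in> V" for t v
  proof -
    \<comment> \<open>Each halving costs a factor 2, but \<open>\<kappa>\<close> is at most
      quadratic at 0, so the bound obtained after \<open>i\<close> halvings is of order
      \<open>1 / 2^i\<close>.\<close>
    have it: "\<kappa> t v \<le> 2^i * \<kappa> t ((1/2^i) *\<^sub>R v)" for i
    proof (induction i)
      case (Suc i)
      have "\<kappa> t ((1/2^i) *\<^sub>R v) \<le> 2 * \<kappa> t ((1/2) *\<^sub>R (1/2^i) *\<^sub>R v)"
        by (rule half[OF t subspace_scale[OF V v]])
      then have "2^i * \<kappa> t ((1/2^i) *\<^sub>R v) \<le> 2^i * (2 * \<kappa> t ((1/2) *\<^sub>R (1/2^i) *\<^sub>R v))"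
        by (rule mult_left_mono) simp
      with Suc.IH have "\<kappa> t v \<le> 2^i * (2 * \<kappa> t ((1/2) *\<^sub>R (1/2^i) *\<^sub>R v))" by linarith
      then show ?case by (simp add: ac_simps)
    qed simp
    have "\<kappa> t v \<le> (C * (norm v)\<^sup>2) / 2^i" for i
    proof -
      have "2^i * \<kappa> t ((1/2^i) *\<^sub>R v) \<le> 2^i * (C * (norm ((1/2^i) *\<^sub>R v))\<^sup>2)"
        by (intro mult_left_mono \<kappa>C t) simp
      also have "\<dots> = (C * (norm v)\<^sup>2) / 2^i"
        by (simp add: power_divide power2_eq_square)
      finally show ?thesis using it[of i] by linarith
    qed
    then show ?thesis
      using LIMSEQ_le_const[OF LIMSEQ_divide_realpow_zero[of 2 "C * (norm v)\<^sup>2"], of "\<kappa> t v"] by auto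
  qed
  \<comment> \<open>Applying \<open>\<kappa>_le\<close> to the renormalization at \<open>z\<close>
    gives a plane above \<open>\<kappa> t\<close> on \<open>z + V\<close> that touches at
    \<open>z\<close>; this is concavity along \<open>V\<close>.\<close>
  have supp: "\<exists>p. \<forall>v\<in>V. \<kappa> t (z + v) \<le> \<kappa> t z + p \<bullet> v" if t: "t \<in> TW" for t z
  proof -
    obtain p where "(\<lambda>y. (t (z + 1 *\<^sub>R y) - t z - 1 * (p \<bullet> y)) / 1\<^sup>2) \<in> TW"
      using renorm[OF t, of 1 z] by auto
    then have r: "(\<lambda>y. t (z + y) - t z - p \<bullet> y) \<in> TW" by simp
    have "\<kappa> t (z + v) \<le> \<kappa> t z + (p - A *v z - m *\<^sub>R z) \<bullet> v" if v: "v \<in> V" for v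
    proof -
      have 1: "(A *v z) \<bullet> v = z \<bullet> (A *v v)" using Sym2_inner_commute[OF A, of z v] by (simp add: inner_commute)
      show ?thesis
        using \<kappa>_le[OF r v] unfolding \<kappa>_def Qadd n2 inner_diff_left inner_scaleR_left 1
        by (simp add: field_simps)
    qed
    then show ?thesis by blast
  qed
  have me: "- e \<in> V" "c *\<^sub>R e \<in> V" for c using subspace_neg[OF V e(1)] subspace_scale[OF V e(1)] by auto
  have "\<kappa> t1 e + \<kappa> t1 (- e) = 0" using e Qm[of e] by (simp add: \<kappa>_def m_def)
  then have e0: "\<kappa> t1 e = 0" "\<kappa> t1 (- e) = 0"
    using \<kappa>_le[OF t1 e(1)] \<kappa>_le[OF t1 me(1)] by linarith+
  have small: "\<kappa> t1 ((1/2^i) *\<^sub>R e) = 0 \<and> \<kappa> t1 (- (1/2^i) *\<^sub>R e) = 0" for i :: nat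
  proof (induction i)
    case (Suc i)
    have "0 \<le> \<kappa> t1 ((1/2^Suc i) *\<^sub>R e)" using half[OF t1 me(2)[of "1/2^i"]] Suc by (simp add: ac_simps)
    moreover have "0 \<le> \<kappa> t1 (- (1/2^Suc i) *\<^sub>R e)" using half[OF t1 me(2)[of "- (1/2^i)"]] Suc by (simp add: ac_simps)
    ultimately show ?case
      using \<kappa>_le[OF t1 me(2)[of "1/2^Suc i"]] \<kappa>_le[OF t1 me(2)[of "- (1/2^Suc i)"]] by linarith
  qed (use e0 in simp)
  \<comment> \<open>Zooming in moves the zeros of \<open>\<kappa> t1\<close> at
    \<open>e / 2^l\<close> outwards, so a cluster point vanishes at every
    \<open>2^j *\<^sub>R e\<close> and at the opposite points.\<close>
  define z where "z i y = t1 ((1/2^i) *\<^sub>R y) / (1/2^i)\<^sup>2" for i :: nat and y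
  have zTW: "z i \<in> TW" for i
  proof -
    have zN: "z i \<in> N" using scale_shift_N[OF TW_N[OF t1], of "1/2^i"] by (simp add: z_def[abs_def])
    have "z i = (\<lambda>y. (t1 (0 + (1/2^i) *\<^sub>R y) - t1 0 - (1/2^i) * (0 \<bullet> y)) / (1/2^i)\<^sup>2)"
      using TW_0[OF t1] by (simp add: z_def[abs_def])
    from invariant_renormalized[OF A W(1) _ _ this zN] t1 have "invariant A W (z i)" by (simp add: TW_def)
    then show ?thesis using zN by (simp add: TW_def)
  qed
  have z\<kappa>: "\<kappa> (z i) y = \<kappa> t1 ((1/2^i) *\<^sub>R y) / (1/2^i)\<^sup>2" for i y
    unfolding \<kappa>_def z_def Qs by (simp add: power_mult_distrib power_divide field_simps)
  obtain t2 where t2: "t2 \<in> TW" and cl: "\<And>D. closed D \<Longrightarrow> (\<forall>\<^sub>F n in sequentially. z n \<in> D) \<Longrightarrow> t2 \<in> D"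
    using compact_cluster_point[of TW z, OF compTW zTW] by blast
  have dyadic: "\<kappa> t2 (2^j *\<^sub>R e) = 0 \<and> \<kappa> t2 ((- (2^j)) *\<^sub>R e) = 0" for j :: nat
  proof -
    have zero: "\<kappa> t2 y = 0" if "\<And>i. i \<ge> j \<Longrightarrow> \<kappa> (z i) y = 0" for y
    proof -
      have "closed {t. \<kappa> t y = 0}" unfolding \<kappa>_def
        by (intro closed_Collect_eq continuous_intros continuous_on_product_coordinates)
      from cl[OF this] show ?thesis using that by (auto simp: eventually_sequentially)
    qed
    have "(1/2^i) *\<^sub>R (2^j *\<^sub>R e) = (1/2^(i-j)) *\<^sub>R e" "(1/2^i) *\<^sub>R ((- (2^j)) *\<^sub>R e) = (- (1/2^(i-j))) *\<^sub>R e"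
      if "i \<ge> j" for i
      using that by (simp_all add: power_diff)
    then have "\<kappa> (z i) (2^j *\<^sub>R e) = 0" "\<kappa> (z i) ((- (2^j)) *\<^sub>R e) = 0" if "i \<ge> j" for i
      using that small[of "i-j"] unfolding z\<kappa> by (simp_all only: div_0)
    then show ?thesis by (intro conjI zero) auto
  qed
  \<comment> \<open>A supporting plane at \<open>\<tau> *\<^sub>R e\<close> lies above the zeros on
    both sides of it, which makes the value there nonnegative; \<open>\<kappa>_le\<close> gives the
    reverse.\<close>
  have line: "\<kappa> t2 (\<tau> *\<^sub>R e) = 0" for \<tau>
  proof -
    obtain j where j: "\<bar>\<tau>\<bar> < 2^j" using real_arch_pow[of 2 "\<bar>\<tau>\<bar>"] by auto
    obtain p where p: "\<And>v. v \<in> V \<Longrightarrow> \<kappa> t2 (\<tau> *\<^sub>R e + v) \<le> \<kappa> t2 (\<tau> *\<^sub>R e) + p \<bullet> v"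
      using supp[OF t2] by blast
    have "0 \<le> \<kappa> t2 (\<tau> *\<^sub>R e) + (2^j - \<tau>) * (p \<bullet> e)"
      using p[OF me(2), of "2^j - \<tau>"] dyadic[of j] by (simp add: scaleR_left.add[symmetric])
    moreover have "0 \<le> \<kappa> t2 (\<tau> *\<^sub>R e) + (- (2^j) - \<tau>) * (p \<bullet> e)"
      using p[OF me(2), of "- (2^j) - \<tau>"] dyadic[of j] by (simp only: scaleR_left.add[symmetric] inner_scaleR_right) simp
    moreover have "(2^j - \<tau>) * (p \<bullet> e) \<le> 0 \<or> (- (2^j) - \<tau>) * (p \<bullet> e) \<le> 0"
      using j by (simp add: mult_le_0_iff) linarith
    ultimately show ?thesis using \<kappa>_le[OF t2 me(2)[of \<tau>]] by linarith
  qed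
  have inv1: "\<kappa> t2 (y + \<tau> *\<^sub>R e) \<le> \<kappa> t2 y" if y: "y \<in> V" for y \<tau>
  proof -
    obtain p where p: "\<And>v. v \<in> V \<Longrightarrow> \<kappa> t2 (y + v) \<le> \<kappa> t2 y + p \<bullet> v"
      using supp[OF t2] by blast
    \<comment> \<open>The plane touching at \<open>y\<close> stays above the zero values on the
      whole line, so its slope along \<open>e\<close> must vanish. The parameter chosen below would
      otherwise make the right side equal to -1.\<close>
    have "0 \<le> \<kappa> t2 y - p \<bullet> y + s * (p \<bullet> e)" for s
      using p[OF subspace_diff[OF V me(2) y], of s] line[of s] by (simp add: inner_diff_right)
    from this[of "- (\<kappa> t2 y - p \<bullet> y + 1) / (p \<bullet> e)"] have "p \<bullet> e = 0"
      by (cases "p \<bullet> e = 0") auto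
    then show ?thesis using p[OF me(2)[of \<tau>]] by simp
  qed
  have inv: "\<kappa> t2 (y + \<tau> *\<^sub>R e) = \<kappa> t2 y" if y: "y \<in> V" for y \<tau>
    using inv1[OF y, of \<tau>] inv1[OF subspace_add[OF V y me(2)[of \<tau>]], of "- \<tau>"] by simp
  \<comment> \<open>Along \<open>e\<close> the function \<open>t2\<close> exceeds half the form of
    \<open>A\<close> by \<open>m / 2\<close> times the square of the coordinate, so the form is
    increased by \<open>m\<close> in that direction.\<close>
  define A' where "A' = A + m *\<^sub>R proj_line e"
  define W' where "W' = span (insert e W)"
  have eW: "e \<notin> span W"
  proof
    assume "e \<in> span W"
    then have "e \<in> W" using W(1) by (metis span_eq_iff)
    then have "e \<bullet> e = 0" using e(1) by (auto simp: V_def)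
    then show False using e(2) by simp
  qed
  have gW: "t2 (y + w) - ?Q (y + w) / 2 = t2 y - ?Q y / 2" if "w \<in> W" for y w
    using t2 that by (simp add: TW_def invariant_def)
  have "invariant A' W' t2"
    unfolding invariant_def
  proof (intro allI ballI)
    fix y w' assume "w' \<in> W'"
    then obtain \<tau> where "w' - \<tau> *\<^sub>R e \<in> W" unfolding W'_def span_breakdown_eq using W(1) by (metis span_eq_iff)
    then obtain w where w: "w \<in> W" "w' = w + \<tau> *\<^sub>R e" by (metis diff_add_cancel)
    obtain y1 y2 where y: "y1 \<in> W" "y2 \<in> V" "y = y1 + y2" using decomp by blast
    have e1: "e \<bullet> y1 = 0" "e \<bullet> w = 0" using e(1) y(1) w(1) by (auto simp: V_def inner_commute)
    have "t2 (y + w') - ?Q (y + w') / 2 = t2 (y2 + \<tau> *\<^sub>R e) - ?Q (y2 + \<tau> *\<^sub>R e) / 2"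
      using gW[OF subspace_add[OF W(1) y(1) w(1)], of "y2 + \<tau> *\<^sub>R e"] by (simp add: y w ac_simps)
    also have "\<dots> = \<kappa> t2 y2 + m / 2 * (norm (y2 + \<tau> *\<^sub>R e))\<^sup>2"
      using inv[OF y(2), of \<tau>] by (simp add: \<kappa>_def)
    also have "\<dots> = t2 y2 - ?Q y2 / 2 + m / 2 * (2 * \<tau> * (e \<bullet> y) + \<tau>\<^sup>2)"
      using e(2) e1 y by (simp add: \<kappa>_def n2 inner_add_right inner_commute[of y2] algebra_simps)
    also have "t2 y2 - ?Q y2 / 2 = t2 y - ?Q y / 2"
      using gW[OF y(1), of y2] y(3) by (simp add: add.commute)
    finally have 1: "t2 (y + w') - ?Q (y + w') / 2 = t2 y - ?Q y / 2 + m / 2 * (2 * \<tau> * (e \<bullet> y) + \<tau>\<^sup>2)" .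
    have Q': "u \<bullet> (A' *v u) = ?Q u + m * (e \<bullet> u)\<^sup>2" for u
      by (simp add: A'_def matrix_vector_mult_add_rdistrib scaleR_matrix_vector_assoc[symmetric]
          proj_line_mult inner_add_right inner_commute power2_eq_square)
    have "e \<bullet> (y + w') = e \<bullet> y + \<tau>"
      using e1 e(2) by (simp add: w inner_add_right power2_norm_eq_inner[symmetric])
    then show "t2 (y + w') - (y + w') \<bullet> (A' *v (y + w')) / 2 = t2 y - y \<bullet> (A' *v y) / 2"
    proof -
      have "t - (Q + m * (y + \<tau>)\<^sup>2) / 2 = t' - (Q' + m * y\<^sup>2) / 2"
        if "t - Q / 2 = t' - Q' / 2 + m / 2 * (2 * \<tau> * y + \<tau>\<^sup>2)" for t t' Q Q' y :: real
        using that by (simp add: power2_eq_square field_simps)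
      then show ?thesis using 1 unfolding Q' \<open>e \<bullet> (y + w') = e \<bullet> y + \<tau>\<close> by blast
    qed
  qed
  moreover have "dim W < dim W'" using eW by (simp add: W'_def dim_insert)
  moreover have "A' \<in> Sym2" using A by (simp add: A'_def Sym2_intros)
  moreover have "subspace W'" by (simp add: W'_def)
  ultimately show ?thesis using TW_N[OF t2] by blast
qed

text \<open>Repeating \<open>extremal_step\<close> reaches \<open>W = UNIV\<close>. Invariance then
  compares every value with the value 0 at the origin and leaves only the quadratic form.\<close>

lemma exists_quadratic: "\<exists>A\<in>Sym2. (\<lambda>y. y \<bullet> (A *v y) / 2) \<in> T"
proof -
  have "\<exists>A W t. A \<in> Sym2 \<and> subspace W \<and> k \<le> dim W \<and> t \<in> N \<and> invariant A W t"
    if "k \<le> CARD('n)" for k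
    using that
  proof (induction k)
    case 0
    obtain t0 where "t0 \<in> T" using T_ne by blast
    from renormalize[OF this, of 1] obtain t where "t \<in> N" by auto
    moreover have "invariant 0 {0} t" by (simp add: invariant_def)
    ultimately show ?case using Sym2_mat[of 0] by (metis mat_0 subspace_single_0 zero_le)
  next
    case (Suc k)
    then obtain A W t where *: "A \<in> Sym2" "subspace W" "k \<le> dim W" "t \<in> N" "invariant A W t" by auto
    show ?case
    proof (cases "W = UNIV")
      case True
      then have "Suc k \<le> dim W" using Suc.prems by simp
      then show ?thesis using * by blast
    next
      case False
      from extremal_step[OF *(1,2) this *(4,5)] show ?thesis using *(3) by (metis Suc_leI le_less_trans)
    qed
  qed
  from this[OF order_refl] obtain A W t where *: "A \<in> Sym2" "subspace W" "CARD('n) \<le> dim W" "t \<in> N" "invariant A W t"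
    by blast
  have "dim W = DIM(real^'n)" using *(3) dim_subset_UNIV[of W] by simp
  then have "W = UNIV" using *(2) by (metis dim_eq_full span_eq_iff)
  then have "t y = y \<bullet> (A *v y) / 2" for y
    using *(5) N_zero[OF *(4)] unfolding invariant_def by (metis UNIV_I add_0 diff_0_right
        diff_eq_eq div_0 inner_zero_left)
  then have "t = (\<lambda>y. y \<bullet> (A *v y) / 2)" by auto
  then show ?thesis using * by (auto simp: N_def)
qed

end

subsection \<open>Contact points of sums of semiconvex functions\<close>

lemma linear_le_quadratic_imp_zero:
  fixes w :: "'a::real_inner"
  assumes "\<And>h. w \<bullet> h \<le> C * (norm h)\<^sup>2"
  shows "w = 0"
proof (rule ccontr)
  assume "w \<noteq> 0"
  then have w: "(norm w)\<^sup>2 > 0" by simp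
  define s where "s = 1 / (2 * \<bar>C\<bar> + 1)"
  have s: "s > 0" "C * s < 1" by (auto simp: s_def divide_less_eq)
  have "s * (norm w)\<^sup>2 \<le> (C * s) * s * (norm w)\<^sup>2"
    using assms[of "s *\<^sub>R w"] s by (simp add: power2_norm_eq_inner[symmetric] power_mult_distrib power2_eq_square ac_simps)
  then have "s \<le> (C * s) * s" using w by (simp only: mult_le_cancel_right)
  moreover have "(C * s) * s < 1 * s" using s by (intro mult_strict_right_mono)
  ultimately show False by simp
qed

text \<open>A function that is only \<open>\<theta>\<close>-close to a quadratic need not be touched
  by it. The extra \<open>e / 2\<close> times the squared norm opens a gap on the unit sphere that
  beats the errors, so the maximum of the difference is interior and a genuine touching point
  appears near \<open>x\<close>.\<close>

lemma rescaled_quadratic_contact: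
  fixes g :: "real^'n \<Rightarrow> real" and x :: "real^'n" and A :: "real^'n^'n"
  assumes g: "continuous_on UNIV g" and A: "A \<in> Sym2" and r: "0 < r"
    and upper: "\<And>y. norm y \<le> 1 \<Longrightarrow> g (x + r *\<^sub>R y) \<le> c + p \<bullet> y + r\<^sup>2 * (y \<bullet> (A *v y) / 2 + \<theta>)"
    and z: "norm z \<le> 1" and lower: "g (x + r *\<^sub>R z) \<ge> c + p \<bullet> z + r\<^sup>2 * (z \<bullet> (A *v z) / 2 - \<theta>)"
    and \<theta>: "2 * \<theta> + e / 2 * (norm z)\<^sup>2 < e / 2"
  shows "\<exists>v P \<rho>. norm v < 1 \<and> 0 < \<rho> \<and> (\<forall>Y\<in>ball (x + r *\<^sub>R v) \<rho>. g Y \<le> g (x + r *\<^sub>R v) + P \<bullet> (Y - (x + r *\<^sub>R v))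
      + (Y - (x + r *\<^sub>R v)) \<bullet> ((A + e *\<^sub>R mat 1) *v (Y - (x + r *\<^sub>R v))) / 2)"
proof -
  let ?B = "A + e *\<^sub>R mat 1"
  have B: "?B \<in> Sym2" using A by (intro Sym2_intros)
  have QB: "y \<bullet> (?B *v y) / 2 = y \<bullet> (A *v y) / 2 + e / 2 * (norm y)\<^sup>2" for y
    by (simp add: matrix_vector_mult_add_rdistrib mat_mult_vec inner_add_right power2_norm_eq_inner add_divide_distrib)
  define \<gamma> where "\<gamma> y = g (x + r *\<^sub>R y) - c - p \<bullet> y - r\<^sup>2 * (y \<bullet> (?B *v y) / 2)" for y
  have "continuous_on (cball 0 1) \<gamma>"
    unfolding \<gamma>_def
    by (intro continuous_intros continuous_on_compose2[OF g]
        bounded_linear.continuous_on[OF matrix_vector_mul_bounded_linear]) auto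
  then obtain v where v: "norm v \<le> 1" "\<And>y. norm y \<le> 1 \<Longrightarrow> \<gamma> y \<le> \<gamma> v"
    using continuous_attains_sup[of "cball 0 1" \<gamma>] by (force simp: dist_norm)
  have "norm v < 1"
  proof (rule ccontr)
    assume "\<not> norm v < 1"
    then have nv: "norm v = 1" using v(1) by simp
    have "\<gamma> v \<le> r\<^sup>2 * (\<theta> - e / 2)"
      using upper[OF v(1)] nv unfolding \<gamma>_def QB by (simp add: algebra_simps)
    moreover have "\<gamma> z \<ge> r\<^sup>2 * (- \<theta> - e / 2 * (norm z)\<^sup>2)"
      using lower unfolding \<gamma>_def QB by (simp add: algebra_simps)
    ultimately have "r\<^sup>2 * (- \<theta> - e / 2 * (norm z)\<^sup>2) \<le> r\<^sup>2 * (\<theta> - e / 2)" using v(2)[OF z] by linarith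
    then have "- \<theta> - e / 2 * (norm z)\<^sup>2 \<le> \<theta> - e / 2" using r by simp
    then show False using \<theta> by linarith
  qed
  define \<rho> where "\<rho> = r * (1 - norm v)"
  have \<rho>: "\<rho> > 0" using \<open>norm v < 1\<close> r by (simp add: \<rho>_def)
  let ?X = "x + r *\<^sub>R v"
  define P where "P = (1 / r) *\<^sub>R p + r *\<^sub>R (?B *v v)"
  have "g Y \<le> g ?X + P \<bullet> (Y - ?X) + (Y - ?X) \<bullet> (?B *v (Y - ?X)) / 2" if Y: "Y \<in> ball ?X \<rho>" for Y
  proof -
    define h where "h = (1 / r) *\<^sub>R (Y - ?X)"
    have Yh: "Y = x + r *\<^sub>R (v + h)" "Y - ?X = r *\<^sub>R h" using r by (simp_all add: h_def scaleR_add_right)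
    have "norm (r *\<^sub>R h) < \<rho>" using Y by (simp add: Yh(2)[symmetric] dist_norm norm_minus_commute)
    then have "norm h < 1 - norm v" using r by (simp add: \<rho>_def)
    then have "norm (v + h) \<le> 1" using norm_triangle_ineq[of v h] by simp
    from v(2)[OF this] have 1: "g Y \<le> g ?X + p \<bullet> h + r\<^sup>2 * ((v + h) \<bullet> (?B *v (v + h)) / 2 - v \<bullet> (?B *v v) / 2)"
      unfolding \<gamma>_def Yh(1)[symmetric] inner_add_right by (simp add: algebra_simps)
    have 2: "(v + h) \<bullet> (?B *v (v + h)) = v \<bullet> (?B *v v) + 2 * ((?B *v v) \<bullet> h) + h \<bullet> (?B *v h)"
      using Sym2_inner_commute[OF B, of v h]
      by (simp add: matrix_vector_right_distrib inner_add_left inner_add_right inner_commute del: matrix_vector_mult_add_rdistrib)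
    have 3: "P \<bullet> (Y - ?X) = p \<bullet> h + r\<^sup>2 * ((?B *v v) \<bullet> h)"
      unfolding Yh(2) P_def inner_add_left inner_scaleR_left inner_scaleR_right using r
      by (simp add: power2_eq_square distrib_left del: matrix_vector_mult_add_rdistrib)
    have 4: "(Y - ?X) \<bullet> (?B *v (Y - ?X)) = r\<^sup>2 * (h \<bullet> (?B *v h))"
      unfolding Yh(2) matrix_vector_mult_scaleR inner_scaleR_left inner_scaleR_right by (simp add: power2_eq_square)
    show ?thesis using 1 unfolding 2 3 4 by (simp add: field_simps)
  qed
  then show ?thesis using \<open>norm v < 1\<close> \<rho> by blast
qed

text \<open>In the application \<open>a\<close> and \<open>b\<close> are sup-convolutions:
  \<open>below_a\<close> and \<open>below_b\<close> are their semiconvexity, \<open>growth\<close>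
  confines maximizers, and the tests are available only where the sum exceeds \<open>\<mu>\<close>,
  that is, away from the boundary. The term with \<open>d\<close> is the strict gap.\<close>

locale contact_pair =
  fixes a b :: "real^'n \<Rightarrow> real" and L d B \<mu> :: real and F G :: "(real^'n^'n) set" and xs :: "real^'n"
  assumes cont_a: "continuous_on UNIV a" and cont_b: "continuous_on UNIV b"
    and below_a: "\<And>x. \<exists>p. \<forall>y. a x + p \<bullet> (y - x) - L * (norm (y - x))\<^sup>2 \<le> a y"
    and below_b: "\<And>x. \<exists>p. \<forall>y. b x + p \<bullet> (y - x) - L * (norm (y - x))\<^sup>2 \<le> b y"
    and L: "0 \<le> L" and d: "0 \<le> d"
    and growth: "\<And>x. a x + b x + d * (norm x)\<^sup>2 \<le> B - (norm x)\<^sup>2"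
    and high: "\<mu> < a xs + b xs + d * (norm xs)\<^sup>2"
    and test_a: "\<And>x A p r. \<lbrakk>\<mu> < a x + b x + d * (norm x)\<^sup>2; A \<in> Sym2; 0 < r;
        \<And>y. y \<in> ball x r \<Longrightarrow> a y \<le> a x + p \<bullet> (y - x) + (y - x) \<bullet> (A *v (y - x)) / 2\<rbrakk> \<Longrightarrow> A \<in> F"
    and test_b: "\<And>x A p r. \<lbrakk>\<mu> < a x + b x + d * (norm x)\<^sup>2; A \<in> Sym2; 0 < r;
        \<And>y. y \<in> ball x r \<Longrightarrow> b y \<le> b x + p \<bullet> (y - x) + (y - x) \<bullet> (A *v (y - x)) / 2\<rbrakk> \<Longrightarrow> A \<in> G"
begin

section \<open>The contact set of the sum\<close>

definition f :: "real^'n \<Rightarrow> real" where "f x = a x + b x + d * (norm x)\<^sup>2"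

lemma cont_f: "continuous_on UNIV f"
  unfolding f_def by (intro continuous_intros cont_a cont_b)

lemma contact_exists: "\<exists>x. \<forall>y. f y \<le> f x + p \<bullet> (y - x)"
proof -
  \<comment> \<open>Beyond this radius the quadratic decay in \<open>growth\<close> beats the slope
    \<open>p\<close>, and the tilted function is below its value at 0.\<close>
  define R where "R = 1 + norm p + \<bar>B\<bar> + \<bar>f 0\<bar>"
  have R: "R \<ge> 1" by (simp add: R_def)
  have "continuous_on (cball 0 R) (\<lambda>y. f y - p \<bullet> y)"
    by (intro continuous_intros continuous_on_subset[OF cont_f]) auto
  then obtain x where x: "\<And>y. norm y \<le> R \<Longrightarrow> f y - p \<bullet> y \<le> f x - p \<bullet> x"
    using continuous_attains_sup[of "cball 0 R" "\<lambda>y. f y - p \<bullet> y"] R by force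
  have "f y - p \<bullet> y \<le> f x - p \<bullet> x" for y
  proof (cases "norm y \<le> R")
    case False
    have "- (p \<bullet> y) \<le> norm p * norm y" using Cauchy_Schwarz_ineq2[of p y] by linarith
    then have "f y - p \<bullet> y \<le> B - norm y * (norm y - norm p)"
      using growth[of y] by (simp add: f_def power2_eq_square algebra_simps)
    moreover have "1 * (1 + \<bar>B\<bar> + \<bar>f 0\<bar>) \<le> norm y * (norm y - norm p)"
    proof -
      have "1 \<le> norm y" using False R by linarith
      then show ?thesis using False by (intro mult_mono) (auto simp: R_def)
    qed
    ultimately have "f y - p \<bullet> y \<le> f 0 - p \<bullet> 0" by simp
    then show ?thesis using x[of 0] R by simp
  qed (rule x)
  then show ?thesis by (intro exI[of _ x] allI) (auto simp: inner_diff_right algebra_simps)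
qed

text \<open>The upper contact set for slopes up to \<open>s\<close>, as in the Alexandrov maximum
  principle.\<close>

definition K :: "real \<Rightarrow> (real^'n) set" where
  "K s = {x. \<exists>p. norm p \<le> s \<and> (\<forall>y. f y \<le> f x + p \<bullet> (y - x))}"

lemma K_bounded:
  assumes "x \<in> K s" "s \<le> 1" shows "norm x \<le> 1 + \<bar>B - f 0\<bar>"
proof (rule ccontr)
  assume x: "\<not> ?thesis"
  obtain p where p: "norm p \<le> s" "f 0 \<le> f x + p \<bullet> (0 - x)" using assms(1) unfolding K_def by blast
  have "- (p \<bullet> x) \<le> norm p * norm x" using Cauchy_Schwarz_ineq2[of p x] by linarith
  also have "\<dots> \<le> 1 * norm x" using p(1) assms(2) by (intro mult_right_mono) auto
  finally have 1: "f 0 \<le> B - norm x * (norm x - 1)"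
    using p growth[of x] by (simp add: f_def power2_eq_square algebra_simps)
  have "1 * \<bar>B - f 0\<bar> < norm x * (norm x - 1)"
    using x by (intro mult_strict_mono') auto
  then have "\<bar>B - f 0\<bar> < norm x * (norm x - 1)" by (simp only: mult_1_left)
  then have "B - f 0 < norm x * (norm x - 1)" by (rule order.strict_trans1[OF abs_ge_self])
  then show False using 1 by (simp only: le_diff_eq less_diff_eq not_le[symmetric])
qed

text \<open>Pairs of a contact point and an admissible slope form a compact set; \<open>K s\<close>
  is its projection.\<close>

lemma K_compact: assumes "s \<le> 1" shows "compact (K s)"
proof -
  let ?R = "1 + \<bar>B - f 0\<bar>"
  let ?C = "(cball 0 ?R \<times> cball 0 s) \<inter> (\<Inter>y. {xp. f y \<le> f (fst xp) + snd xp \<bullet> (y - fst xp)})"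
  have "closed {xp. f y \<le> f (fst xp) + snd xp \<bullet> (y - fst xp)}" for y
    by (intro closed_Collect_le continuous_intros continuous_on_compose2[OF cont_f]) auto
  then have "compact ?C" by (intro compact_Int_closed compact_Times closed_INT) auto
  then have "compact (fst ` ?C)" by (intro compact_continuous_image continuous_intros)
  moreover have "fst ` ?C = K s"
  proof (intro equalityI subsetI)
    fix x assume "x \<in> fst ` ?C" then show "x \<in> K s" by (force simp: K_def)
  next
    fix x assume x: "x \<in> K s"
    then obtain p where "norm p \<le> s" "\<forall>y. f y \<le> f x + p \<bullet> (y - x)" unfolding K_def by blast
    then have "(x, p) \<in> ?C" using K_bounded[OF x assms] by auto
    then show "x \<in> fst ` ?C" by (rule image_eqI[rotated]) simp
  qed
  ultimately show ?thesis by simp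
qed

text \<open>At a contact point a plane lies above the sum and a paraboloid below it, so their slopes
  agree. The upper bound for \<open>a\<close> is then the plane minus the lower paraboloid of
  \<open>b\<close>.\<close>

lemma contact_expansion:
  assumes x: "\<And>y. f y \<le> f x + p \<bullet> (y - x)"
  shows "\<exists>q. \<forall>y. \<bar>a y - a x - q \<bullet> (y - x)\<bar> \<le> L * (norm (y - x))\<^sup>2"
    and "\<bar>f y - f x - p \<bullet> (y - x)\<bar> \<le> (2 * L) * (norm (y - x))\<^sup>2"
proof -
  obtain q where q: "\<And>y. a x + q \<bullet> (y - x) - L * (norm (y - x))\<^sup>2 \<le> a y" using below_a by blast
  obtain q' where q': "\<And>y. b x + q' \<bullet> (y - x) - L * (norm (y - x))\<^sup>2 \<le> b y" using below_b by blast
  have sq: "(norm y)\<^sup>2 = (norm x)\<^sup>2 + 2 * (x \<bullet> (y - x)) + (norm (y - x))\<^sup>2" for y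
    by (simp add: power2_norm_eq_inner inner_diff_left inner_diff_right inner_commute)
  have dn: "0 \<le> d * (norm (y - x))\<^sup>2" for y using d by simp
  \<comment> \<open>The mismatch between the slope of the lower paraboloid and the slope of the
    plane; a linear function dominated by a quadratic one at 0 is zero.\<close>
  define w where "w = q + q' + (2 * d) *\<^sub>R x - p"
  have low: "f y \<ge> f x + (w + p) \<bullet> (y - x) - (2 * L) * (norm (y - x))\<^sup>2" for y
  proof -
    have "d * (norm y)\<^sup>2 = d * (norm x)\<^sup>2 + 2 * d * (x \<bullet> (y - x)) + d * (norm (y - x))\<^sup>2"
      unfolding sq[of y] by (simp add: algebra_simps)
    then show ?thesis
      using q[of y] q'[of y] dn[of y] unfolding f_def w_def by (simp add: inner_add_left inner_diff_left)
  qed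
  have "w \<bullet> h \<le> (2 * L) * (norm h)\<^sup>2" for h
    using low[of "x + h"] x[of "x + h"] by (simp add: inner_add_left)
  then have "w = 0" by (rule linear_le_quadratic_imp_zero)
  then have p: "p = q + q' + (2 * d) *\<^sub>R x" by (simp add: w_def)
  show "\<bar>f y - f x - p \<bullet> (y - x)\<bar> \<le> (2 * L) * (norm (y - x))\<^sup>2"
    using low[of y] x[of y] L \<open>w = 0\<close> by (simp add: abs_le_iff)
  have "\<bar>a y - a x - q \<bullet> (y - x)\<bar> \<le> L * (norm (y - x))\<^sup>2" for y
  proof -
    have "d * (norm y)\<^sup>2 = d * (norm x)\<^sup>2 + 2 * d * (x \<bullet> (y - x)) + d * (norm (y - x))\<^sup>2"
      unfolding sq[of y] by (simp add: algebra_simps)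
    then have "a y \<le> a x + q \<bullet> (y - x) + L * (norm (y - x))\<^sup>2"
      using x[of y] q'[of y] dn[of y] unfolding f_def p by (simp add: inner_add_left)
    then show ?thesis using q[of y] by (simp add: abs_le_iff)
  qed
  then show "\<exists>q. \<forall>y. \<bar>a y - a x - q \<bullet> (y - x)\<bar> \<le> L * (norm (y - x))\<^sup>2" by blast
qed

lemma K_expansion:
  assumes "x \<in> K s"
  shows "\<exists>q. \<forall>y. \<bar>a y - a x - q \<bullet> (y - x)\<bar> \<le> L * (norm (y - x))\<^sup>2"
  using assms contact_expansion(1) unfolding K_def by blast

text \<open>The slope at a contact point is a Lipschitz function of the point, and every slope in a
  ball occurs. Lipschitz maps preserve null sets, so \<open>K s\<close> cannot be one.\<close>

lemma K_not_negligible: assumes "0 < s" shows "\<not> negligible (K s)"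
proof
  assume neg: "negligible (K s)"
  obtain P where P: "\<And>x. x \<in> K s \<Longrightarrow> norm (P x) \<le> s \<and> (\<forall>y. f y \<le> f x + P x \<bullet> (y - x))"
    using bchoice[of "K s" "\<lambda>x p. norm p \<le> s \<and> (\<forall>y. f y \<le> f x + p \<bullet> (y - x))"] unfolding K_def by blast
  have e: "\<bar>f y - f x - P x \<bullet> (y - x)\<bar> \<le> (2 * L) * (norm (y - x))\<^sup>2" if "x \<in> K s" for x y
    by (rule contact_expansion(2)) (use P[OF that] in blast)
  have L2: "0 \<le> 2 * L" using L by simp
  have "negligible (P ` K s)"
  proof (rule negligible_locally_Lipschitz_image[OF _ neg])
    fix x assume x: "x \<in> K s"
    have "norm (P y - P x) \<le> 6 * (2 * L) * norm (y - x)" if "y \<in> K s" for y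
      by (rule gradients_lipschitz[OF L2 e[OF that] e[OF x]])
    then show "\<exists>T B. open T \<and> x \<in> T \<and> (\<forall>y\<in>K s \<inter> T. norm (P y - P x) \<le> B * norm (y - x))"
      by (intro exI[of _ UNIV] exI[of _ "6 * (2 * L)"]) auto
  qed simp
  moreover have "cball 0 s \<subseteq> P ` K s"
  proof
    fix p :: "real^'n" assume "p \<in> cball 0 s"
    then have p: "norm p \<le> s" by simp
    obtain x where x: "\<And>y. f y \<le> f x + p \<bullet> (y - x)" using contact_exists by blast
    then have xK: "x \<in> K s" using p by (auto simp: K_def)
    have "norm (p - P x) \<le> 6 * (2 * L) * norm (x - x)"
      by (rule gradients_lipschitz[OF L2 contact_expansion(2)[OF x] e[OF xK]])
    then have "p = P x" by simp
    then show "p \<in> P ` K s" using xK by blast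
  qed
  ultimately have "negligible (cball (0::real^'n) s)" by (rule negligible_subset)
  then have "negligible (ball (0::real^'n) s)" by (rule negligible_subset) auto
  then show False using open_not_negligible[of "ball (0::real^'n) s"] assms by simp
qed

definition R0 :: real where "R0 = norm xs + (1 + \<bar>B - f 0\<bar>)"

text \<open>With slopes this small, passing from a contact point to \<open>xs\<close> across a
  distance of at most \<open>R0\<close> changes the supporting plane by less than half of
  \<open>f xs - \<mu>\<close>. This keeps \<open>K s0\<close> in the region where the tests
  apply.\<close>

definition s0 :: real where "s0 = min 1 ((f xs - \<mu>) / (2 * (R0 + 1)))"

lemma R0: "0 \<le> R0"
  unfolding R0_def by (intro add_nonneg_nonneg) auto

lemma s0: "0 < s0" "s0 \<le> 1"
  using high R0 by (auto simp: s0_def f_def intro!: divide_pos_pos)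

lemma K_high: assumes "x \<in> K s0" shows "\<mu> < f x"
proof -
  obtain p where p: "norm p \<le> s0" "f xs \<le> f x + p \<bullet> (xs - x)" using assms unfolding K_def by blast
  have "norm (xs - x) \<le> R0"
    using norm_triangle_ineq4[of xs x] K_bounded[OF assms s0(2)] unfolding R0_def by linarith
  have "p \<bullet> (xs - x) \<le> norm p * norm (xs - x)" using Cauchy_Schwarz_ineq2[of p "xs - x"] by linarith
  also have "\<dots> \<le> s0 * R0"
    using p(1) \<open>norm (xs - x) \<le> R0\<close> s0 by (intro mult_mono) auto
  also have "\<dots> \<le> ((f xs - \<mu>) / (2 * (R0 + 1))) * R0"
    using R0 by (intro mult_right_mono) (auto simp: s0_def)
  also have "\<dots> = (f xs - \<mu>) * (R0 / (2 * (R0 + 1)))" by simp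
  also have "\<dots> < (f xs - \<mu>) * 1"
    using R0 high by (intro mult_strict_left_mono) (auto simp: f_def divide_less_eq)
  finally show ?thesis using p(2) by simp
qed

text \<open>Blow-ups of \<open>a\<close> at places where contact points are dense; testing finitely many points at a
  time makes the class closed for pointwise convergence.\<close>

definition dense_at :: "real \<Rightarrow> real \<Rightarrow> real^'n \<Rightarrow> real \<Rightarrow> bool" where
  "dense_at \<epsilon> R x r \<longleftrightarrow> (\<forall>y\<in>cball x (R * r). \<exists>z\<in>K s0. dist y z \<le> \<epsilon> * r)"

definition blowups :: "(real^'n \<Rightarrow> real) set" where
  "blowups = {t. \<forall>\<epsilon>>0. \<forall>R Y. finite Y \<longrightarrow> (\<exists>x r c p. 0 < r \<and> r < \<epsilon> \<and> dense_at \<epsilon> R x r \<and>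
      (\<forall>y\<in>Y. \<bar>a (x + r *\<^sub>R y) - c - p \<bullet> y - r\<^sup>2 * t y\<bar> \<le> \<epsilon> * r\<^sup>2))}"

lemma blowupsD:
  assumes "t \<in> blowups" "0 < \<epsilon>" "finite Y"
  obtains x r c p where "0 < r" "r < \<epsilon>" "dense_at \<epsilon> R x r"
    "\<And>y. y \<in> Y \<Longrightarrow> \<bar>a (x + r *\<^sub>R y) - c - p \<bullet> y - r\<^sup>2 * t y\<bar> \<le> \<epsilon> * r\<^sup>2"
proof -
  have "\<forall>\<epsilon>>0. \<forall>R Y. finite Y \<longrightarrow> (\<exists>x r c p. 0 < r \<and> r < \<epsilon> \<and> dense_at \<epsilon> R x r \<and>
      (\<forall>y\<in>Y. \<bar>a (x + r *\<^sub>R y) - c - p \<bullet> y - r\<^sup>2 * t y\<bar> \<le> \<epsilon> * r\<^sup>2))"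
    using assms(1) by (simp only: blowups_def mem_Collect_eq)
  from this[rule_format, OF assms(2,3), of R] obtain x r c p where "0 < r" "r < \<epsilon>" "dense_at \<epsilon> R x r"
    "\<forall>y\<in>Y. \<bar>a (x + r *\<^sub>R y) - c - p \<bullet> y - r\<^sup>2 * t y\<bar> \<le> \<epsilon> * r\<^sup>2"
    by (elim exE conjE)
  then show thesis by (intro that[of r x c p]) auto
qed

lemma dense_at_mono:
  assumes "\<epsilon> \<le> \<epsilon>'" "0 \<le> r" "dense_at \<epsilon> R x r" shows "dense_at \<epsilon>' R x r"
  unfolding dense_at_def
proof
  fix y assume "y \<in> cball x (R * r)"
  then obtain z where z: "z \<in> K s0" "dist y z \<le> \<epsilon> * r" using assms(3) unfolding dense_at_def by blast
  have "\<epsilon> * r \<le> \<epsilon>' * r" using assms by (intro mult_right_mono)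
  then show "\<exists>z\<in>K s0. dist y z \<le> \<epsilon>' * r" using z by force
qed

text \<open>If \<open>t\<close> fails the test at a finite set with tolerance
  \<open>\<epsilon>\<close>, then any function within \<open>\<epsilon> / 2\<close> of
  \<open>t\<close> on that set fails it with tolerance \<open>\<epsilon> / 2\<close>.\<close>

lemma blowups_closed: "closed blowups"
  unfolding closed_def
proof (subst open_subopen, intro ballI)
  fix t assume "t \<in> - blowups"
  then obtain \<epsilon> R Y where \<epsilon>: "0 < \<epsilon>" and Y: "finite Y" and
    no: "\<not> (\<exists>x r c p. 0 < r \<and> r < \<epsilon> \<and> dense_at \<epsilon> R x r \<and>
        (\<forall>y\<in>Y. \<bar>a (x + r *\<^sub>R y) - c - p \<bullet> y - r\<^sup>2 * t y\<bar> \<le> \<epsilon> * r\<^sup>2))"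
    unfolding blowups_def by blast
  define e where "e = \<epsilon> / 2"
  have e: "0 < e" "e < \<epsilon>" using \<epsilon> by (auto simp: e_def)
  let ?U = "\<Inter>y\<in>Y. {t'. \<bar>t' y - t y\<bar> < e}"
  have "open ?U"
    using Y by (intro open_INT ballI open_Collect_less continuous_intros continuous_on_product_coordinates) auto
  moreover have "t \<in> ?U" using e by simp
  moreover have "?U \<subseteq> - blowups"
  proof
    fix t' assume t': "t' \<in> ?U"
    show "t' \<in> - blowups"
    proof
      assume "t' \<in> blowups"
      then obtain x r c p where r: "0 < r" "r < e" "dense_at e R x r"
        and a: "\<And>y. y \<in> Y \<Longrightarrow> \<bar>a (x + r *\<^sub>R y) - c - p \<bullet> y - r\<^sup>2 * t' y\<bar> \<le> e * r\<^sup>2"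
        using blowupsD[of t' e Y R] e Y by metis
      have "dense_at \<epsilon> R x r" using e r by (intro dense_at_mono[OF _ _ r(3)]) auto
      moreover have "r < \<epsilon>" using r(2) e(2) by linarith
      moreover have "\<bar>a (x + r *\<^sub>R y) - c - p \<bullet> y - r\<^sup>2 * t y\<bar> \<le> \<epsilon> * r\<^sup>2" if y: "y \<in> Y" for y
      proof -
        have "\<bar>r\<^sup>2 * t' y - r\<^sup>2 * t y\<bar> = r\<^sup>2 * \<bar>t' y - t y\<bar>" by (simp add: right_diff_distrib[symmetric] abs_mult)
        also have "\<dots> \<le> r\<^sup>2 * e" using t' y by (intro mult_left_mono) (auto intro: less_imp_le)
        finally have "\<bar>r\<^sup>2 * t' y - r\<^sup>2 * t y\<bar> \<le> r\<^sup>2 * e" .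
        moreover have "\<epsilon> * r\<^sup>2 = e * r\<^sup>2 + r\<^sup>2 * e" by (simp add: e_def)
        ultimately show ?thesis using a[OF y] by linarith
      qed
      ultimately show False using no r(1) by blast
    qed
  qed
  ultimately show "\<exists>U. open U \<and> t \<in> U \<and> U \<subseteq> - blowups" by blast
qed

lemma blowups_affine:
  assumes t: "t \<in> blowups" shows "(\<lambda>y. t y + c0 + p0 \<bullet> y) \<in> blowups"
  unfolding blowups_def
proof (intro CollectI allI impI)
  fix \<epsilon> R :: real and Y :: "(real^'n) set" assume "0 < \<epsilon>" "finite Y"
  then obtain x r c p where r: "0 < r" "r < \<epsilon>" "dense_at \<epsilon> R x r"
    and a: "\<And>y. y \<in> Y \<Longrightarrow> \<bar>a (x + r *\<^sub>R y) - c - p \<bullet> y - r\<^sup>2 * t y\<bar> \<le> \<epsilon> * r\<^sup>2"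
    using blowupsD[OF t, of \<epsilon> Y R] by metis
  have "\<bar>a (x + r *\<^sub>R y) - (c - r\<^sup>2 * c0) - (p - r\<^sup>2 *\<^sub>R p0) \<bullet> y - r\<^sup>2 * (t y + c0 + p0 \<bullet> y)\<bar> \<le> \<epsilon> * r\<^sup>2"
    if "y \<in> Y" for y
    using a[OF that] by (simp add: algebra_simps inner_diff_left)
  then show "\<exists>x r c p. 0 < r \<and> r < \<epsilon> \<and> dense_at \<epsilon> R x r \<and>
      (\<forall>y\<in>Y. \<bar>a (x + r *\<^sub>R y) - c - p \<bullet> y - r\<^sup>2 * (t y + c0 + p0 \<bullet> y)\<bar> \<le> \<epsilon> * r\<^sup>2)"
    using r by (intro exI[of _ x] exI[of _ r] exI[of _ "c - r\<^sup>2 * c0"] exI[of _ "p - r\<^sup>2 *\<^sub>R p0"]) auto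
qed

lemma blowups_translate:
  assumes t: "t \<in> blowups" shows "(\<lambda>y. t (z + y)) \<in> blowups"
  unfolding blowups_def
proof (intro CollectI allI impI)
  fix \<epsilon> R :: real and Y :: "(real^'n) set" assume "0 < \<epsilon>" "finite Y"
  \<comment> \<open>Enlarging the density radius by \<open>norm z\<close> makes the ball about the
    shifted centre fall inside the old one.\<close>
  then obtain x r c p where r: "0 < r" "r < \<epsilon>" "dense_at \<epsilon> (R + norm z) x r"
    and a: "\<And>y. y \<in> (+) z ` Y \<Longrightarrow> \<bar>a (x + r *\<^sub>R y) - c - p \<bullet> y - r\<^sup>2 * t y\<bar> \<le> \<epsilon> * r\<^sup>2"
    using blowupsD[OF t, of \<epsilon> "(+) z ` Y" "R + norm z"] by (metis finite_imageI)
  let ?x = "x + r *\<^sub>R z"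
  have "cball ?x (R * r) \<subseteq> cball x ((R + norm z) * r)"
  proof
    fix y assume "y \<in> cball ?x (R * r)"
    moreover have "dist x ?x = norm z * r" using r(1) by (simp add: dist_norm)
    ultimately show "y \<in> cball x ((R + norm z) * r)"
      using dist_triangle[of x y ?x] by (simp add: distrib_right)
  qed
  then have "dense_at \<epsilon> R ?x r" using r(3) unfolding dense_at_def by blast
  moreover have "\<bar>a (?x + r *\<^sub>R y) - (c + p \<bullet> z) - p \<bullet> y - r\<^sup>2 * t (z + y)\<bar> \<le> \<epsilon> * r\<^sup>2" if "y \<in> Y" for y
    using a[of "z + y"] that by (simp add: scaleR_add_right inner_add_right add.assoc algebra_simps)
  ultimately show "\<exists>x r c p. 0 < r \<and> r < \<epsilon> \<and> dense_at \<epsilon> R x r \<and>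
      (\<forall>y\<in>Y. \<bar>a (x + r *\<^sub>R y) - c - p \<bullet> y - r\<^sup>2 * t (z + y)\<bar> \<le> \<epsilon> * r\<^sup>2)"
    using r by (intro exI[of _ ?x] exI[of _ r] exI[of _ "c + p \<bullet> z"] exI[of _ p]) auto
qed

lemma blowups_zoom:
  assumes t: "t \<in> blowups" and s: "0 < s" shows "(\<lambda>y. t (s *\<^sub>R y) / s\<^sup>2) \<in> blowups"
  unfolding blowups_def
proof (intro CollectI allI impI)
  fix \<epsilon> R :: real and Y :: "(real^'n) set" assume \<epsilon>: "0 < \<epsilon>" and Y: "finite Y"
  \<comment> \<open>The three bounds serve, in order, the smallness of the new scale
    \<open>r * s\<close>, the density of contact points at that scale, and the approximation
    error.\<close>
  define \<epsilon>' where "\<epsilon>' = min (\<epsilon> / s) (min (\<epsilon> * s) (\<epsilon> * s\<^sup>2))"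
  have \<epsilon>': "0 < \<epsilon>'" "\<epsilon>' \<le> \<epsilon> / s" "\<epsilon>' \<le> \<epsilon> * s" "\<epsilon>' \<le> \<epsilon> * s\<^sup>2" using \<epsilon> s by (auto simp: \<epsilon>'_def)
  obtain x r c p where r: "0 < r" "r < \<epsilon>'" "dense_at \<epsilon>' (R * s) x r"
    and a: "\<And>y. y \<in> (*\<^sub>R) s ` Y \<Longrightarrow> \<bar>a (x + r *\<^sub>R y) - c - p \<bullet> y - r\<^sup>2 * t y\<bar> \<le> \<epsilon>' * r\<^sup>2"
    using blowupsD[OF t \<epsilon>'(1), of "(*\<^sub>R) s ` Y" "R * s"] Y by (metis finite_imageI)
  have "r < \<epsilon> / s" using r(2) \<epsilon>'(2) by (rule order_less_le_trans)
  then have r': "0 < r * s" "r * s < \<epsilon>" using r(1) s by (auto simp: pos_less_divide_eq)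
  have "dense_at \<epsilon> R x (r * s)"
    unfolding dense_at_def
  proof
    fix y assume y: "y \<in> cball x (R * (r * s))"
    have "R * (r * s) = R * s * r" by simp
    then obtain z where "z \<in> K s0" "dist y z \<le> \<epsilon>' * r"
      using r(3) y unfolding dense_at_def by metis
    moreover have "\<epsilon>' * r \<le> \<epsilon> * (r * s)" using mult_right_mono[OF \<epsilon>'(3), of r] r(1) by (simp add: ac_simps)
    ultimately show "\<exists>z\<in>K s0. dist y z \<le> \<epsilon> * (r * s)" by force
  qed
  moreover have "\<bar>a (x + (r * s) *\<^sub>R y) - c - (s *\<^sub>R p) \<bullet> y - (r * s)\<^sup>2 * (t (s *\<^sub>R y) / s\<^sup>2)\<bar> \<le> \<epsilon> * (r * s)\<^sup>2"
    if "y \<in> Y" for y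
  proof -
    have "\<epsilon>' * r\<^sup>2 \<le> \<epsilon> * (r * s)\<^sup>2"
      using mult_right_mono[OF \<epsilon>'(4), of "r\<^sup>2"] by (simp add: power_mult_distrib ac_simps)
    moreover have "\<bar>a (x + r *\<^sub>R (s *\<^sub>R y)) - c - p \<bullet> (s *\<^sub>R y) - r\<^sup>2 * t (s *\<^sub>R y)\<bar> \<le> \<epsilon>' * r\<^sup>2"
      by (rule a) (use that in blast)
    moreover have "(r * s)\<^sup>2 * (t (s *\<^sub>R y) / s\<^sup>2) = r\<^sup>2 * t (s *\<^sub>R y)" using s by (simp add: power_mult_distrib)
    ultimately show ?thesis by simp
  qed
  ultimately show "\<exists>x r c p. 0 < r \<and> r < \<epsilon> \<and> dense_at \<epsilon> R x r \<and>
      (\<forall>y\<in>Y. \<bar>a (x + r *\<^sub>R y) - c - p \<bullet> y - r\<^sup>2 * (t (s *\<^sub>R y) / s\<^sup>2)\<bar> \<le> \<epsilon> * r\<^sup>2)"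
    using r' by (intro exI[of _ x] exI[of _ "r * s"] exI[of _ c] exI[of _ "s *\<^sub>R p"]) auto
qed

text \<open>In coordinates rescaled by \<open>r\<close>, every point of the ball is within
  \<open>\<epsilon>\<close> of a contact point, where the two-sided expansion holds globally with
  constant \<open>L * r\<^sup>2\<close>.\<close>

lemma near_contact_expansion:
  assumes r: "0 < r" and dn: "dense_at \<epsilon> R x r" and z: "norm z \<le> R"
  obtains \<eta> q where "norm (\<eta> - z) \<le> \<epsilon>" "x + r *\<^sub>R \<eta> \<in> K s0"
    "\<And>y. \<bar>a (x + r *\<^sub>R y) - a (x + r *\<^sub>R \<eta>) - q \<bullet> (y - \<eta>)\<bar> \<le> L * r\<^sup>2 * (norm (y - \<eta>))\<^sup>2"
proof -
  have "x + r *\<^sub>R z \<in> cball x (R * r)" using z r by (simp add: dist_norm mult.commute)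
  then obtain k where k: "k \<in> K s0" "dist (x + r *\<^sub>R z) k \<le> \<epsilon> * r" using dn unfolding dense_at_def by blast
  define \<eta> where "\<eta> = (1 / r) *\<^sub>R (k - x)"
  have \<eta>: "x + r *\<^sub>R \<eta> = k" using r by (simp add: \<eta>_def)
  have "x + r *\<^sub>R z - k = r *\<^sub>R (z - \<eta>)" unfolding \<eta>[symmetric] by (simp add: scaleR_diff_right)
  then have "norm (z - \<eta>) \<le> \<epsilon>" using k(2) r by (simp add: dist_norm mult.commute)
  then have 1: "norm (\<eta> - z) \<le> \<epsilon>" by (simp add: norm_minus_commute)
  obtain q where q: "\<And>y. \<bar>a y - a k - q \<bullet> (y - k)\<bar> \<le> L * (norm (y - k))\<^sup>2"
    using K_expansion[OF k(1)] by blast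
  have "\<bar>a (x + r *\<^sub>R y) - a (x + r *\<^sub>R \<eta>) - (r *\<^sub>R q) \<bullet> (y - \<eta>)\<bar> \<le> L * r\<^sup>2 * (norm (y - \<eta>))\<^sup>2" for y
  proof -
    have "x + r *\<^sub>R y - k = r *\<^sub>R (y - \<eta>)" unfolding \<eta>[symmetric] by (simp add: scaleR_diff_right)
    then show ?thesis using q[of "x + r *\<^sub>R y"] r by (simp add: \<eta> power_mult_distrib ac_simps)
  qed
  then show ?thesis using that 1 k(1) \<eta> by metis
qed

text \<open>A blow-up only controls finitely many points at a time, so each finite test yields its
  own approximate slope. These slopes lie in a fixed ball, and the finite intersection property
  supplies one slope for all points and tolerances.\<close>

lemma blowups_paraboloid_bounded:
  assumes t: "t \<in> blowups" shows "paraboloid_bounded L t"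
  unfolding paraboloid_bounded_def
proof
  fix z :: "real^'n"
  \<comment> \<open>The terms with \<open>L\<close> are the cost of replacing \<open>z\<close> by a
    contact point within \<open>\<delta>\<close>; the 2 accounts for the approximation errors at
    \<open>y\<close> and at \<open>z\<close>.\<close>
  define e where "e y \<delta> = \<delta> * (2 * L * (norm (y - z) + 1) + 2)" for y \<delta>
  have approx: "\<exists>q. \<forall>y\<in>Y. \<bar>t y - t z - q \<bullet> (y - z)\<bar> \<le> L * (norm (y - z))\<^sup>2 + e y \<epsilon>"
    if Y: "finite Y" and \<epsilon>: "0 < \<epsilon>" "\<epsilon> \<le> 1" for Y \<epsilon>
  proof -
    obtain x r c p where r: "0 < r" "r < \<epsilon>" "dense_at \<epsilon> (norm z) x r"
      and a: "\<And>y. y \<in> insert z Y \<Longrightarrow> \<bar>a (x + r *\<^sub>R y) - c - p \<bullet> y - r\<^sup>2 * t y\<bar> \<le> \<epsilon> * r\<^sup>2"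
      using blowupsD[OF t \<epsilon>(1), of "insert z Y" "norm z"] Y by (metis finite_insert)
    obtain \<eta> q where \<eta>: "norm (\<eta> - z) \<le> \<epsilon>" and
      q: "\<And>y. \<bar>a (x + r *\<^sub>R y) - a (x + r *\<^sub>R \<eta>) - q \<bullet> (y - \<eta>)\<bar> \<le> L * r\<^sup>2 * (norm (y - \<eta>))\<^sup>2"
      using near_contact_expansion[OF r(1,3) order_refl] by metis
    define q' where "q' = (1 / r\<^sup>2) *\<^sub>R (q - p)"
    have rq: "r\<^sup>2 *\<^sub>R q' = q - p" using r by (simp add: q'_def)
    have "\<bar>t y - t z - q' \<bullet> (y - z)\<bar> \<le> L * (norm (y - z))\<^sup>2 + e y \<epsilon>" if y: "y \<in> Y" for y
    proof -
      let ?n = "norm (y - z)"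
      have e2: "\<epsilon>\<^sup>2 \<le> \<epsilon>" using \<epsilon> by (simp add: power2_eq_square mult_left_le)
      have "norm (y - \<eta>) \<le> ?n + \<epsilon>" using norm_triangle_ineq4[of "y - z" "\<eta> - z"] \<eta> by simp
      then have "(norm (y - \<eta>))\<^sup>2 \<le> (?n + \<epsilon>)\<^sup>2" by (intro power_mono) auto
      also have "\<dots> \<le> ?n\<^sup>2 + \<epsilon> * (2 * ?n + 1)" using e2 by (simp add: power2_sum algebra_simps)
      finally have 1: "(norm (y - \<eta>))\<^sup>2 \<le> ?n\<^sup>2 + \<epsilon> * (2 * ?n + 1)" .
      have "(norm (z - \<eta>))\<^sup>2 \<le> \<epsilon>\<^sup>2" using \<eta> by (intro power_mono) (auto simp: norm_minus_commute)
      then have 2: "(norm (z - \<eta>))\<^sup>2 \<le> \<epsilon>" using e2 by linarith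
      have "L * r\<^sup>2 * (norm (y - \<eta>))\<^sup>2 + L * r\<^sup>2 * (norm (z - \<eta>))\<^sup>2 \<le>
          L * r\<^sup>2 * (?n\<^sup>2 + \<epsilon> * (2 * ?n + 1)) + L * r\<^sup>2 * \<epsilon>"
        using 1 2 L by (intro add_mono mult_left_mono) auto
      moreover have "r\<^sup>2 * (t y - t z - q' \<bullet> (y - z)) = r\<^sup>2 * t y - r\<^sup>2 * t z - (q - p) \<bullet> (y - z)"
        unfolding rq[symmetric] by (simp add: right_diff_distrib)
      moreover have "(q - p) \<bullet> (y - z) = q \<bullet> (y - \<eta>) - q \<bullet> (z - \<eta>) - p \<bullet> y + p \<bullet> z"
        by (simp add: inner_diff_left inner_diff_right)
      ultimately have "\<bar>r\<^sup>2 * (t y - t z - q' \<bullet> (y - z))\<bar> \<le>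
          L * r\<^sup>2 * (?n\<^sup>2 + \<epsilon> * (2 * ?n + 1)) + L * r\<^sup>2 * \<epsilon> + 2 * (\<epsilon> * r\<^sup>2)"
        using a[of y] a[of z] q[of y] q[of z] y by auto
      also have "\<dots> = r\<^sup>2 * (L * ?n\<^sup>2 + e y \<epsilon>)" by (simp add: e_def algebra_simps)
      finally have "r\<^sup>2 * \<bar>t y - t z - q' \<bullet> (y - z)\<bar> \<le> r\<^sup>2 * (L * ?n\<^sup>2 + e y \<epsilon>)" by (simp add: abs_mult)
      then show ?thesis using r by simp
    qed
    then show ?thesis by blast
  qed
  \<comment> \<open>Testing at \<open>z\<close> plus the basis vectors bounds every coordinate of an
    approximate slope independently of the finite set.\<close>
  define M where "M = (\<Sum>b\<in>Basis. \<bar>t (z + b) - t z\<bar> + L + e (z + b) 1)"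
  define C where "C = (\<lambda>(y, \<delta>). {q. \<bar>t y - t z - q \<bullet> (y - z)\<bar> \<le> L * (norm (y - z))\<^sup>2 + e y \<delta>})"
  have e_mono: "e y \<delta> \<le> e y \<delta>'" if "\<delta> \<le> \<delta>'" for y \<delta> \<delta>'
    unfolding e_def using that L by (intro mult_right_mono) (auto intro!: add_nonneg_nonneg mult_nonneg_nonneg)
  have "cball 0 M \<inter> (\<Inter>i\<in>UNIV \<times> {0<..}. C i) \<noteq> {}"
  proof (rule compact_imp_fip_image)
    show "closed (C i)" for i
      unfolding C_def case_prod_beta by (intro closed_Collect_le continuous_intros)
    fix I :: "((real^'n) \<times> real) set"
    assume I: "finite I" "I \<subseteq> UNIV \<times> {0<..}"
    define \<epsilon> where "\<epsilon> = Min (insert 1 (snd ` I))"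
    have \<epsilon>: "0 < \<epsilon>" "\<epsilon> \<le> 1" "\<And>i. i \<in> I \<Longrightarrow> \<epsilon> \<le> snd i" using I by (auto simp: \<epsilon>_def)
    obtain q where q: "\<And>y. y \<in> fst ` I \<union> (+) z ` Basis \<Longrightarrow> \<bar>t y - t z - q \<bullet> (y - z)\<bar> \<le> L * (norm (y - z))\<^sup>2 + e y \<epsilon>"
      using approx[of "fst ` I \<union> (+) z ` Basis" \<epsilon>] I \<epsilon> by (metis finite_Basis finite_UnI finite_imageI)
    have "norm q \<le> (\<Sum>b\<in>Basis. \<bar>q \<bullet> b\<bar>)" by (rule norm_le_l1)
    also have "\<dots> \<le> M" unfolding M_def
    proof (rule sum_mono)
      fix b :: "real^'n" assume b: "b \<in> Basis"
      then show "\<bar>q \<bullet> b\<bar> \<le> \<bar>t (z + b) - t z\<bar> + L + e (z + b) 1"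
        using q[of "z + b"] e_mono[OF \<epsilon>(2), of "z + b"] by auto
    qed
    finally have "q \<in> cball 0 M" by simp
    moreover have "q \<in> C i" if "i \<in> I" for i
      using q[of "fst i"] e_mono[OF \<epsilon>(3)[OF that], of "fst i"] that by (auto simp: C_def case_prod_beta)
    ultimately show "cball 0 M \<inter> (\<Inter>i\<in>I. C i) \<noteq> {}" by blast
  qed simp
  then obtain q where "q \<in> (\<Inter>i\<in>UNIV \<times> {0<..}. C i)" by blast
  then have "q \<in> C (y, \<delta>)" if "0 < \<delta>" for y \<delta> using that by auto
  then have q: "\<bar>t y - t z - q \<bullet> (y - z)\<bar> \<le> L * (norm (y - z))\<^sup>2 + e y \<delta>" if "0 < \<delta>" for y \<delta>
    using that by (simp add: C_def)
  have "\<bar>t y - t z - q \<bullet> (y - z)\<bar> \<le> L * (norm (y - z))\<^sup>2" for y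
  proof -
    have "((\<lambda>\<delta>. L * (norm (y - z))\<^sup>2 + e y \<delta>) \<longlongrightarrow> L * (norm (y - z))\<^sup>2 + e y 0) (at_right 0)"
      unfolding e_def by (intro tendsto_intros)
    then have "\<bar>t y - t z - q \<bullet> (y - z)\<bar> \<le> L * (norm (y - z))\<^sup>2 + e y 0"
      by (rule tendsto_lowerbound) (use q in \<open>auto simp: eventually_at_right_field intro!: exI[of _ 1]\<close>)
    then show ?thesis by (simp add: e_def)
  qed
  then show "\<exists>q. \<forall>y. \<bar>t y - t z - q \<bullet> (y - z)\<bar> \<le> L * (norm (y - z))\<^sup>2" by blast
qed

text \<open>Non-porous points of the contact set give scales with arbitrarily good density. The
  renormalizations of \<open>a\<close> there obey a fixed quadratic bound, and any cluster point of
  them is a blow-up.\<close>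

lemma blowups_nonempty: "blowups \<noteq> {}"
proof -
  have "\<exists>x r q. 0 < r \<and> r < 1 / (real n + 1) \<and> dense_at (1 / (real n + 1)) (real n + 1) x r \<and>
      (\<forall>y. \<bar>a (x + r *\<^sub>R y) - a x - r * (q \<bullet> y)\<bar> \<le> L * (norm y)\<^sup>2 * r\<^sup>2)" for n :: nat
  proof -
    let ?\<epsilon> = "1 / (real n + 1)"
    obtain x \<rho> where x: "x \<in> K s0" and \<rho>: "0 < \<rho>" "\<rho> < ?\<epsilon>" and
      dn: "\<forall>y\<in>cball x \<rho>. \<exists>z\<in>K s0. dist y z \<le> (?\<epsilon> / (real n + 1)) * \<rho>"
      using nonporous_point[OF K_compact[OF s0(2)] K_not_negligible[OF s0(1)], of "?\<epsilon> / (real n + 1)" ?\<epsilon>] by auto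
    \<comment> \<open>Shrinking the scale by \<open>real n + 1\<close> trades part of the precision
      for a large window: the ball of radius \<open>\<rho>\<close> becomes \<open>real n + 1\<close>
      units wide, and holes of relative size \<open>1 / (real n + 1)^2\<close> become holes of
      relative size \<open>1 / (real n + 1)\<close>.\<close>
    define r where "r = \<rho> / (real n + 1)"
    have r: "0 < r" "r \<le> \<rho>" "(real n + 1) * r = \<rho>" using \<rho> by (auto simp: r_def divide_le_eq)
    have "dense_at ?\<epsilon> (real n + 1) x r"
      unfolding dense_at_def r(3) using dn by (simp add: r_def)
    moreover obtain q where "\<And>y. \<bar>a y - a x - q \<bullet> (y - x)\<bar> \<le> L * (norm (y - x))\<^sup>2"
      using K_expansion[OF x] by blast
    then have "\<bar>a (x + r *\<^sub>R y) - a x - r * (q \<bullet> y)\<bar> \<le> L * (norm y)\<^sup>2 * r\<^sup>2" for y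
    proof -
      have "\<bar>a (x + r *\<^sub>R y) - a x - q \<bullet> (r *\<^sub>R y)\<bar> \<le> L * (norm (r *\<^sub>R y))\<^sup>2"
        using \<open>\<And>y. \<bar>a y - a x - q \<bullet> (y - x)\<bar> \<le> L * (norm (y - x))\<^sup>2\<close>[of "x + r *\<^sub>R y"] by simp
      then show ?thesis by (simp add: power_mult_distrib ac_simps)
    qed
    ultimately show ?thesis using r \<rho> by (intro exI[of _ x] exI[of _ r] exI[of _ q]) auto
  qed
  then obtain x r q where r: "\<And>n. 0 < r n" "\<And>n. r n < 1 / (real n + 1)"
    and dn: "\<And>n. dense_at (1 / (real n + 1)) (real n + 1) (x n) (r n)"
    and q: "\<And>n y. \<bar>a (x n + r n *\<^sub>R y) - a (x n) - r n * (q n \<bullet> y)\<bar> \<le> L * (norm y)\<^sup>2 * (r n)\<^sup>2"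
    by metis
  define T where "T n y = (a (x n + r n *\<^sub>R y) - a (x n) - r n * (q n \<bullet> y)) / (r n)\<^sup>2" for n y
  have TL: "T n \<in> {t. \<forall>y. \<bar>t y\<bar> \<le> L * (norm y)\<^sup>2}" for n
    using q[of n] r(1)[of n] by (auto simp: T_def abs_divide divide_le_eq)
  obtain t where "\<forall>D. closed D \<longrightarrow> (\<forall>\<^sub>F n in sequentially. T n \<in> D) \<longrightarrow> t \<in> D"
    using compact_cluster_point[where s=T, OF compact_pointwise_bounded TL] by (elim bexE)
  then have cl: "\<And>D. closed D \<Longrightarrow> (\<forall>\<^sub>F n in sequentially. T n \<in> D) \<Longrightarrow> t \<in> D" by simp
  have "t \<in> blowups"
    unfolding blowups_def
  proof (intro CollectI allI impI)
    fix \<epsilon> R :: real and Y :: "(real^'n) set" assume \<epsilon>: "0 < \<epsilon>" and Y: "finite Y"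
    obtain N :: nat where N: "max (1 / \<epsilon>) R < real N" using reals_Archimedean2 by blast
    \<comment> \<open>If all late terms missed the tolerance at some point of \<open>Y\<close>, they
      would lie in a finite union of closed sets that does not contain \<open>t\<close>.\<close>
    have "\<exists>n\<ge>N. \<forall>y\<in>Y. \<bar>T n y - t y\<bar> < \<epsilon>"
    proof (rule ccontr)
      assume no: "\<not> ?thesis"
      let ?D = "\<Union>y\<in>Y. {t'. \<epsilon> \<le> \<bar>t' y - t y\<bar>}"
      have "closed ?D"
        using Y by (intro closed_UN ballI closed_Collect_le continuous_intros continuous_on_product_coordinates) auto
      moreover have "\<forall>\<^sub>F n in sequentially. T n \<in> ?D"
        using no by (auto simp: eventually_sequentially not_less intro!: exI[of _ N])
      ultimately have "t \<in> ?D" by (rule cl)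
      then show False using \<epsilon> by simp
    qed
    then obtain n where n: "n \<ge> N" "\<And>y. y \<in> Y \<Longrightarrow> \<bar>T n y - t y\<bar> < \<epsilon>" by blast
    have "1 / \<epsilon> < real n + 1" "R \<le> real n + 1" using N n(1) by linarith+
    then have \<epsilon>n: "1 / (real n + 1) \<le> \<epsilon>" and Rn: "R \<le> real n + 1"
      using \<epsilon> by (auto simp: field_simps)
    have "dense_at \<epsilon> R (x n) (r n)"
      unfolding dense_at_def
    proof
      fix y assume "y \<in> cball (x n) (R * r n)"
      moreover have "R * r n \<le> (real n + 1) * r n" using Rn r(1)[of n] by (intro mult_right_mono) auto
      ultimately have "y \<in> cball (x n) ((real n + 1) * r n)" by simp
      then obtain z where "z \<in> K s0" "dist y z \<le> 1 / (real n + 1) * r n" using dn[of n] unfolding dense_at_def by blast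
      moreover have "1 / (real n + 1) * r n \<le> \<epsilon> * r n" using \<epsilon>n r(1)[of n] by (intro mult_right_mono) auto
      ultimately show "\<exists>z\<in>K s0. dist y z \<le> \<epsilon> * r n" by force
    qed
    moreover have "\<bar>a (x n + r n *\<^sub>R y) - a (x n) - (r n *\<^sub>R q n) \<bullet> y - (r n)\<^sup>2 * t y\<bar> \<le> \<epsilon> * (r n)\<^sup>2" if "y \<in> Y" for y
    proof -
      have "a (x n + r n *\<^sub>R y) - a (x n) - (r n *\<^sub>R q n) \<bullet> y - (r n)\<^sup>2 * t y = (r n)\<^sup>2 * (T n y - t y)"
      proof -
        have "(r n)\<^sup>2 * T n y = a (x n + r n *\<^sub>R y) - a (x n) - r n * (q n \<bullet> y)"
          using r(1)[of n] by (simp add: T_def)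
        then show ?thesis by (simp add: right_diff_distrib)
      qed
      moreover have "(r n)\<^sup>2 * \<bar>T n y - t y\<bar> \<le> (r n)\<^sup>2 * \<epsilon>"
        using n(2)[OF that] by (intro mult_left_mono) auto
      ultimately show ?thesis by (simp add: abs_mult mult.commute)
    qed
    ultimately show "\<exists>x r c p. 0 < r \<and> r < \<epsilon> \<and> dense_at \<epsilon> R x r \<and>
        (\<forall>y\<in>Y. \<bar>a (x + r *\<^sub>R y) - c - p \<bullet> y - r\<^sup>2 * t y\<bar> \<le> \<epsilon> * r\<^sup>2)"
      using r(1)[of n] order_less_le_trans[OF r(2)[of n] \<epsilon>n] by blast
  qed
  then show ?thesis by blast
qed

section \<open>Touching paraboloids at the blow-up scale\<close>

lemma blowup_class_blowups: "blowup_class blowups L"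
  by unfold_locales (use blowups_closed blowups_nonempty L blowups_paraboloid_bounded blowups_affine
      blowups_translate blowups_zoom in auto)

text \<open>A net of the unit ball suffices: the expansions at nearby contact points bound the
  slopes of the rescaled function, and this carries the approximation from the net to the whole
  ball.\<close>

lemma blowup_uniform:
  assumes A: "(\<lambda>y. y \<bullet> (A *v y) / 2) \<in> blowups" and \<theta>: "0 < \<theta>"
  obtains x r c p where "0 < r" "r < 1" "dense_at \<theta> 1 x r"
    "\<And>y. norm y \<le> 1 \<Longrightarrow> \<bar>a (x + r *\<^sub>R y) - c - p \<bullet> y - r\<^sup>2 * (y \<bullet> (A *v y) / 2)\<bar> \<le> 3 * \<theta> * r\<^sup>2"
proof -
  let ?q = "\<lambda>y. y \<bullet> (A *v y) / 2"
  have "uniformly_continuous_on (cball 0 1) ?q"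
    by (intro compact_uniformly_continuous continuous_intros
        bounded_linear.continuous_on[OF matrix_vector_mul_bounded_linear]) auto
  then obtain \<delta>0 where \<delta>0: "\<delta>0 > 0"
    "\<And>y y'. norm y \<le> 1 \<Longrightarrow> norm y' \<le> 1 \<Longrightarrow> dist y' y < \<delta>0 \<Longrightarrow> dist (?q y') (?q y) < \<theta>"
    unfolding uniformly_continuous_on_def using \<theta> by (metis dist_0_norm mem_cball)
  \<comment> \<open>Bounds the slope at a contact point near 0, read off from the values at 0 and at
    the basis vectors. In \<open>C\<close> the summand \<open>18 * L\<close> is the variation of
    slopes over distance 3, and \<open>5 * L\<close> collects the quadratic errors at the two points
    compared.\<close>
  define M where "M = (\<Sum>b\<in>Basis. (5 * L + 2 + \<bar>?q b\<bar>))"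
  define C where "C = (M + 18 * L) * 3 + 5 * L + 1"
  have "M \<ge> 0" unfolding M_def using L by (intro sum_nonneg) auto
  then have C: "C \<ge> 1" using L by (simp add: C_def)
  define \<delta> where "\<delta> = min (min (\<delta>0 / 2) 1) (min \<theta> (\<theta> / C))"
  have C0: "C > 0" using C by simp
  have "0 < \<theta> / C" using \<theta> C0 by simp
  then have \<delta>': "0 < \<delta>" "\<delta> \<le> \<delta>0 / 2" "\<delta> \<le> 1" "\<delta> \<le> \<theta>" "\<delta> \<le> \<theta> / C"
    unfolding \<delta>_def using \<delta>0(1) \<theta> order_trans[OF min.cobounded1 min.cobounded1]
    by (auto intro: min.coboundedI1 min.coboundedI2 simp del: le_divide_eq_numeral1)
  have \<delta>: "0 < \<delta>" "\<delta> < \<delta>0" "\<delta> \<le> 1" "\<delta> \<le> \<theta>" "C * \<delta> \<le> \<theta>"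
    using \<delta>' \<delta>0(1) C0 by (auto simp: pos_le_divide_eq mult.commute)
  obtain Y0 where Y0: "finite Y0" "Y0 \<subseteq> cball (0::real^'n) 1" "cball 0 1 \<subseteq> (\<Union>y\<in>Y0. ball y \<delta>)"
    using compactE_image[OF compact_cball[of "0::real^'n" 1], of "cball 0 1" "\<lambda>y. ball y \<delta>"] \<delta>(1)
    by (metis UN_I centre_in_ball open_ball subsetI)
  let ?Y = "Y0 \<union> insert 0 Basis"
  obtain x r c p where r: "0 < r" "r < \<delta>" "dense_at \<delta> 1 x r"
    and ap: "\<And>y. y \<in> ?Y \<Longrightarrow> \<bar>a (x + r *\<^sub>R y) - c - p \<bullet> y - r\<^sup>2 * ?q y\<bar> \<le> \<delta> * r\<^sup>2"
    using blowupsD[OF A \<delta>(1), of ?Y 1] Y0(1) by (metis finite_Basis finite_UnI finite_insert)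
  define \<alpha> where "\<alpha> y = (a (x + r *\<^sub>R y) - c - p \<bullet> y) / r\<^sup>2" for y
  have \<alpha>: "a (x + r *\<^sub>R y) - c - p \<bullet> y = r\<^sup>2 * \<alpha> y" for y using r by (simp add: \<alpha>_def)
  have \<alpha>q: "\<bar>\<alpha> y - ?q y\<bar> \<le> \<delta>" if "y \<in> ?Y" for y
  proof -
    have "r\<^sup>2 * \<bar>\<alpha> y - ?q y\<bar> \<le> r\<^sup>2 * \<delta>"
      using ap[OF that] unfolding \<alpha> by (simp only: right_diff_distrib[symmetric] abs_mult) (simp add: mult.commute)
    then show ?thesis using r(1) by simp
  qed
  have ex: "\<exists>\<eta> s. norm (\<eta> - z) \<le> \<delta> \<and> (\<forall>y. \<bar>\<alpha> y - \<alpha> \<eta> - s \<bullet> (y - \<eta>)\<bar> \<le> L * (norm (y - \<eta>))\<^sup>2)"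
    if nz: "norm z \<le> 1" for z
  proof -
    obtain \<eta> q where \<eta>: "norm (\<eta> - z) \<le> \<delta>" and
      q: "\<And>y. \<bar>a (x + r *\<^sub>R y) - a (x + r *\<^sub>R \<eta>) - q \<bullet> (y - \<eta>)\<bar> \<le> L * r\<^sup>2 * (norm (y - \<eta>))\<^sup>2"
      using near_contact_expansion[OF r(1,3) nz] by metis
    define s where "s = (1 / r\<^sup>2) *\<^sub>R (q - p)"
    have rs: "r\<^sup>2 *\<^sub>R s = q - p" using r(1) by (simp add: s_def)
    have "\<bar>\<alpha> y - \<alpha> \<eta> - s \<bullet> (y - \<eta>)\<bar> \<le> L * (norm (y - \<eta>))\<^sup>2" for y
    proof -
      have "r\<^sup>2 * (\<alpha> y - \<alpha> \<eta> - s \<bullet> (y - \<eta>)) = r\<^sup>2 * \<alpha> y - r\<^sup>2 * \<alpha> \<eta> - (q - p) \<bullet> (y - \<eta>)"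
        unfolding rs[symmetric] by (simp add: right_diff_distrib)
      also have "\<dots> = a (x + r *\<^sub>R y) - a (x + r *\<^sub>R \<eta>) - q \<bullet> (y - \<eta>)"
        unfolding \<alpha>[symmetric] by (simp add: inner_diff_left inner_diff_right)
      finally have "\<bar>r\<^sup>2 * (\<alpha> y - \<alpha> \<eta> - s \<bullet> (y - \<eta>))\<bar> \<le> L * r\<^sup>2 * (norm (y - \<eta>))\<^sup>2"
        using q[of y] by (simp only:)
      then have "r\<^sup>2 * \<bar>\<alpha> y - \<alpha> \<eta> - s \<bullet> (y - \<eta>)\<bar> \<le> r\<^sup>2 * (L * (norm (y - \<eta>))\<^sup>2)"
        by (simp only: abs_mult abs_power2) (simp only: ac_simps)
      then show ?thesis using r(1) by simp
    qed
    then show ?thesis using \<eta> by blast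
  qed
  obtain \<eta>0 s0' where \<eta>0: "norm (\<eta>0 - 0) \<le> \<delta>" and s0': "\<And>y. \<bar>\<alpha> y - \<alpha> \<eta>0 - s0' \<bullet> (y - \<eta>0)\<bar> \<le> L * (norm (y - \<eta>0))\<^sup>2"
    using ex[of 0] by auto
  have "norm s0' \<le> (\<Sum>b\<in>Basis. \<bar>s0' \<bullet> b\<bar>)" by (rule norm_le_l1)
  also have "\<dots> \<le> M" unfolding M_def
  proof (rule sum_mono)
    fix b :: "real^'n" assume b: "b \<in> Basis"
    have "norm (b - \<eta>0) \<le> 2" using norm_triangle_ineq4[of b \<eta>0] \<eta>0 \<delta> b by simp
    then have "(norm (b - \<eta>0))\<^sup>2 \<le> 2\<^sup>2" by (intro power_mono) auto
    then have 1: "L * (norm (b - \<eta>0))\<^sup>2 \<le> L * 4" using L by (intro mult_left_mono) auto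
    have "(norm (0 - \<eta>0))\<^sup>2 \<le> 1\<^sup>2" using \<eta>0 \<delta> by (intro power_mono) auto
    then have 2: "L * (norm (0 - \<eta>0))\<^sup>2 \<le> L * 1" using L by (intro mult_left_mono) auto
    have "s0' \<bullet> b = s0' \<bullet> (b - \<eta>0) - s0' \<bullet> (0 - \<eta>0)" by (simp add: inner_diff_right)
    moreover have "?q 0 = 0" by simp
    ultimately show "\<bar>s0' \<bullet> b\<bar> \<le> 5 * L + 2 + \<bar>?q b\<bar>"
      using s0'[of b] s0'[of 0] 1 2 \<alpha>q[of b] \<alpha>q[of 0] b \<delta>(3) by (simp add: abs_le_iff) linarith
  qed
  finally have sM: "norm s0' \<le> M" .
  have "\<bar>\<alpha> y - ?q y\<bar> \<le> 3 * \<theta>" if y: "norm y \<le> 1" for y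
  proof -
    obtain \<eta> s where \<eta>: "norm (\<eta> - y) \<le> \<delta>" and s: "\<And>y. \<bar>\<alpha> y - \<alpha> \<eta> - s \<bullet> (y - \<eta>)\<bar> \<le> L * (norm (y - \<eta>))\<^sup>2"
      using ex[OF y] by blast
    obtain y' where y': "y' \<in> Y0" "dist y' y < \<delta>" using Y0(3) y by (auto simp: subset_iff)
    have "norm (\<eta> - \<eta>0) \<le> 3"
      using norm_triangle_ineq4[of "\<eta> - y" "\<eta>0 - y"] norm_triangle_ineq4[of \<eta>0 y] \<eta> \<eta>0 y \<delta>(3) by simp
    then have "6 * L * norm (\<eta> - \<eta>0) \<le> 6 * L * 3" using L by (intro mult_left_mono) auto
    then have "norm s \<le> M + 18 * L"
      using gradients_lipschitz[OF L s s0'] norm_triangle_sub[of s s0'] sM by linarith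
    have yy: "norm (y - \<eta>) \<le> \<delta>" "norm (y' - \<eta>) \<le> 2 * \<delta>"
      using \<eta> y'(2) norm_triangle_ineq4[of "y' - y" "\<eta> - y"] by (auto simp: dist_norm norm_minus_commute)
    have "\<bar>s \<bullet> (y - y')\<bar> \<le> norm s * norm (y - y')" by (rule Cauchy_Schwarz_ineq2)
    also have "\<dots> \<le> (M + 18 * L) * \<delta>"
      using \<open>norm s \<le> M + 18 * L\<close> y'(2) L \<open>M \<ge> 0\<close> by (intro mult_mono) (auto simp: dist_norm norm_minus_commute)
    finally have 1: "\<bar>s \<bullet> (y - y')\<bar> \<le> (M + 18 * L) * \<delta>" .
    have "(norm (y - \<eta>))\<^sup>2 \<le> \<delta>\<^sup>2" "(norm (y' - \<eta>))\<^sup>2 \<le> (2 * \<delta>)\<^sup>2" using yy by (intro power_mono; simp)+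
    moreover have "\<delta>\<^sup>2 \<le> \<delta>" using \<delta> by (simp add: power2_eq_square mult_left_le)
    ultimately have "(norm (y - \<eta>))\<^sup>2 \<le> \<delta>" "(norm (y' - \<eta>))\<^sup>2 \<le> 4 * \<delta>" by (auto simp: power_mult_distrib)
    then have 2: "L * (norm (y - \<eta>))\<^sup>2 \<le> L * \<delta>" "L * (norm (y' - \<eta>))\<^sup>2 \<le> L * (4 * \<delta>)"
      using L by (intro mult_left_mono; simp)+
    have "s \<bullet> (y - y') = s \<bullet> (y - \<eta>) - s \<bullet> (y' - \<eta>)" by (simp add: inner_diff_right)
    then have "\<bar>\<alpha> y - \<alpha> y'\<bar> \<le> (M + 18 * L) * \<delta> + L * \<delta> + L * (4 * \<delta>)"
      using s[of y] s[of y'] 1 2 by (simp add: abs_le_iff)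
    also have "\<dots> \<le> C * \<delta>"
      using \<delta>(1) L \<open>M \<ge> 0\<close> mult_nonneg_nonneg[of "M + 18 * L" \<delta>] unfolding C_def distrib_right by (simp add: algebra_simps)
    finally have "\<bar>\<alpha> y - \<alpha> y'\<bar> \<le> \<theta>" using \<delta>(5) by linarith
    moreover have "\<bar>\<alpha> y' - ?q y'\<bar> \<le> \<theta>" using \<alpha>q[of y'] y'(1) \<delta>(4) by simp
    moreover have "\<bar>?q y' - ?q y\<bar> \<le> \<theta>"
      using \<delta>0(2)[of y y'] y y' Y0(2) \<delta>(2) by (auto simp: dist_real_def)
    ultimately show ?thesis by linarith
  qed
  then have "\<bar>a (x + r *\<^sub>R y) - c - p \<bullet> y - r\<^sup>2 * ?q y\<bar> \<le> 3 * \<theta> * r\<^sup>2" if "norm y \<le> 1" for y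
    using that r(1) unfolding \<alpha> right_diff_distrib[symmetric] abs_mult by (simp add: mult.commute)
  moreover have "dense_at \<theta> 1 x r"
    using r(1) \<delta>(4) by (intro dense_at_mono[OF _ _ r(3)]) auto
  ultimately show ?thesis using that r \<delta>(3) by fastforce
qed

text \<open>Near a blow-up scale \<open>a\<close> is close to the quadratic of \<open>A\<close>, and
  the supporting plane of the sum forces \<open>b\<close> below the quadratic of
  \<open>- A - (2 * d) *\<^sub>R mat 1\<close>. Both are then touched from above after a shift by
  \<open>e\<close>. The matrix must not depend on \<open>e\<close>, which is why a quadratic limit
  had to be found first.\<close>

lemma contact_matrix:
  "\<exists>A\<in>Sym2. \<forall>e>0. A + e *\<^sub>R mat 1 \<in> F \<and> (- A - (2 * d) *\<^sub>R mat 1) + e *\<^sub>R mat 1 \<in> G"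
proof -
  interpret blowup_class blowups L by (rule blowup_class_blowups)
  obtain A where A: "A \<in> Sym2" "(\<lambda>y. y \<bullet> (A *v y) / 2) \<in> blowups" using exists_quadratic by blast
  let ?A' = "- A - (2 * d) *\<^sub>R mat 1"
  have A': "?A' \<in> Sym2" using A by (intro Sym2_intros)
  have QA': "y \<bullet> (?A' *v y) / 2 = - (y \<bullet> (A *v y) / 2) - d * (norm y)\<^sup>2" for y
    by (simp add: matrix_vector_mult_diff_rdistrib mat_mult_vec inner_diff_right matrix_vector_minus power2_norm_eq_inner diff_divide_distrib)
  have opn: "open {x. \<mu> < f x}"
    by (intro open_Collect_less continuous_intros cont_f)
  have "K s0 \<noteq> {}" using K_not_negligible[OF s0(1)] by auto
  then obtain \<sigma> where \<sigma>: "\<sigma> > 0" "{x. infdist x (K s0) \<le> \<sigma>} \<subseteq> {x. \<mu> < f x}"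
    using compact_in_open_separated[OF _ K_compact[OF s0(2)] opn] K_high by blast
  have high: "\<mu> < f y" if "z \<in> K s0" "dist y z \<le> \<sigma>" for y z
  proof -
    have "y \<in> {x. infdist x (K s0) \<le> \<sigma>}" using infdist_le[OF that(1), of y] that(2) by simp
    then show ?thesis using \<sigma>(2) by blast
  qed
  have "A + e *\<^sub>R mat 1 \<in> F \<and> ?A' + e *\<^sub>R mat 1 \<in> G" if e: "e > 0" for e
  proof -
    \<comment> \<open>The first bound makes errors of \<open>6 * \<theta>\<close> fit into the gap
      \<open>e / 2\<close>, the second puts a contact point close to 0, and the third keeps the
      whole window where the tests apply.\<close>
    define \<theta> where "\<theta> = min (e / 16) (min (1/4) \<sigma>)"
    have \<theta>: "0 < \<theta>" "16 * \<theta> \<le> e" "\<theta> \<le> 1/4" "\<theta> \<le> \<sigma>" using e \<sigma> by (auto simp: \<theta>_def)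
    obtain x r c p where r: "0 < r" "r < 1" "dense_at \<theta> 1 x r" and
      ap: "\<And>y. norm y \<le> 1 \<Longrightarrow> \<bar>a (x + r *\<^sub>R y) - c - p \<bullet> y - r\<^sup>2 * (y \<bullet> (A *v y) / 2)\<bar> \<le> 3 * \<theta> * r\<^sup>2"
      using blowup_uniform[OF A(2) \<theta>(1)] by metis
    have up: "X \<le> C + Y + s * (Q + T)" and lo: "C + Y + s * (Q - T) \<le> X"
      if "\<bar>X - C - Y - s * Q\<bar> \<le> T * s" for X C Y s Q T :: real
      using that by (simp_all add: abs_le_iff algebra_simps)
    have hi: "\<mu> < a (x + r *\<^sub>R v) + b (x + r *\<^sub>R v) + d * (norm (x + r *\<^sub>R v))\<^sup>2" if "norm v < 1" for v
    proof -
      have "x + r *\<^sub>R v \<in> cball x (1 * r)" using that r by (simp add: dist_norm mult_left_le)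
      then obtain z where z: "z \<in> K s0" "dist (x + r *\<^sub>R v) z \<le> \<theta> * r" using r(3) unfolding dense_at_def by blast
      have "\<theta> * r \<le> \<sigma>" using r \<theta> mult_left_le[of r \<theta>] by linarith
      then show ?thesis using high[OF z(1)] z(2) unfolding f_def by auto
    qed
    have "A + e *\<^sub>R mat 1 \<in> F"
    proof -
      have "\<exists>v P \<rho>. norm v < 1 \<and> 0 < \<rho> \<and> (\<forall>Y\<in>ball (x + r *\<^sub>R v) \<rho>. a Y \<le> a (x + r *\<^sub>R v) + P \<bullet> (Y - (x + r *\<^sub>R v))
          + (Y - (x + r *\<^sub>R v)) \<bullet> ((A + e *\<^sub>R mat 1) *v (Y - (x + r *\<^sub>R v))) / 2)"
      proof (rule rescaled_quadratic_contact[OF cont_a A(1) r(1), where c=c and p=p and \<theta>="3 * \<theta>" and z=0])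
        show "a (x + r *\<^sub>R y) \<le> c + p \<bullet> y + r\<^sup>2 * (y \<bullet> (A *v y) / 2 + 3 * \<theta>)" if "norm y \<le> 1" for y
          by (rule up[OF ap[OF that]])
        show "c + p \<bullet> 0 + r\<^sup>2 * (0 \<bullet> (A *v 0) / 2 - 3 * \<theta>) \<le> a (x + r *\<^sub>R 0)"
          by (rule lo[OF ap]) simp
      qed (use \<theta> in auto)
      then show ?thesis using test_a[OF hi] Sym2_intros(1)[OF A(1) Sym2_intros(2)[OF Sym2_mat]] by blast
    qed
    moreover have "?A' + e *\<^sub>R mat 1 \<in> G"
    proof -
      \<comment> \<open>For \<open>b\<close> the lower estimate is available only at a contact
        point, where the sum equals its supporting plane; hence a point near 0 in place of 0
        itself.\<close>
      obtain \<eta> where \<eta>: "norm (\<eta> - 0) \<le> \<theta>" "x + r *\<^sub>R \<eta> \<in> K s0"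
        using near_contact_expansion[OF r(1,3), of 0] by force
      obtain P where P: "\<And>y. f y \<le> f (x + r *\<^sub>R \<eta>) + P \<bullet> (y - (x + r *\<^sub>R \<eta>))"
        using \<eta>(2) unfolding K_def by blast
      define c' where "c' = f (x + r *\<^sub>R \<eta>) - r * (P \<bullet> \<eta>) - c - d * (norm x)\<^sup>2"
      define p' where "p' = r *\<^sub>R P - p - (2 * d * r) *\<^sub>R x"
      have bf: "b (x + r *\<^sub>R y) = f (x + r *\<^sub>R y) - a (x + r *\<^sub>R y) - d * (norm x)\<^sup>2 - 2 * d * r * (x \<bullet> y) - r\<^sup>2 * (d * (norm y)\<^sup>2)" for y
      proof -
        have "(norm (x + r *\<^sub>R y))\<^sup>2 = (norm x)\<^sup>2 + 2 * r * (x \<bullet> y) + r\<^sup>2 * (norm y)\<^sup>2"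
          by (simp only: power2_norm_eq_inner inner_add_left inner_add_right)
            (simp add: inner_commute[of y x] power2_eq_square)
        then show ?thesis unfolding f_def by (simp only:) (simp add: distrib_left)
      qed
      have pl: "f (x + r *\<^sub>R \<eta>) + P \<bullet> (x + r *\<^sub>R y - (x + r *\<^sub>R \<eta>)) = c' + p' \<bullet> y + c + d * (norm x)\<^sup>2 + p \<bullet> y + 2 * d * r * (x \<bullet> y)" for y
        by (simp add: c'_def p'_def inner_diff_left inner_diff_right inner_add_left inner_add_right)
      have n\<eta>: "norm \<eta> \<le> 1" using \<eta>(1) \<theta>(3) by simp
      have "\<exists>v P \<rho>. norm v < 1 \<and> 0 < \<rho> \<and> (\<forall>Y\<in>ball (x + r *\<^sub>R v) \<rho>. b Y \<le> b (x + r *\<^sub>R v) + P \<bullet> (Y - (x + r *\<^sub>R v))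
          + (Y - (x + r *\<^sub>R v)) \<bullet> ((?A' + e *\<^sub>R mat 1) *v (Y - (x + r *\<^sub>R v))) / 2)"
      proof (rule rescaled_quadratic_contact[OF cont_b A' r(1), where c=c' and p=p' and \<theta>="3 * \<theta>" and z=\<eta>])
        show "b (x + r *\<^sub>R y) \<le> c' + p' \<bullet> y + r\<^sup>2 * (y \<bullet> (?A' *v y) / 2 + 3 * \<theta>)" if "norm y \<le> 1" for y
        proof -
          have "u - v - m - n - s * E \<le> C + Y + s * (- Q - E + T)"
            if "u \<le> C + Y + c + m + Z + n" "c + Z + s * (Q - T) \<le> v" for u v m n s E C Y Q T Z :: real
            using that by (simp add: algebra_simps)
          then show ?thesis
            using P[of "x + r *\<^sub>R y"] lo[OF ap[OF that]] unfolding pl bf QA' by blast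
        qed
        show "c' + p' \<bullet> \<eta> + r\<^sup>2 * (\<eta> \<bullet> (?A' *v \<eta>) / 2 - 3 * \<theta>) \<le> b (x + r *\<^sub>R \<eta>)"
        proof -
          have "C + Y + s * (- Q - E - T) \<le> u - v - m - n - s * E"
            if "u = C + Y + c + m + Z + n" "v \<le> c + Z + s * (Q + T)" for u v m n s E C Y Q T Z :: real
            using that by (simp add: algebra_simps)
          moreover have "f (x + r *\<^sub>R \<eta>) = c' + p' \<bullet> \<eta> + c + d * (norm x)\<^sup>2 + p \<bullet> \<eta> + 2 * d * r * (x \<bullet> \<eta>)"
            using pl[of \<eta>] by simp
          ultimately show ?thesis using up[OF ap[OF n\<eta>]] unfolding bf QA' by blast
        qed
        have "(norm \<eta>)\<^sup>2 \<le> (1/4)\<^sup>2" using \<eta>(1) \<theta>(3) by (intro power_mono) auto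
        then have "e / 2 * (norm \<eta>)\<^sup>2 \<le> e / 2 * (1/16)" using e by (intro mult_left_mono) (auto simp: power2_eq_square)
        then show "2 * (3 * \<theta>) + e / 2 * (norm \<eta>)\<^sup>2 < e / 2" using \<theta>(2) e by linarith
      qed (rule n\<eta>)
      then show ?thesis using test_b[OF hi] Sym2_intros(1)[OF A' Sym2_intros(2)[OF Sym2_mat]] by blast
    qed
    ultimately show ?thesis by blast
  qed
  then show ?thesis using A(1) by blast
qed

end

subsection \<open>Upper semicontinuous functions and \<open>F\<close>-subharmonicity\<close>

lemma usc_on_iff_ball:
  "usc_on S u \<longleftrightarrow> (\<forall>x\<in>S. \<forall>c. u x < c \<longrightarrow> (\<exists>e>0. \<forall>y\<in>S. dist y x < e \<longrightarrow> u y < c))"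
  unfolding usc_on_def eventually_at by (metis dist_self dist_commute)

lemma usc_on_subset: "usc_on S u \<Longrightarrow> T \<subseteq> S \<Longrightarrow> usc_on T u"
  unfolding usc_on_iff_ball by (meson subsetD)

lemma usc_on_cong: "(\<And>y. y \<in> S \<Longrightarrow> u y = v y) \<Longrightarrow> usc_on S u = usc_on S v"
  unfolding usc_on_iff_ball by auto

lemma usc_on_continuous:
  assumes "continuous_on S u" shows "usc_on S u"
  unfolding usc_on_def
proof (intro ballI allI impI)
  fix x c assume "x \<in> S" "u x < c"
  then show "\<forall>\<^sub>F y in at x within S. u y < c"
    using assms unfolding continuous_on_def by (blast intro: order_tendstoD(2))
qed

lemma usc_on_max: "usc_on S u \<Longrightarrow> usc_on S v \<Longrightarrow> usc_on S (\<lambda>y. max (u y) (v y))"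
  unfolding usc_on_def by (auto intro: eventually_conj simp: eventually_conj_iff)

lemma usc_on_add:
  assumes u: "usc_on S u" and v: "usc_on S v" and lt: "\<And>y. y \<in> S \<Longrightarrow> u y < \<infinity> \<and> v y < \<infinity>"
  shows "usc_on S (\<lambda>y. u y + v y)"
  unfolding usc_on_def
proof (intro ballI allI impI)
  fix x c assume x: "x \<in> S" and c: "u x + v x < c"
  have "\<exists>a b. u x < a \<and> v x < b \<and> a + b \<le> c"
  proof (cases "u x = -\<infinity> \<or> v x = -\<infinity>")
    case True
    have "\<exists>r. c \<ge> ereal r" using c by (cases c) auto
    then obtain r where r: "ereal r \<le> c" by blast
    from True show ?thesis
    proof
      assume "u x = -\<infinity>"
      moreover obtain b where "v x < ereal b" using lt[OF x] less_PInf_Ex_of_nat by (metis ereal_dense2)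
      ultimately show ?thesis using r
        by (intro exI[of _ "ereal (r - b)"] exI[of _ "ereal b"]) auto
    next
      assume "v x = -\<infinity>"
      moreover obtain b where "u x < ereal b" using lt[OF x] by (metis ereal_dense2)
      ultimately show ?thesis using r
        by (intro exI[of _ "ereal b"] exI[of _ "ereal (r - b)"]) auto
    qed
  next
    case False
    then obtain p q where pq: "u x = ereal p" "v x = ereal q" using lt[OF x] by (cases "u x"; cases "v x") auto
    then obtain r where r: "p + q < r" "ereal r \<le> c"
      using c by (metis ereal_dense2 less_ereal.simps(1) less_imp_le plus_ereal.simps(1))
    show ?thesis unfolding pq using r
      by (intro exI[of _ "ereal (p + (r - p - q) / 2)"] exI[of _ "ereal (q + (r - p - q) / 2)"])
         (auto simp: field_simps)
  qed
  then obtain a b where ab: "u x < a" "v x < b" "a + b \<le> c" by blast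
  have "\<forall>\<^sub>F y in at x within S. u y < a" "\<forall>\<^sub>F y in at x within S. v y < b"
    using u v x ab unfolding usc_on_def by blast+
  then show "\<forall>\<^sub>F y in at x within S. u y + v y < c"
    by eventually_elim (use ab(3) ereal_add_strict_mono2 in \<open>blast intro: order_less_le_trans\<close>)
qed

lemma compact_ball_cover:
  assumes K: "compact K" and e: "\<And>x. x \<in> K \<Longrightarrow> 0 < e x"
  shows "\<exists>D\<subseteq>K. finite D \<and> K \<subseteq> (\<Union>x\<in>D. ball x (e x))"
proof -
  have "K \<subseteq> (\<Union>x\<in>K. ball x (e x))" using e by force
  from compactE_image[OF K _ this] show ?thesis by (metis open_ball)
qed

lemma usc_attains_max:
  assumes K: "compact K" "K \<noteq> {}" and u: "usc_on K u"
  shows "\<exists>x\<in>K. \<forall>y\<in>K. u y \<le> u x"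
proof (rule ccontr)
  assume no: "\<not> ?thesis"
  define M where "M = (SUP y\<in>K. u y)"
  have lt: "u x < M" if "x \<in> K" for x
    using no that unfolding M_def by (metis SUP_upper not_le order_le_less_trans)
  have "\<forall>x\<in>K. \<exists>c e. u x < c \<and> c < M \<and> 0 < e \<and> (\<forall>y\<in>K. dist y x < e \<longrightarrow> u y < c)"
    using u lt dense unfolding usc_on_iff_ball by metis
  then obtain c e where ce: "\<And>x. x \<in> K \<Longrightarrow> c x < M" "\<And>x. x \<in> K \<Longrightarrow> 0 < e x"
    "\<And>x y. x \<in> K \<Longrightarrow> y \<in> K \<Longrightarrow> dist y x < e x \<Longrightarrow> u y < c x" by metis
  obtain D where D: "D \<subseteq> K" "finite D" "K \<subseteq> (\<Union>x\<in>D. ball x (e x))"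
    using compact_ball_cover[of K e, OF K(1) ce(2)] by metis
  have "D \<noteq> {}" using D(3) K(2) by auto
  have "M \<le> Max (c ` D)"
    unfolding M_def
  proof (rule SUP_least)
    fix y assume y: "y \<in> K"
    then obtain x where x: "x \<in> D" "dist y x < e x" using D(3) by (auto simp: dist_commute)
    then have "u y < c x" using ce(3) y D(1) by blast
    also have "\<dots> \<le> Max (c ` D)" using x D(2) by (intro Max_ge) auto
    finally show "u y \<le> Max (c ` D)" by (rule less_imp_le)
  qed
  moreover have "Max (c ` D) \<in> c ` D" using D(2) \<open>D \<noteq> {}\<close> by (intro Max_in) auto
  ultimately show False using ce(1) D(1) by (metis imageE not_le subsetD)
qed

lemma usc_real_bound:
  assumes "compact K" "usc_on K u" "\<And>y. y \<in> K \<Longrightarrow> u y < \<infinity>"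
  shows "\<exists>N. \<forall>y\<in>K. u y \<le> ereal N"
proof (cases "K = {}")
  case False
  then obtain x where x: "x \<in> K" "\<And>y. y \<in> K \<Longrightarrow> u y \<le> u x" using usc_attains_max assms by metis
  then have "u x \<le> ereal (real_of_ereal (u x))" using assms(3)[OF x(1)] by (cases "u x") auto
  then show ?thesis using x(2) order_trans by blast
qed auto

section \<open>Calculus of subharmonic functions\<close>

lemma F_sub_test:
  assumes "F_sub F X u" "x0 \<in> U" "U \<subseteq> X" "C2_hess U \<phi> g Hs" "\<And>y. y \<in> U \<Longrightarrow> u y \<le> ereal (\<phi> y)" "u x0 = ereal (\<phi> x0)"
  shows "Hs x0 \<in> F"
  using assms unfolding F_sub_def by blast

lemma F_subI:
  assumes "\<And>x. x \<in> X \<Longrightarrow> u x < \<infinity>" "usc_on X u"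
    "\<And>x0 U \<phi> g Hs. x0 \<in> U \<Longrightarrow> U \<subseteq> X \<Longrightarrow> C2_hess U \<phi> g Hs \<Longrightarrow> (\<And>y. y \<in> U \<Longrightarrow> u y \<le> ereal (\<phi> y)) \<Longrightarrow>
      u x0 = ereal (\<phi> x0) \<Longrightarrow> Hs x0 \<in> F"
  shows "F_sub F X u"
  using assms unfolding F_sub_def by blast

lemma F_sub_subset: "F_sub F X u \<Longrightarrow> Y \<subseteq> X \<Longrightarrow> F_sub F Y u"
  unfolding F_sub_def by (meson order_trans subsetD usc_on_subset)

lemma F_sub_cong:
  assumes "\<And>y. y \<in> X \<Longrightarrow> u y = v y" "F_sub F X u" shows "F_sub F X v"
proof (rule F_subI)
  show "usc_on X v" using assms usc_on_cong[of X u v] by (auto simp: F_sub_def)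
  show "v x < \<infinity>" if "x \<in> X" for x using assms that by (auto simp: F_sub_def)
  show "Hs x0 \<in> F" if "x0 \<in> U" "U \<subseteq> X" "C2_hess U \<phi> g Hs" "\<And>y. y \<in> U \<Longrightarrow> v y \<le> ereal (\<phi> y)" "v x0 = ereal (\<phi> x0)"
    for x0 U \<phi> g Hs
    by (rule F_sub_test[OF assms(2) that(1-3)]) (use assms(1) that in \<open>auto simp: subset_iff\<close>)
qed

lemma F_sub_local:
  assumes X: "open X" and loc: "\<And>x. x \<in> X \<Longrightarrow> \<exists>N. open N \<and> x \<in> N \<and> N \<subseteq> X \<and> F_sub F N u"
  shows "F_sub F X u"
proof (rule F_subI)
  show "u x < \<infinity>" if "x \<in> X" for x using loc[OF that] by (auto simp: F_sub_def)
  show "usc_on X u" unfolding usc_on_def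
  proof (intro ballI allI impI)
    fix x c assume x: "x \<in> X" "u x < c"
    obtain N where N: "open N" "x \<in> N" "F_sub F N u" using loc[OF x(1)] by blast
    then have "\<forall>\<^sub>F y in at x within N. u y < c" using x(2) by (auto simp: F_sub_def usc_on_def)
    then have "\<forall>\<^sub>F y in at x. u y < c" using N by (simp add: at_within_open[of x N])
    then show "\<forall>\<^sub>F y in at x within X. u y < c" using X x by (simp add: at_within_open[of x X])
  qed
  fix x0 U \<phi> g Hs
  assume *: "x0 \<in> U" "U \<subseteq> X" "C2_hess U \<phi> g Hs" "\<And>y. y \<in> U \<Longrightarrow> u y \<le> ereal (\<phi> y)" "u x0 = ereal (\<phi> x0)"
  obtain N where N: "open N" "x0 \<in> N" "F_sub F N u" using loc *(1,2) by blast
  have "open U" using *(3) by (simp add: C2_hess_def)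
  then have "C2_hess (U \<inter> N) \<phi> g Hs" using *(3) N by (intro C2_hess_subset[OF *(3)]) auto
  then show "Hs x0 \<in> F" using F_sub_test[OF N(3), of x0 "U \<inter> N"] * N by auto
qed

lemma F_sub_max:
  assumes "F_sub F X u" "F_sub F X v" shows "F_sub F X (\<lambda>y. max (u y) (v y))"
proof (rule F_subI)
  show "usc_on X (\<lambda>y. max (u y) (v y))" using assms by (auto simp: F_sub_def intro: usc_on_max)
  show "max (u x) (v x) < \<infinity>" if "x \<in> X" for x using assms that by (auto simp: F_sub_def max_def)
  fix x0 U \<phi> g Hs
  assume *: "x0 \<in> U" "U \<subseteq> X" "C2_hess U \<phi> g Hs" "\<And>y. y \<in> U \<Longrightarrow> max (u y) (v y) \<le> ereal (\<phi> y)"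
    "max (u x0) (v x0) = ereal (\<phi> x0)"
  from *(5) have "u x0 = ereal (\<phi> x0) \<or> v x0 = ereal (\<phi> x0)" by (auto simp: max_def split: if_splits)
  then show "Hs x0 \<in> F"
    using F_sub_test[OF assms(1) *(1-3)] F_sub_test[OF assms(2) *(1-3)] *(4) by auto
qed

text \<open>A test function minus \<open>\<rho>\<close> has a local minimum at the contact point, so
  its Hessian exceeds that of \<open>\<rho>\<close> by a positive matrix.\<close>

lemma F_sub_C2:
  assumes F: "cone_subequation F" and C2: "C2_hess X \<rho> g Hs" and H: "\<And>x. x \<in> X \<Longrightarrow> Hs x \<in> F"
  shows "F_sub F X (\<lambda>y. ereal (\<rho> y))"
proof (rule F_subI)
  show "usc_on X (\<lambda>y. ereal (\<rho> y))"
    by (intro usc_on_continuous continuous_intros C2_hess_continuous[OF C2])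
  fix x0 U \<phi> g' Hs'
  assume *: "x0 \<in> U" "U \<subseteq> X" "C2_hess U \<phi> g' Hs'" "\<And>y. y \<in> U \<Longrightarrow> ereal (\<rho> y) \<le> ereal (\<phi> y)" "ereal (\<rho> x0) = ereal (\<phi> x0)"
  have "open U" using *(3) by (simp add: C2_hess_def)
  then have c: "C2_hess U (\<lambda>y. \<phi> y + - \<rho> y) (\<lambda>y. g' y + - g y) (\<lambda>y. Hs' y + - Hs y)"
    using *(2,3) C2 by (intro C2_hess_add C2_hess_minus) (auto intro: C2_hess_subset)
  have "psd (Hs' x0 + - Hs x0)"
    by (rule C2_local_min_hess_psd[OF c *(1)]) (use *(4,5) in auto)
  then have "Hs x0 + (Hs' x0 + - Hs x0) \<in> F"
    using F H *(1,2) C2_hess_symmetric[OF c *(1)] unfolding cone_subequation_def by blast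
  then show "Hs' x0 \<in> F" by simp
qed simp

lemma F_sub_const:
  assumes "cone_subequation F" "0 \<in> F" "open X" shows "F_sub F X (\<lambda>y. ereal c)"
  using F_sub_C2[OF assms(1) C2_hess_const[OF assms(3)]] assms(2) by blast

lemma F_sub_scale_add:
  assumes F: "cone_subequation F" and u: "F_sub F X u" and c: "0 < c"
  shows "F_sub F X (\<lambda>y. ereal c * u y + ereal m)"
proof (rule F_subI)
  \<comment> \<open>Moving the affine map to the other side of the inequality reduces upper
    semicontinuity to that of \<open>u\<close> with another threshold.\<close>
  have inv: "ereal c * t + ereal m < s \<longleftrightarrow> t < (s - ereal m) / ereal c" for t s
    using c by (cases t; cases s) (auto simp: field_simps)
  show "usc_on X (\<lambda>y. ereal c * u y + ereal m)" using u unfolding F_sub_def usc_on_def inv by blast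
  show "ereal c * u x + ereal m < \<infinity>" if "x \<in> X" for x
    using u that c unfolding F_sub_def by (cases "u x") auto
  fix x0 U \<phi> g Hs
  assume *: "x0 \<in> U" "U \<subseteq> X" "C2_hess U \<phi> g Hs" "\<And>y. y \<in> U \<Longrightarrow> ereal c * u y + ereal m \<le> ereal (\<phi> y)"
    "ereal c * u x0 + ereal m = ereal (\<phi> x0)"
  have "open U" using *(3) by (simp add: C2_hess_def)
  have c2: "C2_hess U (\<lambda>y. (1/c) * (\<phi> y + - m)) (\<lambda>y. (1/c) *\<^sub>R (g y + 0)) (\<lambda>y. (1/c) *\<^sub>R (Hs y + 0))"
    by (intro C2_hess_scale C2_hess_add *(3) C2_hess_const \<open>open U\<close>)
  have "(1/c) *\<^sub>R (Hs x0 + 0) \<in> F"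
  proof (rule F_sub_test[OF u *(1,2) c2])
    show "u y \<le> ereal ((1/c) * (\<phi> y + - m))" if "y \<in> U" for y
      using *(4)[OF that] c by (cases "u y") (auto simp: field_simps)
    show "u x0 = ereal ((1/c) * (\<phi> x0 + - m))"
      using *(5) c by (cases "u x0") (auto simp: field_simps)
  qed
  then have "c *\<^sub>R ((1/c) *\<^sub>R (Hs x0 + 0)) \<in> F" using cone_scale[OF F] c by blast
  then show "Hs x0 \<in> F" using c by simp
qed

subsection \<open>Comparison via sup-convolution\<close>

text \<open>The supremum runs over a compact set only, but the result lives on the whole space,
  where the quadratic penalty makes it semiconvex.\<close>

definition supconv :: "(real^'n) set \<Rightarrow> real \<Rightarrow> (real^'n \<Rightarrow> real) \<Rightarrow> real^'n \<Rightarrow> real" where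
  "supconv K \<Lambda> u x = (SUP z\<in>K. u z - \<Lambda> * (norm (x - z))\<^sup>2)"

lemma supconv_attained:
  assumes K: "compact K" "K \<noteq> {}" and u: "usc_on K (\<lambda>y. ereal (u y))"
  shows "\<exists>z\<in>K. supconv K \<Lambda> u x = u z - \<Lambda> * (norm (x - z))\<^sup>2 \<and> (\<forall>z'\<in>K. u z' - \<Lambda> * (norm (x - z'))\<^sup>2 \<le> supconv K \<Lambda> u x)"
proof -
  have "usc_on K (\<lambda>z. ereal (u z) + ereal (- \<Lambda> * (norm (x - z))\<^sup>2))"
    by (intro usc_on_add u usc_on_continuous continuous_intros) auto
  from usc_attains_max[OF K this] obtain z where z: "z \<in> K"
    "\<And>z'. z' \<in> K \<Longrightarrow> u z' - \<Lambda> * (norm (x - z'))\<^sup>2 \<le> u z - \<Lambda> * (norm (x - z))\<^sup>2" by auto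
  then have "supconv K \<Lambda> u x = u z - \<Lambda> * (norm (x - z))\<^sup>2"
    unfolding supconv_def by (intro cSup_eq_maximum) auto
  then show ?thesis using z by auto
qed

text \<open>Keeping the maximizer \<open>z\<close> of \<open>x\<close> as a competitor at
  \<open>y\<close> gives a paraboloid below the graph: this is the semiconvexity.\<close>

lemma supconv_shift:
  assumes K: "compact K" "K \<noteq> {}" and u: "usc_on K (\<lambda>y. ereal (u y))"
    and z: "z \<in> K" "supconv K \<Lambda> u x = u z - \<Lambda> * (norm (x - z))\<^sup>2"
  shows "supconv K \<Lambda> u x + (- (2 * \<Lambda>) *\<^sub>R (x - z)) \<bullet> (y - x) - \<Lambda> * (norm (y - x))\<^sup>2 \<le> supconv K \<Lambda> u y"
proof -
  have "u z - \<Lambda> * (norm (y - z))\<^sup>2 \<le> supconv K \<Lambda> u y" using supconv_attained[OF K u] z(1) by metis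
  moreover have "(norm (y - z))\<^sup>2 = (norm (x - z))\<^sup>2 + 2 * ((x - z) \<bullet> (y - x)) + (norm (y - x))\<^sup>2"
    by (simp add: power2_norm_eq_inner inner_diff_left inner_diff_right inner_commute)
  ultimately show ?thesis using z(2) by (simp add: algebra_simps)
qed

lemma supconv_continuous:
  fixes K :: "(real^'n) set"
  assumes K: "compact K" "K \<noteq> {}" and u: "usc_on K (\<lambda>y. ereal (u y))" and \<Lambda>: "0 \<le> \<Lambda>"
  shows "continuous_on UNIV (supconv K \<Lambda> u)"
proof (intro continuous_at_imp_continuous_on ballI)
  fix x :: "real^'n"
  let ?a = "supconv K \<Lambda> u"
  obtain R where R: "\<And>z. z \<in> K \<Longrightarrow> norm z \<le> R" using compact_imp_bounded[OF K(1)] by (auto simp: bounded_iff)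
  have le: "?a x - \<Lambda> * (norm (y - x) * (norm x + norm y + 2 * R)) \<le> ?a y" for x y
  proof -
    obtain z where z: "z \<in> K" "?a x = u z - \<Lambda> * (norm (x - z))\<^sup>2" using supconv_attained[OF K u] by metis
    have 1: "u z - \<Lambda> * (norm (y - z))\<^sup>2 \<le> ?a y" using supconv_attained[OF K u] z(1) by metis
    have "(norm (y - z))\<^sup>2 - (norm (x - z))\<^sup>2 = (y - x) \<bullet> (x + y - 2 *\<^sub>R z)"
      by (simp add: power2_norm_eq_inner inner_diff_left inner_diff_right inner_add_right inner_commute)
    also have "\<dots> \<le> norm (y - x) * norm (x + y - 2 *\<^sub>R z)" by (rule norm_cauchy_schwarz)
    also have "\<dots> \<le> norm (y - x) * (norm x + norm y + 2 * R)"
      using norm_triangle_ineq4[of "x + y" "2 *\<^sub>R z"] norm_triangle_ineq[of x y] R[OF z(1)]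
      by (intro mult_left_mono) auto
    finally have "\<Lambda> * ((norm (y - z))\<^sup>2 - (norm (x - z))\<^sup>2) \<le> \<Lambda> * (norm (y - x) * (norm x + norm y + 2 * R))"
      using \<Lambda> by (intro mult_left_mono)
    then show ?thesis using 1 z(2) by (simp add: right_diff_distrib)
  qed
  have "((\<lambda>y. \<Lambda> * (norm (y - x) * (norm x + norm y + 2 * R))) \<longlongrightarrow> \<Lambda> * (norm (x - x) * (norm x + norm x + 2 * R))) (at x)"
    by (intro tendsto_intros)
  then have "((\<lambda>y. \<Lambda> * (norm (y - x) * (norm x + norm y + 2 * R))) \<longlongrightarrow> 0) (at x)" by simp
  moreover have "norm (?a y - ?a x) \<le> \<Lambda> * (norm (y - x) * (norm x + norm y + 2 * R))" for y
    using le[of x y] le[of y x] by (simp add: abs_le_iff norm_minus_commute add.commute)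
  ultimately have "((\<lambda>y. ?a y - ?a x) \<longlongrightarrow> 0) (at x)"
    by (intro Lim_null_comparison[of "\<lambda>y. ?a y - ?a x"]) (auto intro: always_eventually)
  then show "isCont ?a x" by (simp add: isCont_def LIM_zero_iff)
qed

text \<open>Moving \<open>x\<close> and its maximizer by the same vector leaves the penalty
  unchanged. A paraboloid touching the sup-convolution at \<open>x\<close> therefore translates to
  one touching \<open>u\<close> at \<open>z\<close>, with the same matrix.\<close>

lemma supconv_test:
  assumes K: "compact K" "K \<noteq> {}" and u: "usc_on K (\<lambda>y. ereal (u y))"
    and X: "open X" "X \<subseteq> K" and sub: "F_sub F X (\<lambda>y. ereal (u y))"
    and z: "z \<in> X" "supconv K \<Lambda> u x = u z - \<Lambda> * (norm (x - z))\<^sup>2"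
    and A: "A \<in> Sym2" and r: "0 < r"
    and touch: "\<And>y. y \<in> ball x r \<Longrightarrow> supconv K \<Lambda> u y \<le> supconv K \<Lambda> u x + p \<bullet> (y - x) + (y - x) \<bullet> (A *v (y - x)) / 2"
  shows "A \<in> F"
proof -
  have o: "open (ball z r \<inter> X)" using X by auto
  show ?thesis
  proof (rule F_sub_test[OF sub _ _ C2_hess_quadratic[OF A o, of "u z" p z]])
    show "z \<in> ball z r \<inter> X" using z r by simp
    fix y assume y: "y \<in> ball z r \<inter> X"
    have "u y - \<Lambda> * (norm ((x + (y - z)) - y))\<^sup>2 \<le> supconv K \<Lambda> u (x + (y - z))"
      using supconv_attained[OF K u] X(2) y by (metis IntD2 subsetD)
    also have "\<dots> \<le> supconv K \<Lambda> u x + p \<bullet> (y - z) + (y - z) \<bullet> (A *v (y - z)) / 2"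
      using touch[of "x + (y - z)"] y by (simp add: dist_norm norm_minus_commute)
    finally show "ereal (u y) \<le> ereal (u z + p \<bullet> (y - z) + 1 / 2 * ((y - z) \<bullet> (A *v (y - z))))"
      using z(2) by simp
  qed auto
qed

text \<open>From a positive value of \<open>u + w\<close> one gets a high point of the sum of
  sup-convolutions plus a small multiple of the squared norm. Maximizers of high points stay inside
  \<open>X\<close>, so \<open>contact_pair\<close> applies with \<open>F\<close> and
  \<open>dual F\<close>.\<close>

lemma comparison_real:
  fixes u w :: "real^'n \<Rightarrow> real"
  assumes F: "cone_subequation F" and X: "open X" "bounded X"
    and u: "usc_on (closure X) (\<lambda>y. ereal (u y))" "F_sub F X (\<lambda>y. ereal (u y))"
    and w: "usc_on (closure X) (\<lambda>y. ereal (w y))" "F_sub (dual F) X (\<lambda>y. ereal (w y))"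
    and bound: "\<And>y. y \<in> closure X \<Longrightarrow> u y \<le> N \<and> w y \<le> N"
    and bd: "\<And>y. y \<in> frontier X \<Longrightarrow> u y + w y \<le> 0" and x0: "x0 \<in> X"
  shows "u x0 + w x0 \<le> 0"
proof (rule ccontr)
  assume neg: "\<not> ?thesis"
  define c where "c = u x0 + w x0"
  have c: "c > 0" using neg by (simp add: c_def)
  define K where "K = closure X"
  have K: "compact K" "K \<noteq> {}" "X \<subseteq> K" "x0 \<in> K" using X x0 closure_subset[of X] by (auto simp: K_def)
  obtain R where R: "R > 0" "\<And>z. z \<in> K \<Longrightarrow> norm z \<le> R"
    using compact_imp_bounded[OF K(1)] by (auto simp: bounded_pos)
  \<comment> \<open>The added quadratic is at most \<open>c / 2\<close> within distance 1 of
    \<open>K\<close>, so it cannot account for a value above \<open>3 * c / 4\<close>.\<close>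
  define d where "d = c / (2 * (R + 1)\<^sup>2)"
  have d: "d > 0" "d * (R + 1)\<^sup>2 = c / 2" using c R by (auto simp: d_def)
  note d_pos = d(1)
  have bnd: "u y \<le> \<bar>N\<bar>" "w y \<le> \<bar>N\<bar>" if "y \<in> K" for y using bound[of y] that by (auto simp: K_def)
  have frK: "frontier X \<subseteq> K" by (simp add: K_def frontier_def Diff_subset)
  have KX: "z \<in> frontier X" if "z \<in> K" "z \<notin> X" for z using that X(1) by (simp add: K_def frontier_def interior_open)
  \<comment> \<open>The factor 2 leaves room for a pair: if one point is in the ball of radius
    \<open>e \<zeta>\<close> of a finite subcover and the other is close to it, \<open>u\<close> and
    \<open>w\<close> still exceed their values at \<open>\<zeta>\<close> by less than
    \<open>c / 16\<close>.\<close>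
  have "\<forall>\<zeta>\<in>frontier X. \<exists>e>0. \<forall>z\<in>K. dist z \<zeta> < 2 * e \<longrightarrow> u z < u \<zeta> + c / 16 \<and> w z < w \<zeta> + c / 16"
  proof
    fix \<zeta> assume \<zeta>: "\<zeta> \<in> frontier X"
    have \<zeta>c: "\<zeta> \<in> closure X" using \<zeta> by (simp add: frontier_def)
    have "\<exists>e>0. \<forall>z\<in>K. dist z \<zeta> < e \<longrightarrow> ereal (u z) < ereal (u \<zeta> + c / 16)"
      using u(1)[unfolded usc_on_iff_ball, rule_format, OF \<zeta>c, of "ereal (u \<zeta> + c / 16)"] c by (simp add: K_def)
    moreover have "\<exists>e>0. \<forall>z\<in>K. dist z \<zeta> < e \<longrightarrow> ereal (w z) < ereal (w \<zeta> + c / 16)"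
      using w(1)[unfolded usc_on_iff_ball, rule_format, OF \<zeta>c, of "ereal (w \<zeta> + c / 16)"] c by (simp add: K_def)
    ultimately obtain e1 e2 where e: "e1 > 0" "\<And>z. z \<in> K \<Longrightarrow> dist z \<zeta> < e1 \<Longrightarrow> u z < u \<zeta> + c / 16"
      "e2 > 0" "\<And>z. z \<in> K \<Longrightarrow> dist z \<zeta> < e2 \<Longrightarrow> w z < w \<zeta> + c / 16" by auto
    then show "\<exists>e>0. \<forall>z\<in>K. dist z \<zeta> < 2 * e \<longrightarrow> u z < u \<zeta> + c / 16 \<and> w z < w \<zeta> + c / 16"
      by (intro exI[of _ "min e1 e2 / 2"]) auto
  qed
  then obtain e where e: "\<And>\<zeta>. \<zeta> \<in> frontier X \<Longrightarrow> 0 < e \<zeta>"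
    "\<And>\<zeta> z. \<zeta> \<in> frontier X \<Longrightarrow> z \<in> K \<Longrightarrow> dist z \<zeta> < 2 * e \<zeta> \<Longrightarrow> u z < u \<zeta> + c / 16 \<and> w z < w \<zeta> + c / 16"
    by metis
  have "compact (frontier X)" using X(2) by (simp add: compact_frontier_bounded)
  then obtain D where D: "D \<subseteq> frontier X" "finite D" "frontier X \<subseteq> (\<Union>\<zeta>\<in>D. ball \<zeta> (e \<zeta>))"
    using compact_ball_cover[of "frontier X" e, OF _ e(1)] by metis
  define \<delta> where "\<delta> = Min (insert 1 (e ` D))"
  have \<delta>: "0 < \<delta>" "\<And>\<zeta>. \<zeta> \<in> D \<Longrightarrow> \<delta> \<le> e \<zeta>" using D e(1) by (auto simp: \<delta>_def)
  have near: "u z + w z' < c / 8" if z: "z \<in> K" "z' \<in> K" "dist z z' < \<delta>" "z \<in> frontier X \<or> z' \<in> frontier X" for z z'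
  proof -
    obtain \<zeta>0 where \<zeta>0: "\<zeta>0 \<in> frontier X" "\<zeta>0 = z \<or> \<zeta>0 = z'" using z(4) by blast
    then obtain \<zeta> where \<zeta>: "\<zeta> \<in> D" "dist \<zeta> \<zeta>0 < e \<zeta>" using D(3) by auto
    have "dist z \<zeta> < 2 * e \<zeta>" "dist z' \<zeta> < 2 * e \<zeta>"
      using \<zeta>0(2) \<zeta> \<delta>(2)[OF \<zeta>(1)] z(3) e(1)[of \<zeta>] D(1) dist_triangle[of z \<zeta> z'] dist_triangle[of z' \<zeta> z]
      by (auto simp: dist_commute subset_iff)
    then have "u z < u \<zeta> + c / 16" "w z' < w \<zeta> + c / 16" using e(2) \<zeta>(1) D(1) z by blast+
    moreover have "u \<zeta> + w \<zeta> \<le> 0" using bd \<zeta>(1) D(1) by blast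
    ultimately show ?thesis by linarith
  qed
  define \<tau> where "\<tau> = min 1 (\<delta> / 3)"
  have \<tau>: "0 < \<tau>" "\<tau> \<le> 1" "2 * \<tau> < \<delta>" using \<delta>(1) by (auto simp: \<tau>_def)
  define C0 where "C0 = 2 * \<bar>N\<bar> + 2 * d * R\<^sup>2"
  have C0: "0 \<le> C0" using d by (simp add: C0_def)
  \<comment> \<open>This penalty forces the maximizers of a high point to lie within
    \<open>\<tau>\<close> of it. The summand \<open>2 * d\<close> in \<open>\<Lambda>\<close>
    absorbs the growth of the added quadratic away from \<open>K\<close>.\<close>
  define \<Lambda>' where "\<Lambda>' = (C0 + 1) / \<tau>\<^sup>2 + 1"
  define \<Lambda> where "\<Lambda> = 2 * d + \<Lambda>'"
  have \<Lambda>': "\<Lambda>' > 0" "(C0 + 1) / \<tau>\<^sup>2 \<le> \<Lambda>'" "\<Lambda>' \<ge> 1" using C0 \<tau> by (auto simp: \<Lambda>'_def intro!: add_nonneg_pos)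
  have \<Lambda>: "\<Lambda> > 0" "d + 1 \<le> \<Lambda>" using \<Lambda>' d by (auto simp: \<Lambda>_def)
  note u1 = u(1)[folded K_def] and w1 = w(1)[folded K_def]
  define a where "a = supconv K \<Lambda> u"
  define b where "b = supconv K \<Lambda> w"
  \<comment> \<open>Of the height \<open>3 * c / 4\<close> at most \<open>c / 2\<close> comes from
    the quadratic, so \<open>u z + w z'\<close> exceeds \<open>c / 8\<close>; by \<open>near\<close>
    neither maximizer is on the frontier.\<close>
  have interior: "z \<in> X \<and> z' \<in> X"
    if z: "z \<in> K" "a x = u z - \<Lambda> * (norm (x - z))\<^sup>2" and z': "z' \<in> K" "b x = w z' - \<Lambda> * (norm (x - z'))\<^sup>2"
      and hi: "3 * c / 4 < a x + b x + d * (norm x)\<^sup>2" for x z z'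
  proof -
    let ?m = "(norm (x - z))\<^sup>2 + (norm (x - z'))\<^sup>2"
    have "norm x \<le> R + norm (x - z)" using norm_triangle_ineq[of z "x - z"] R(2)[OF z(1)] by simp
    then have "(norm x)\<^sup>2 \<le> (R + norm (x - z))\<^sup>2" by (intro power_mono) auto
    also have "\<dots> \<le> 2 * R\<^sup>2 + 2 * (norm (x - z))\<^sup>2"
      using sum_squares_bound[of R "norm (x - z)"] by (simp add: power2_sum)
    also have "\<dots> \<le> 2 * R\<^sup>2 + 2 * ?m" by simp
    finally have nx: "d * (norm x)\<^sup>2 \<le> d * (2 * R\<^sup>2 + 2 * ?m)" using d by (intro mult_left_mono) auto
    have "\<Lambda> * ?m < u z + w z' + d * (norm x)\<^sup>2 - 3 * c / 4" using hi z(2) z'(2) by (simp add: distrib_left)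
    also have "\<dots> \<le> 2 * \<bar>N\<bar> + d * (2 * R\<^sup>2 + 2 * ?m)" using bnd(1)[OF z(1)] bnd(2)[OF z'(1)] nx c by linarith
    finally have m0: "\<Lambda>' * ?m < C0" by (simp add: \<Lambda>_def C0_def algebra_simps)
    have "((C0 + 1) / \<tau>\<^sup>2) * ?m \<le> \<Lambda>' * ?m" using \<Lambda>' by (intro mult_right_mono) auto
    then have "((C0 + 1) / \<tau>\<^sup>2) * ?m < C0" using m0 by (rule order.strict_trans1)
    then have "((C0 + 1) * ?m) / \<tau>\<^sup>2 < C0" by (simp only: times_divide_eq_left)
    then have "(C0 + 1) * ?m < C0 * \<tau>\<^sup>2" using \<tau>(1) by (simp only: pos_divide_less_eq zero_less_power)
    also have "\<dots> \<le> (C0 + 1) * \<tau>\<^sup>2" by (simp add: mult_right_mono)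
    finally have m: "?m < \<tau>\<^sup>2" using C0 by (simp add: mult_less_cancel_left)
    have "(norm (x - z))\<^sup>2 < \<tau>\<^sup>2" "(norm (x - z'))\<^sup>2 < \<tau>\<^sup>2"
      using m zero_le_power2[of "norm (x - z)"] zero_le_power2[of "norm (x - z')"] by linarith+
    then have nn: "norm (x - z) < \<tau>" "norm (x - z') < \<tau>" using \<tau>(1) power_less_imp_less_base[of _ 2 \<tau>] by auto
    then have "dist z z' < \<delta>"
      using dist_triangle[of z z' x] \<tau>(3) by (simp add: dist_norm norm_minus_commute)
    have "norm x \<le> R + 1" using \<open>norm x \<le> R + norm (x - z)\<close> nn(1) \<tau>(2) by simp
    then have "d * (norm x)\<^sup>2 \<le> d * (R + 1)\<^sup>2" using d by (intro mult_left_mono power_mono) auto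
    then have "d * (norm x)\<^sup>2 \<le> c / 2" using d(2) by simp
    moreover have "0 \<le> \<Lambda> * ?m" using \<Lambda> by simp
    ultimately have "u z + w z' > c / 8" using hi z(2) z'(2) c by (simp add: distrib_left)
    then have "\<not> (z \<in> frontier X \<or> z' \<in> frontier X)" using near[OF z(1) z'(1) \<open>dist z z' < \<delta>\<close>] by linarith
    then show ?thesis using KX z(1) z'(1) by blast
  qed
  have att_a: "\<exists>z\<in>K. a x = u z - \<Lambda> * (norm (x - z))\<^sup>2" for x
    unfolding a_def using supconv_attained[OF K(1,2) u1] by metis
  have att_b: "\<exists>z\<in>K. b x = w z - \<Lambda> * (norm (x - z))\<^sup>2" for x
    unfolding b_def using supconv_attained[OF K(1,2) w1] by metis
  have half: "v z - \<Lambda> * (norm (x - z))\<^sup>2 \<le> \<bar>N\<bar> - \<Lambda> * ((norm x)\<^sup>2 / 2 - R\<^sup>2)" if "z \<in> K" "v z \<le> \<bar>N\<bar>" for v x z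
  proof -
    have "norm x \<le> R + norm (x - z)" using norm_triangle_ineq[of z "x - z"] R(2)[OF that(1)] by simp
    then have "(norm x)\<^sup>2 \<le> (R + norm (x - z))\<^sup>2" by (intro power_mono) auto
    also have "\<dots> \<le> 2 * R\<^sup>2 + 2 * (norm (x - z))\<^sup>2"
      using sum_squares_bound[of R "norm (x - z)"] by (simp add: power2_sum)
    finally have "\<Lambda> * ((norm x)\<^sup>2 / 2 - R\<^sup>2) \<le> \<Lambda> * (norm (x - z))\<^sup>2" using \<Lambda> by (intro mult_left_mono) auto
    then show ?thesis using that(2) by linarith
  qed
  interpret contact_pair a b \<Lambda> d "2 * \<bar>N\<bar> + 2 * \<Lambda> * R\<^sup>2" "3 * c / 4" F "dual F" x0
  proof
    show "continuous_on UNIV a" "continuous_on UNIV b"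
      unfolding a_def b_def using \<Lambda> by (auto intro!: supconv_continuous K(1,2) u1 w1)
    show "\<exists>p. \<forall>y. a x + p \<bullet> (y - x) - \<Lambda> * (norm (y - x))\<^sup>2 \<le> a y" for x
      unfolding a_def using supconv_attained[OF K(1,2) u1] supconv_shift[OF K(1,2) u1] by metis
    show "\<exists>p. \<forall>y. b x + p \<bullet> (y - x) - \<Lambda> * (norm (y - x))\<^sup>2 \<le> b y" for x
      unfolding b_def using supconv_attained[OF K(1,2) w1] supconv_shift[OF K(1,2) w1] by metis
    show "a x + b x + d * (norm x)\<^sup>2 \<le> 2 * \<bar>N\<bar> + 2 * \<Lambda> * R\<^sup>2 - (norm x)\<^sup>2" for x
    proof -
      obtain z z' where "z \<in> K" "a x = u z - \<Lambda> * (norm (x - z))\<^sup>2" "z' \<in> K" "b x = w z' - \<Lambda> * (norm (x - z'))\<^sup>2"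
        using att_a att_b by metis
      then have "a x \<le> \<bar>N\<bar> - \<Lambda> * ((norm x)\<^sup>2 / 2 - R\<^sup>2)" "b x \<le> \<bar>N\<bar> - \<Lambda> * ((norm x)\<^sup>2 / 2 - R\<^sup>2)"
        using half bnd by simp_all
      moreover have "(d + 1) * (norm x)\<^sup>2 \<le> \<Lambda> * (norm x)\<^sup>2" using \<Lambda>(2) by (intro mult_right_mono) auto
      ultimately show ?thesis by (simp add: algebra_simps)
    qed
    have "u x0 \<le> a x0" "w x0 \<le> b x0"
      unfolding a_def b_def
      using supconv_attained[OF K(1,2) u1, of \<Lambda> x0] supconv_attained[OF K(1,2) w1, of \<Lambda> x0] K(4) by force+
    moreover have "0 \<le> d * (norm x0)\<^sup>2" using d by simp
    ultimately show "3 * c / 4 < a x0 + b x0 + d * (norm x0)\<^sup>2" using c by (simp add: c_def)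
    show "A \<in> F" if "3 * c / 4 < a x + b x + d * (norm x)\<^sup>2" "A \<in> Sym2" "0 < r"
      "\<And>y. y \<in> ball x r \<Longrightarrow> a y \<le> a x + p \<bullet> (y - x) + (y - x) \<bullet> (A *v (y - x)) / 2" for x A p r
    proof -
      obtain z z' where "z \<in> K" "a x = u z - \<Lambda> * (norm (x - z))\<^sup>2" "z' \<in> K" "b x = w z' - \<Lambda> * (norm (x - z'))\<^sup>2"
        using att_a att_b by metis
      then show ?thesis using supconv_test[OF K(1,2) u1 X(1) K(3) u(2), of z \<Lambda> x A r p] interior[of z x z'] that
        unfolding a_def by blast
    qed
    show "A \<in> dual F" if "3 * c / 4 < a x + b x + d * (norm x)\<^sup>2" "A \<in> Sym2" "0 < r"
      "\<And>y. y \<in> ball x r \<Longrightarrow> b y \<le> b x + p \<bullet> (y - x) + (y - x) \<bullet> (A *v (y - x)) / 2" for x A p r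
    proof -
      obtain z z' where "z \<in> K" "a x = u z - \<Lambda> * (norm (x - z))\<^sup>2" "z' \<in> K" "b x = w z' - \<Lambda> * (norm (x - z'))\<^sup>2"
        using att_a att_b by metis
      then show ?thesis using supconv_test[OF K(1,2) w1 X(1) K(3) w(2), of z' \<Lambda> x A r p] interior[of z x z'] that
        unfolding b_def by blast
    qed
  qed (use \<Lambda> d in auto)
  obtain A where A: "\<And>e. e > 0 \<Longrightarrow> A + e *\<^sub>R mat 1 \<in> F" "\<And>e. e > 0 \<Longrightarrow> (- A - (2 * d) *\<^sub>R mat 1) + e *\<^sub>R mat 1 \<in> dual F"
    using contact_matrix by blast
  have d2: "d / 2 > 0" using d_pos by simp
  \<comment> \<open>Both summands are given the tolerance \<open>d / 2\<close>. Half of the gap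
    \<open>2 * d\<close> remains to push the first matrix into the interior, whose elements are
    never negatives of elements of the dual.\<close>
  have "(A + (d / 2) *\<^sub>R mat 1) + d *\<^sub>R mat 1 \<in> IntF F" by (rule add_scaled_id_IntF[OF F A(1)[OF d2] d_pos])
  moreover have "(A + (d / 2) *\<^sub>R mat 1) + d *\<^sub>R mat 1 = - ((- A - (2 * d) *\<^sub>R mat 1) + (d / 2) *\<^sub>R mat 1)"
  proof -
    have "(2 * d) *\<^sub>R (mat 1 :: real^'n^'n) = (d / 2) *\<^sub>R mat 1 + (d / 2) *\<^sub>R mat 1 + d *\<^sub>R mat 1"
      unfolding scaleR_add_left[symmetric] by simp
    then show ?thesis by simp
  qed
  ultimately show False using A(2)[OF d2] by (simp add: dual_def)
qed

text \<open>Both functions are truncated below at \<open>- N\<close>, where \<open>N\<close> bounds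
  them from above. Truncation is a maximum with a constant, which is subharmonic because 0 lies in
  \<open>F\<close> and in its dual.\<close>

lemma comparison:
  fixes u w :: "real^'n \<Rightarrow> ereal"
  assumes F: "cone_subequation F" and zero: "0 \<in> F" "0 \<in> dual F" and X: "open X" "bounded X"
    and u: "usc_on (closure X) u" "F_sub F X u" "\<And>y. y \<in> closure X \<Longrightarrow> u y < \<infinity>"
    and w: "usc_on (closure X) w" "F_sub (dual F) X w" "\<And>y. y \<in> closure X \<Longrightarrow> w y < \<infinity>"
    and bd: "\<And>y. y \<in> frontier X \<Longrightarrow> u y + w y \<le> 0" and x: "x \<in> X"
  shows "u x + w x \<le> 0"
proof -
  let ?K = "closure X"
  have K: "compact ?K" using X by simp
  obtain N1 N2 where "\<And>y. y \<in> ?K \<Longrightarrow> u y \<le> ereal N1" "\<And>y. y \<in> ?K \<Longrightarrow> w y \<le> ereal N2"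
    using usc_real_bound[OF K u(1,3)] usc_real_bound[OF K w(1,3)] by metis
  then have N: "u y \<le> ereal N" "w y \<le> ereal N" if "y \<in> ?K" "N = max 0 (max N1 N2)" for y N
    using that by (auto intro: order_trans simp: le_max_iff_disj)
  define N where "N = max 0 (max N1 N2)"
  have N0: "0 \<le> N" and uN: "\<And>y. y \<in> ?K \<Longrightarrow> u y \<le> ereal N" and wN: "\<And>y. y \<in> ?K \<Longrightarrow> w y \<le> ereal N"
    using N by (auto simp: N_def)
  define u' where "u' y = real_of_ereal (max (u y) (ereal (- N)))" for y
  define w' where "w' y = real_of_ereal (max (w y) (ereal (- N)))" for y
  have u'e: "ereal (u' y) = max (u y) (ereal (- N))" if "y \<in> ?K" for y
    using uN[OF that] unfolding u'_def by (cases "u y") (auto simp: max_def)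
  have w'e: "ereal (w' y) = max (w y) (ereal (- N))" if "y \<in> ?K" for y
    using wN[OF that] unfolding w'_def by (cases "w y") (auto simp: max_def)
  have XK: "X \<subseteq> ?K" by (rule closure_subset)
  have usc_c: "usc_on ?K (\<lambda>y. ereal (- N))" by (intro usc_on_continuous continuous_intros)
  have usc_u: "usc_on ?K (\<lambda>y. ereal (u' y))" and usc_w: "usc_on ?K (\<lambda>y. ereal (w' y))"
    using usc_on_max[OF u(1) usc_c] usc_on_max[OF w(1) usc_c] 
      usc_on_cong[of ?K "\<lambda>y. ereal (u' y)", OF u'e] usc_on_cong[of ?K "\<lambda>y. ereal (w' y)", OF w'e] by simp_all
  have sub_u: "F_sub F X (\<lambda>y. ereal (u' y))"
    by (rule F_sub_cong[OF _ F_sub_max[OF u(2) F_sub_const[OF F zero(1) X(1), of "- N"]]]) (use u'e XK in auto)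
  have sub_w: "F_sub (dual F) X (\<lambda>y. ereal (w' y))"
    by (rule F_sub_cong[OF _ F_sub_max[OF w(2) F_sub_const[OF dual_cone_subequation[OF F] zero(2) X(1), of "- N"]]])
       (use w'e XK in auto)
  have bounds: "u' y \<le> N \<and> w' y \<le> N" if "y \<in> ?K" for y
  proof -
    have "ereal (u' y) \<le> ereal N" "ereal (w' y) \<le> ereal N"
      unfolding u'e[OF that] w'e[OF that] using uN[OF that] wN[OF that] N0 by auto
    then show ?thesis by simp
  qed
  have "u' x + w' x \<le> 0"
  proof (rule comparison_real[OF F X usc_u sub_u usc_w sub_w bounds _ x])
    fix y assume y: "y \<in> frontier X"
    then have yK: "y \<in> ?K" by (simp add: frontier_def)
    \<comment> \<open>Where one truncation is active, the other function is still at most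
      \<open>N\<close>, so the sum stays nonpositive.\<close>
    have "max (u y) (ereal (- N)) + max (w y) (ereal (- N)) \<le> 0"
      using bd[OF y] uN[OF yK] wN[OF yK] N0 by (cases "u y"; cases "w y") (auto simp: max_def)
    then have "ereal (u' y) + ereal (w' y) \<le> 0" by (simp only: u'e[OF yK] w'e[OF yK])
    then show "u' y + w' y \<le> 0" by simp
  qed auto
  then have "ereal (u' x) + ereal (w' x) \<le> 0" by simp
  moreover have "u x + w x \<le> ereal (u' x) + ereal (w' x)"
    using u'e w'e XK x by (intro add_mono) auto
  ultimately show ?thesis by (rule order_trans[rotated])
qed

subsection \<open>Comparison with isolated singularities\<close>

text \<open>The factor \<open>1 + \<epsilon>\<close> is allowed because \<open>F\<close> is a cone.
  It could spoil the inequality on the outer frontier, where \<open>v\<close> may be as large as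
  \<open>M\<close>, and the subtracted constant compensates for this. Both changes vanish as
  \<open>\<epsilon>\<close> tends to 0 at the fixed point \<open>y\<close>.\<close>

lemma punctured_comparison:
  fixes v w :: "real^'n \<Rightarrow> ereal"
  assumes F: "cone_subequation F" and zero: "0 \<in> F" "0 \<in> dual F" and X: "open X" "bounded X"
    and S: "finite S" "S \<subseteq> X"
    and v: "usc_on (closure X - S) v" "F_sub F (X - S) v" "\<And>y. y \<in> closure X - S \<Longrightarrow> v y \<le> ereal M"
    and w: "usc_on (closure X - S) w" "F_sub (dual F) (X - S) w" "\<And>y. y \<in> closure X - S \<Longrightarrow> w y < \<infinity>"
    and bd: "\<And>y. y \<in> frontier X \<Longrightarrow> v y + w y \<le> 0"
    and near: "\<And>s. s \<in> S \<Longrightarrow> \<exists>h C. (h \<longlongrightarrow> -\<infinity>) (at s) \<and>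
        (\<forall>\<^sub>F y in at s. v y \<le> h y + ereal C \<and> w y \<le> - h y + ereal C)"
    and y: "y \<in> X - S"
  shows "v y + w y \<le> 0"
proof -
  have clXS: "frontier X \<subseteq> closure X - S" using S X by (auto simp: frontier_def interior_open)
  have wy: "w y < \<infinity>" using w(3) y closure_subset by blast
  have key: "ereal (1 + \<epsilon>) * v y + ereal (- \<epsilon> * max M 0) + w y \<le> 0" if \<epsilon>: "0 < \<epsilon>" for \<epsilon>
  proof -
    have "\<exists>r>0. y \<notin> cball s r \<and> cball s r \<subseteq> X \<and> (\<forall>z. dist s z = r \<longrightarrow> ereal (1 + \<epsilon>) * v z + w z \<le> 0)" if s: "s \<in> S" for s
    proof -
      obtain h C where h: "(h \<longlongrightarrow> -\<infinity>) (at s)" and C: "\<forall>\<^sub>F z in at s. v z \<le> h z + ereal C \<and> w z \<le> - h z + ereal C"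
        using near[OF s] by blast
      \<comment> \<open>Chosen so that \<open>h < m\<close> makes
        \<open>\<epsilon> * h + (2 + \<epsilon>) * C\<close> negative, and this expression bounds
        \<open>(1 + \<epsilon>) * v + w\<close> near \<open>s\<close>.\<close>
      define m where "m = - ((2 + \<epsilon>) * \<bar>C\<bar>) / \<epsilon>"
      have "\<forall>\<^sub>F z in at s. h z < ereal m" using h by (rule order_tendstoD) simp
      moreover have "\<forall>\<^sub>F z in at s. z \<in> (X - (S - {s})) - {s}"
        using X(1) S s by (intro eventually_at_in_open) (auto intro!: open_Diff finite_imp_closed)
      ultimately have "\<forall>\<^sub>F z in at s. h z < ereal m \<and> z \<in> X - S \<and> v z \<le> h z + ereal C \<and> w z \<le> - h z + ereal C"
        using C by eventually_elim auto
      then obtain r where r: "r > 0" "\<And>z. z \<noteq> s \<Longrightarrow> dist z s < r \<Longrightarrow>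
          h z < ereal m \<and> z \<in> X - S \<and> v z \<le> h z + ereal C \<and> w z \<le> - h z + ereal C"
        unfolding eventually_at by auto
      have sy: "dist s y > 0" using y s by auto
      define q where "q = min r (dist s y) / 2"
      have q: "0 < q" "q < r" "q < dist s y" 
        using r(1) sy min.cobounded1[of r "dist s y"] min.cobounded2[of r "dist s y"]
        unfolding q_def by (simp, linarith+)
      have "ereal (1 + \<epsilon>) * v z + w z \<le> 0" if z: "dist s z = q" for z
      proof -
        have zz: "h z < ereal m" "v z \<le> h z + ereal C" "w z \<le> - h z + ereal C" "z \<in> X - S"
          using r(2)[of z] z q by (auto simp: dist_commute)
        show ?thesis
        proof (cases "v z = -\<infinity>")
          case True
          have "w z < \<infinity>" using w(3)[of z] zz(4) closure_subset by blast
          then show ?thesis using True \<epsilon> by (cases "w z") auto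
        next
          case False
          then obtain H where H: "h z = ereal H" using zz(1,2) by (cases "h z") auto
          obtain V where V: "v z = ereal V" using False zz(2) H by (cases "v z") auto
          have "(1 + \<epsilon>) * V \<le> (1 + \<epsilon>) * (H + C)" using zz(2) V H \<epsilon> by (intro mult_left_mono) auto
          moreover have "\<epsilon> * H < \<epsilon> * m" using zz(1) H \<epsilon> by simp
          moreover have "\<epsilon> * m = - ((2 + \<epsilon>) * \<bar>C\<bar>)" using \<epsilon> by (simp add: m_def)
          moreover have "(2 + \<epsilon>) * C \<le> (2 + \<epsilon>) * \<bar>C\<bar>" using \<epsilon> by (intro mult_left_mono) auto
          ultimately have "(1 + \<epsilon>) * V + (- H + C) \<le> 0" by (simp add: algebra_simps)
          then show ?thesis using zz(3) H V by (cases "w z") auto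
        qed
      qed
      moreover have "z \<in> X" if "dist s z \<le> q" for z
        using r(2)[of z] q that s S(2) by (cases "z = s") (auto simp: dist_commute)
      then have "cball s q \<subseteq> X" by auto
      ultimately show ?thesis using q by (intro exI[of _ q]) auto
    qed
    then obtain r where r: "\<And>s. s \<in> S \<Longrightarrow> 0 < r s" "\<And>s. s \<in> S \<Longrightarrow> y \<notin> cball s (r s)"
      "\<And>s. s \<in> S \<Longrightarrow> cball s (r s) \<subseteq> X"
      "\<And>s z. s \<in> S \<Longrightarrow> dist s z = r s \<Longrightarrow> ereal (1 + \<epsilon>) * v z + w z \<le> 0" by metis
    define Y where "Y = X - (\<Union>s\<in>S. cball s (r s))"
    have oY: "open Y" unfolding Y_def using X S by (intro open_Diff closed_UN) auto
    have YX: "Y \<subseteq> X - S" using r(1) by (fastforce simp: Y_def)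
    have "closure Y \<subseteq> closure X - (\<Union>s\<in>S. ball s (r s))"
    proof -
      have "closed (closure X - (\<Union>s\<in>S. ball s (r s)))" by (intro closed_Diff open_UN) auto
      moreover have "Y \<subseteq> closure X - (\<Union>s\<in>S. ball s (r s))"
        using closure_subset by (fastforce simp: Y_def)
      ultimately show ?thesis by (rule closure_minimal[rotated])
    qed
    then have clY: "closure Y \<subseteq> closure X - S" and clYb: "\<And>z s. z \<in> closure Y \<Longrightarrow> s \<in> S \<Longrightarrow> r s \<le> dist s z"
      using r(1) by fastforce+
    let ?u = "\<lambda>z. ereal (1 + \<epsilon>) * v z + ereal (- \<epsilon> * max M 0)"
    have ve: "ereal (1 + \<epsilon>) * t + ereal c < b \<longleftrightarrow> t < (b - ereal c) / ereal (1 + \<epsilon>)" for t b :: ereal and c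
      using \<epsilon> by (cases t; cases b) (auto simp: field_simps)
    have "?u y + w y \<le> 0"
    proof (rule comparison[OF F zero oY])
      show "bounded Y" using X(2) YX by (blast intro: bounded_subset)
      show "usc_on (closure Y) ?u" using usc_on_subset[OF v(1) clY] unfolding usc_on_def ve by blast
      show "F_sub F Y ?u" using \<epsilon> by (intro F_sub_scale_add[OF F F_sub_subset[OF v(2) YX]]) auto
      show "?u z < \<infinity>" if "z \<in> closure Y" for z using v(3)[of z] clY that \<epsilon> by (cases "v z") auto
      show "usc_on (closure Y) w" "F_sub (dual F) Y w" using usc_on_subset[OF w(1) clY] F_sub_subset[OF w(2) YX] by auto
      show "w z < \<infinity>" if "z \<in> closure Y" for z using w(3) clY that by blast
      show "y \<in> Y" using y r(2) by (auto simp: Y_def)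
      show "?u z + w z \<le> 0" if z: "z \<in> frontier Y" for z
      proof -
        have zc: "z \<in> closure Y" "z \<notin> Y" using z oY by (auto simp: frontier_def interior_open)
        define m' where "m' = \<epsilon> * max M 0"
        have m': "- \<epsilon> * max M 0 = - m'" "0 \<le> m'" using \<epsilon> by (auto simp: m'_def)
        have zM: "v z \<le> ereal M" "w z < \<infinity>" using v(3) w(3) zc(1) clY by auto
        show ?thesis
        proof (cases "z \<in> X")
          case True
          then obtain s where s: "s \<in> S" "dist s z \<le> r s" using zc(2) by (auto simp: Y_def)
          then have "ereal (1 + \<epsilon>) * v z + w z \<le> 0" using r(4) clYb[OF zc(1)] by force
          then show ?thesis unfolding m'(1) using m'(2) \<epsilon> zM(2) by (cases "v z"; cases "w z") auto
        next
          case False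
          then have "z \<in> frontier X" using zc(1) clY X(1) by (auto simp: frontier_def interior_open)
          then have b: "v z + w z \<le> 0" by (rule bd)
          show ?thesis
          proof (cases "v z")
            case (real V)
            have "\<epsilon> * V \<le> m'" unfolding m'_def using zM(1) real \<epsilon> by (intro mult_left_mono) auto
            then show ?thesis unfolding m'(1) using b real zM(2) by (cases "w z") (auto simp: distrib_right)
          qed (use zM \<epsilon> in \<open>cases "w z"; auto\<close>)+
        qed
      qed
    qed
    then show ?thesis .
  qed
  show ?thesis
  proof (cases "v y")
    case (real V)
    show ?thesis
    proof (cases "w y")
      case (real W)
      have "V + \<epsilon> * (V - max M 0) + W \<le> 0" if "0 < \<epsilon>" for \<epsilon>
        using key[OF that] real \<open>v y = ereal V\<close> by (simp add: algebra_simps)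
      moreover have "((\<lambda>\<epsilon>. V + \<epsilon> * (V - max M 0) + W) \<longlongrightarrow> V + 0 * (V - max M 0) + W) (at_right 0)"
        by (intro tendsto_intros)
      ultimately have "V + 0 * (V - max M 0) + W \<le> 0"
        by (intro tendsto_upperbound[where F="at_right (0::real)"])
           (auto simp: eventually_at_right_field intro!: exI[of _ 1])
      then show ?thesis using real \<open>v y = ereal V\<close> by simp
    qed (use wy real in auto)
  qed (use wy v(3)[of y] y closure_subset in \<open>cases "w y"; auto\<close>)+
qed

subsection \<open>Barriers and gluing\<close>

text \<open>At a positive maximum of \<open>v - \<xi>\<close> a vertical translate of
  \<open>\<xi>\<close> is itself a test function. This elementary case uses no comparison
  theorem.\<close>

lemma C2_max_principle:
  fixes v :: "real^'n \<Rightarrow> ereal"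
  assumes X: "open X" "bounded X" and v: "usc_on (closure X) v" "F_sub F X v" "\<And>y. y \<in> closure X \<Longrightarrow> v y < \<infinity>"
    and C2: "C2_hess U \<xi> g Hs" "closure X \<subseteq> U" and H: "\<And>x. x \<in> X \<Longrightarrow> Hs x \<notin> F"
    and bd: "\<And>y. y \<in> frontier X \<Longrightarrow> v y \<le> ereal (\<xi> y)" and x: "x \<in> X"
  shows "v x \<le> ereal (\<xi> x)"
proof (rule ccontr)
  assume neg: "\<not> ?thesis"
  let ?f = "\<lambda>y. v y + ereal (- \<xi> y)"
  have xc: "x \<in> closure X" using x closure_subset by blast
  have "usc_on (closure X) ?f"
    by (intro usc_on_add v(1) usc_on_continuous continuous_intros continuous_on_subset[OF C2_hess_continuous[OF C2(1)] C2(2)])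
       (use v(3) in auto)
  then obtain z where z: "z \<in> closure X" "\<And>y. y \<in> closure X \<Longrightarrow> ?f y \<le> ?f z"
    using usc_attains_max[of "closure X" ?f] X(2) x by auto
  have "0 < ?f x" using neg by (cases "v x") auto
  then have pos: "0 < ?f z" using z(2)[OF xc] by (rule order_less_le_trans)
  then obtain m where m: "v z = ereal (\<xi> z + m)" "m > 0" using v(3)[OF z(1)]
    by (cases "v z") (auto intro: that[of "real_of_ereal (v z) - \<xi> z"])
  have zX: "z \<in> X"
    using bd[of z] m z(1) X(1) by (auto simp: frontier_def interior_open)
  have XU: "X \<subseteq> U" using C2(2) closure_subset by blast
  have c2: "C2_hess X (\<lambda>y. \<xi> y + m) (\<lambda>y. g y + 0) (\<lambda>y. Hs y + 0)"
    by (intro C2_hess_add C2_hess_subset[OF C2(1) X(1) XU] C2_hess_const X(1))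
  have "Hs z + 0 \<in> F"
  proof (rule F_sub_test[OF v(2) zX order_refl c2])
    fix y assume "y \<in> X"
    then have "v y + ereal (- \<xi> y) \<le> ereal m" using z(2)[of y] m closure_subset[of X] by auto
    then show "v y \<le> ereal (\<xi> y + m)" by (cases "v y") auto
  qed (use m in auto)
  then show False using H[OF zX] by simp
qed

lemma proj_line_normalized:
  "proj_line g = (norm g)\<^sup>2 *\<^sub>R proj_line (g /\<^sub>R norm g)"
  by (cases "g = 0") (auto simp: proj_line_def vec_eq_iff power2_eq_square field_simps)

text \<open>The barrier is the defining function plus a multiple of its square minus a small
  multiple of the squared distance. The square supplies the normal projection demanded by strict
  convexity, and the last term makes the barrier negative on the closure away from
  \<open>x0\<close>.\<close>

lemma strict_barrier:
  fixes \<Omega> :: "(real^'n) set"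
  assumes \<Omega>: "open \<Omega>" and x0: "x0 \<in> frontier \<Omega>"
    and U: "x0 \<in> U" and C2: "C2_hess U \<rho> g Hs" and def: "\<Omega> \<inter> U = {y\<in>U. \<rho> y < 0}" and g: "g x0 \<noteq> 0"
    and conv: "\<forall>t\<ge>t0. Hs x0 + t *\<^sub>R proj_line (g x0 /\<^sub>R norm (g x0)) \<in> IntF G"
  shows "\<exists>r>0. \<exists>\<beta> g' H' \<delta>. 0 < \<delta> \<and> C2_hess (ball x0 r) \<beta> g' H' \<and> (\<forall>y\<in>ball x0 r. H' y \<in> IntF G) \<and> \<beta> x0 = 0
     \<and> (\<forall>y\<in>closure \<Omega> \<inter> ball x0 r. \<beta> y \<le> - \<delta> * (norm (y - x0))\<^sup>2)"
proof -
  have oU: "open U" using C2 by (simp add: C2_hess_def)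
  have cont: "continuous_on U \<rho>" by (rule C2_hess_continuous[OF C2])
  have le0: "\<rho> y \<le> 0" if y: "y \<in> closure \<Omega>" "y \<in> U" for y
  proof (rule ccontr)
    assume "\<not> \<rho> y \<le> 0"
    have "open (U \<inter> \<rho> -` {0<..})" by (rule continuous_open_preimage[OF cont oU open_greaterThan])
    then have "open {z\<in>U. 0 < \<rho> z}" by (simp add: Int_def)
    then obtain z where "z \<in> \<Omega>" "z \<in> U" "0 < \<rho> z"
      using y \<open>\<not> \<rho> y \<le> 0\<close> closure_iff_nhds_not_empty[of y \<Omega>] by force
    then show False using def by force
  qed
  have r0: "\<rho> x0 = 0"
  proof -
    have "x0 \<in> closure \<Omega>" "x0 \<notin> \<Omega>" using x0 \<Omega> by (auto simp: frontier_def interior_open)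
    then show ?thesis using le0[OF _ U] def U by force
  qed
  \<comment> \<open>Then \<open>2 * c * (norm (g x0))\<^sup>2\<close>, the coefficient of the unit
    normal projection, equals \<open>\<bar>t0\<bar> + 1\<close>.\<close>
  define c where "c = (\<bar>t0\<bar> + 1) / (2 * (norm (g x0))\<^sup>2)"
  have c: "c > 0" using g by (simp add: c_def)
  define A where "A = Hs x0 + (2 * c * (norm (g x0))\<^sup>2) *\<^sub>R proj_line (g x0 /\<^sub>R norm (g x0))"
  have "2 * c * (norm (g x0))\<^sup>2 = \<bar>t0\<bar> + 1" using g by (simp add: c_def)
  then have A: "A \<in> IntF G" unfolding A_def using conv by auto
  obtain e where e: "e > 0" "\<And>B. B \<in> Sym2 \<Longrightarrow> dist B A < e \<Longrightarrow> B \<in> IntF G" using IntF_open[OF A] by blast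
  define n where "n = norm (mat 1 :: real^'n^'n) + 1"
  have n: "n > 0" by (simp add: n_def add_nonneg_pos)
  \<comment> \<open>The subtracted identity uses up half of the radius \<open>e\<close>; the other
    half is left for the variation of the Hessian near \<open>x0\<close>.\<close>
  define \<delta> where "\<delta> = e / (4 * n)"
  have \<delta>: "\<delta> > 0" using e n by (simp add: \<delta>_def)
  define \<beta> where "\<beta> y = (\<rho> y + c * (\<rho> y)\<^sup>2) + (0 + - \<delta> * (norm (y - x0))\<^sup>2)" for y
  define g' where "g' y = (g y + c *\<^sub>R ((2 * \<rho> y) *\<^sub>R g y)) + (2 * - \<delta>) *\<^sub>R (y - x0)" for y
  define H' where "H' y = (Hs y + c *\<^sub>R ((2 * \<rho> y) *\<^sub>R Hs y + 2 *\<^sub>R proj_line (g y))) + (2 * - \<delta>) *\<^sub>R mat 1" for y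
  have C2': "C2_hess U \<beta> g' H'"
    unfolding \<beta>_def g'_def H'_def
    by (intro C2_hess_add C2 C2_hess_scale C2_hess_square C2_hess_norm_square oU)
  have "H' x0 = A - (2 * \<delta>) *\<^sub>R mat 1"
    unfolding H'_def A_def r0 using proj_line_normalized[of "g x0"] by (simp add: scaleR_add_right)
  then have "dist (H' x0) A = 2 * \<delta> * norm (mat 1 :: real^'n^'n)" using \<delta> by (simp add: dist_norm)
  also have "\<dots> \<le> 2 * \<delta> * n" using \<delta> by (simp add: n_def)
  also have "\<dots> = e / 2" using n by (simp add: \<delta>_def)
  finally have d0: "dist (H' x0) A \<le> e / 2" .
  have "continuous_on U H'" using C2' by (simp add: C2_hess_def)
  then have "\<forall>\<^sub>F y in at x0. dist (H' y) (H' x0) < e / 2"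
  proof -
    have "0 < e / 2" using e(1) by simp
    then show ?thesis using \<open>continuous_on U H'\<close> U oU
      by (simp only: continuous_on_eq_continuous_at continuous_at tendsto_iff)
  qed
  moreover have "\<forall>\<^sub>F y in at x0. dist (\<rho> y) (\<rho> x0) < 1 / c"
  proof -
    have "0 < 1 / c" using c by simp
    then show ?thesis using cont U oU
      by (simp only: continuous_on_eq_continuous_at continuous_at tendsto_iff)
  qed
  moreover have "\<forall>\<^sub>F y in at x0. y \<in> U" using oU U by (intro eventually_at_in_open') auto
  ultimately have "\<forall>\<^sub>F y in at x0. dist (H' y) (H' x0) < e / 2 \<and> dist (\<rho> y) (\<rho> x0) < 1 / c \<and> y \<in> U"
    by eventually_elim auto
  then obtain r where r: "r > 0" and r': "\<And>y. y \<noteq> x0 \<Longrightarrow> dist y x0 < r \<Longrightarrow>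
      dist (H' y) (H' x0) < e / 2 \<and> dist (\<rho> y) (\<rho> x0) < 1 / c \<and> y \<in> U"
    unfolding eventually_at by auto
  have r'': "dist (H' y) (H' x0) < e / 2 \<and> dist (\<rho> y) (\<rho> x0) < 1 / c \<and> y \<in> U" if "y \<in> ball x0 r" for y
    using r'[of y] that e c U by (cases "y = x0") (auto simp: dist_commute)
  have bU: "ball x0 r \<subseteq> U" using r'' by blast
  show ?thesis
  proof (rule exI[of _ r], intro exI[of _ \<beta>] exI[of _ g'] exI[of _ H'] exI[of _ \<delta>] conjI ballI r \<delta>)
    show "C2_hess (ball x0 r) \<beta> g' H'" by (rule C2_hess_subset[OF C2' open_ball bU])
    show "\<beta> x0 = 0" by (simp add: \<beta>_def r0)
    show "H' y \<in> IntF G" if y: "y \<in> ball x0 r" for y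
    proof (rule e(2))
      show "H' y \<in> Sym2" using C2_hess_symmetric[OF C2'] bU y by blast
      show "dist (H' y) A < e" using r''[OF y] d0 dist_triangle[of "H' y" A "H' x0"] by simp
    qed
    show "\<beta> y \<le> - \<delta> * (norm (y - x0))\<^sup>2" if y: "y \<in> closure \<Omega> \<inter> ball x0 r" for y
    proof -
    have "\<rho> y \<le> 0" "\<bar>\<rho> y\<bar> < 1 / c" using y le0[of y] r''[of y] by (auto simp: r0 dist_real_def)
    \<comment> \<open>Nonpositivity of \<open>\<rho> + c * \<rho>\<^sup>2\<close> on the closure
      needs \<open>\<rho>\<close> between \<open>- 1 / c\<close> and 0, whence the second smallness
      condition on \<open>r\<close>.\<close>
    then have "c * (- \<rho> y) \<le> 1" "0 \<le> - \<rho> y" using c by (auto simp: field_simps)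
    then have "(c * (- \<rho> y)) * (- \<rho> y) \<le> 1 * (- \<rho> y)" by (intro mult_right_mono)
    then show ?thesis by (simp add: \<beta>_def power2_eq_square mult.assoc)
    qed
  qed
qed

text \<open>On the annulus between \<open>r / 2\<close> and \<open>r\<close> the maximum is just
  \<open>a\<close>. The two definitions of \<open>v\<close> thus overlap on an open set, and both
  properties are local.\<close>

lemma glue_subharmonics:
  fixes a b :: "real^'n \<Rightarrow> ereal"
  assumes X: "open X" and r: "0 < r"
    and a: "usc_on D a" "F_sub F X a" and b: "usc_on (D \<inter> ball x0 r) b" "F_sub F (X \<inter> ball x0 r) b"
    and le: "\<And>y. y \<in> D \<union> X \<Longrightarrow> dist x0 y < r \<Longrightarrow> r / 2 \<le> dist x0 y \<Longrightarrow> b y \<le> a y"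
  defines "v \<equiv> \<lambda>y. if y \<in> ball x0 r then max (a y) (b y) else a y"
  shows "usc_on D v" "F_sub F X v"
proof -
  have va: "v y = a y" if "y \<in> D \<union> X" "r / 2 < dist x0 y" for y
    using le[of y] that unfolding v_def by (auto simp: max_def)
  show "usc_on D v"
    unfolding usc_on_iff_ball
  proof (intro ballI allI impI)
    fix x c assume x: "x \<in> D" "v x < c"
    show "\<exists>e>0. \<forall>y\<in>D. dist y x < e \<longrightarrow> v y < c"
    proof (cases "dist x0 x < r")
      case True
      then have "a x < c" "b x < c" using x by (auto simp: v_def)
      then obtain e1 e2 where "0 < e1" "\<And>y. y \<in> D \<Longrightarrow> dist y x < e1 \<Longrightarrow> a y < c" "0 < e2"
        "\<And>y. y \<in> D \<Longrightarrow> dist x0 y < r \<Longrightarrow> dist y x < e2 \<Longrightarrow> b y < c"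
        using a(1) b(1) x(1) True unfolding usc_on_iff_ball by (metis IntI mem_ball)
      then show ?thesis
        by (intro exI[of _ "min e1 e2"]) (auto simp: v_def)
    next
      case False
      then have "a x < c" using x by (auto simp: v_def)
      then obtain e where e: "0 < e" "\<And>y. y \<in> D \<Longrightarrow> dist y x < e \<Longrightarrow> a y < c"
        using a(1) x(1) unfolding usc_on_iff_ball by metis
      have "v y < c" if "y \<in> D" "dist y x < min e (r / 2)" for y
      proof -
        have "r / 2 < dist x0 y" using False that dist_triangle[of x0 x y] by (simp add: dist_commute)
        then show ?thesis using va that e by auto
      qed
      then show ?thesis using e r by (intro exI[of _ "min e (r / 2)"]) auto
    qed
  qed
  show "F_sub F X v"
  proof (rule F_sub_local[OF X])
    fix x assume x: "x \<in> X"
    show "\<exists>N. open N \<and> x \<in> N \<and> N \<subseteq> X \<and> F_sub F N v"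
    proof (cases "dist x0 x < r")
      case True
      have "F_sub F (X \<inter> ball x0 r) (\<lambda>y. max (a y) (b y))"
        by (intro F_sub_max b(2) F_sub_subset[OF a(2)]) auto
      then have "F_sub F (X \<inter> ball x0 r) v" by (rule F_sub_cong[rotated]) (auto simp: v_def)
      then show ?thesis using True x X by (intro exI[of _ "X \<inter> ball x0 r"]) auto
    next
      case False
      have "F_sub F (X - cball x0 (r / 2)) a" by (rule F_sub_subset[OF a(2)]) auto
      then have "F_sub F (X - cball x0 (r / 2)) v" by (rule F_sub_cong[rotated]) (use va in auto)
      then show ?thesis using False x X r by (intro exI[of _ "X - cball x0 (r / 2)"]) auto
    qed
  qed
qed

subsection \<open>Upper semicontinuous regularization\<close>

definition usc_reg :: "(real^'n) set \<Rightarrow> (real^'n \<Rightarrow> ereal) \<Rightarrow> real^'n \<Rightarrow> ereal" where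
  "usc_reg D f y = (INF r\<in>{0<..}. SUP z\<in>D \<inter> ball y r. f z)"

lemma usc_reg_less:
  assumes "usc_reg D f y < c"
  obtains r where "0 < r" "\<And>z. z \<in> D \<Longrightarrow> dist y z < r \<Longrightarrow> f z < c"
proof -
  from assms obtain r where r: "0 < r" "(SUP z\<in>D \<inter> ball y r. f z) < c"
    unfolding usc_reg_def by (auto simp: INF_less_iff)
  have "f z < c" if "z \<in> D" "dist y z < r" for z
    using r(2) SUP_upper[of z "D \<inter> ball y r" f] that by (auto intro: order_le_less_trans)
  then show ?thesis using r(1) that by blast
qed

lemma usc_reg_le:
  assumes "0 < r" "\<And>z. z \<in> D \<Longrightarrow> dist y z < r \<Longrightarrow> f z \<le> c" shows "usc_reg D f y \<le> c"
  unfolding usc_reg_def by (rule INF_lower2[of r]) (use assms in \<open>auto intro: SUP_least\<close>)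

lemma usc_reg_ge: assumes "y \<in> D" shows "f y \<le> usc_reg D f y"
  unfolding usc_reg_def by (rule INF_greatest, rule SUP_upper) (use assms in auto)

lemma usc_on_usc_reg: "usc_on D (usc_reg D f)"
  unfolding usc_on_iff_ball
proof (intro ballI allI impI)
  fix x c assume "x \<in> D" "usc_reg D f x < c"
  then obtain b where b: "usc_reg D f x < b" "b < c" using dense by blast
  obtain r where r: "0 < r" "\<And>z. z \<in> D \<Longrightarrow> dist x z < r \<Longrightarrow> f z < b" using usc_reg_less[OF b(1)] by blast
  have "usc_reg D f y \<le> b" if "dist y x < r / 2" for y
  proof (rule usc_reg_le[of "r / 2"])
    fix z assume "z \<in> D" "dist y z < r / 2"
    then have "dist x z < r" using that dist_triangle[of x z y] by (simp add: dist_commute)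
    then show "f z \<le> b" using r(2) \<open>z \<in> D\<close> by (auto intro: less_imp_le)
  qed (use r in simp)
  then show "\<exists>e>0. \<forall>y\<in>D. dist y x < e \<longrightarrow> usc_reg D f y < c"
    using r(1) b(2) by (intro exI[of _ "r / 2"]) (auto intro: order_le_less_trans)
qed

lemma usc_reg_le_usc:
  assumes y: "y \<in> D" and N: "open N" "y \<in> N" and le: "\<And>z. z \<in> D \<inter> N \<Longrightarrow> f z \<le> g z" and g: "usc_on (D \<inter> N) g"
  shows "usc_reg D f y \<le> g y"
proof (rule ccontr)
  assume "\<not> ?thesis"
  then have "g y < usc_reg D f y" by simp
  then obtain c where c: "g y < c" "c < usc_reg D f y" using dense by blast
  obtain e where e: "0 < e" "\<And>z. z \<in> D \<inter> N \<Longrightarrow> dist z y < e \<Longrightarrow> g z < c"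
    using g y N c(1) unfolding usc_on_iff_ball by (metis IntI)
  obtain r where r: "0 < r" "ball y r \<subseteq> N" using N open_contains_ball by blast
  have "usc_reg D f y \<le> c"
  proof (rule usc_reg_le[of "min r e"])
    fix z assume "z \<in> D" "dist y z < min r e"
    then have "z \<in> D \<inter> N" "dist z y < e" using r(2) by (auto simp: dist_commute subset_iff)
    then show "f z \<le> c" using le e(2) by (metis less_imp_le order_trans)
  qed (use r e in simp)
  then show False using c(2) by simp
qed

text \<open>The envelope is only approached by members of the family, at points near
  \<open>x0\<close>. Adding \<open>\<eta>\<close> times the squared distance to the test function
  makes its contact strict, so a member that nearly reaches the envelope is touched at a nearby
  interior point. Closedness of \<open>F\<close> removes \<open>\<eta>\<close>.\<close>

lemma F_sub_usc_reg_SUP: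
  fixes \<V> :: "(real^'n \<Rightarrow> ereal) set"
  assumes F: "cone_subequation F" and X: "open X" "X \<subseteq> D" and sub: "\<And>v. v \<in> \<V> \<Longrightarrow> F_sub F X v"
    and fin: "\<And>x. x \<in> X \<Longrightarrow> usc_reg D (\<lambda>y. SUP v\<in>\<V>. v y) x < \<infinity>"
  shows "F_sub F X (usc_reg D (\<lambda>y. SUP v\<in>\<V>. v y))"
proof (rule F_subI)
  let ?f = "\<lambda>y. SUP v\<in>\<V>. v y"
  show "usc_on X (usc_reg D ?f)" by (rule usc_on_subset[OF usc_on_usc_reg X(2)])
  show "usc_reg D ?f x < \<infinity>" if "x \<in> X" for x by (rule fin[OF that])
  fix x0 U \<phi> g Hs
  assume *: "x0 \<in> U" "U \<subseteq> X" "C2_hess U \<phi> g Hs" "\<And>y. y \<in> U \<Longrightarrow> usc_reg D ?f y \<le> ereal (\<phi> y)"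
    "usc_reg D ?f x0 = ereal (\<phi> x0)"
  have oU: "open U" using *(3) by (simp add: C2_hess_def)
  have vle: "v y \<le> ereal (\<phi> y)" if "v \<in> \<V>" "y \<in> U" for v y
  proof -
    have "v y \<le> ?f y" by (rule SUP_upper[OF that(1)])
    also have "\<dots> \<le> usc_reg D ?f y" using that(2) *(2) X(2) by (intro usc_reg_ge) auto
    finally show ?thesis using *(4)[OF that(2)] by simp
  qed
  have near: "\<exists>z\<in>ball x0 r. Hs z + (2 * \<eta>) *\<^sub>R mat 1 \<in> F" if \<eta>: "0 < \<eta>" and r: "0 < r" "cball x0 r \<subseteq> U" for \<eta> r
  proof -
    \<comment> \<open>The member misses the modified test function by less than
      \<open>2 * \<sigma>\<close> at \<open>z1\<close>, which is less than the gap
      \<open>\<eta> * r\<^sup>2\<close> on the sphere; the maximum is therefore interior.\<close>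
    define \<sigma> where "\<sigma> = \<eta> * r\<^sup>2 / 3"
    have \<sigma>: "0 < \<sigma>" "2 * \<sigma> < \<eta> * r\<^sup>2" using \<eta> r by (auto simp: \<sigma>_def)
    define \<phi>' where "\<phi>' y = \<phi> y + (0 + \<eta> * (norm (y - x0))\<^sup>2)" for y
    have C2': "C2_hess U \<phi>' (\<lambda>y. g y + (2 * \<eta>) *\<^sub>R (y - x0)) (\<lambda>y. Hs y + (2 * \<eta>) *\<^sub>R mat 1)"
      unfolding \<phi>'_def by (intro C2_hess_add *(3) C2_hess_norm_square oU)
    have cont': "continuous_on U \<phi>'" by (rule C2_hess_continuous[OF C2'])
    have "isCont \<phi>' x0" using cont' oU *(1) by (simp add: continuous_on_eq_continuous_at)
    then obtain q where q: "0 < q" "\<And>y. dist y x0 < q \<Longrightarrow> dist (\<phi>' y) (\<phi>' x0) < \<sigma>"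
      using \<sigma>(1) unfolding continuous_at_eps_delta by blast
    have "\<exists>z\<in>D. dist x0 z < min q r \<and> ereal (\<phi> x0 - \<sigma>) < ?f z"
    proof (rule ccontr)
      assume "\<not> ?thesis"
      then have "usc_reg D ?f x0 \<le> ereal (\<phi> x0 - \<sigma>)"
        using q r by (intro usc_reg_le[of "min q r"]) (auto simp: not_less)
      then show False using *(5) \<sigma>(1) by simp
    qed
    then obtain z1 where z1: "dist x0 z1 < min q r" "ereal (\<phi> x0 - \<sigma>) < ?f z1" by blast
    then obtain v where v: "v \<in> \<V>" "ereal (\<phi> x0 - \<sigma>) < v z1" by (auto simp: less_SUP_iff)
    have cU: "cball x0 r \<subseteq> X" using r *(2) by blast
    have vX: "usc_on X v" "\<And>y. y \<in> X \<Longrightarrow> v y < \<infinity>" using sub[OF v(1)] by (auto simp: F_sub_def)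
    let ?d = "\<lambda>y. v y + ereal (- \<phi>' y)"
    have "usc_on (cball x0 r) ?d"
      by (intro usc_on_add usc_on_subset[OF vX(1) cU] usc_on_continuous continuous_intros continuous_on_subset[OF cont' r(2)])
         (use vX cU in auto)
    then obtain z where z: "z \<in> cball x0 r" "\<And>y. y \<in> cball x0 r \<Longrightarrow> ?d y \<le> ?d z"
      using usc_attains_max[of "cball x0 r" ?d] r(1) by auto
    have z1c: "z1 \<in> cball x0 r" using z1(1) by simp
    have "\<phi>' z1 < \<phi> x0 + \<sigma>" using q(2)[of z1] z1(1) by (auto simp: dist_commute dist_real_def \<phi>'_def)
    then have "ereal (- 2 * \<sigma>) < ?d z1" using v(2) by (cases "v z1") auto
    then have dz: "ereal (- 2 * \<sigma>) < ?d z" using z(2)[OF z1c] by (rule order_less_le_trans)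
    have zU: "z \<in> U" using z(1) r(2) by blast
    obtain m where m: "v z = ereal (\<phi>' z + m)" "- 2 * \<sigma> < m"
      using dz vle[OF v(1) zU] by (cases "v z") (auto intro: that[of "real_of_ereal (v z) - \<phi>' z"])
    have "m \<le> - \<eta> * (norm (z - x0))\<^sup>2" using vle[OF v(1) zU] m(1) by (simp add: \<phi>'_def)
    then have "\<eta> * (norm (z - x0))\<^sup>2 < \<eta> * r\<^sup>2" using m(2) \<sigma>(2) by simp
    then have "(norm (z - x0))\<^sup>2 < r\<^sup>2" using \<eta> by simp
    then have zb: "z \<in> ball x0 r" using r(1) power_less_imp_less_base[of "norm (z - x0)" 2 r] by (simp add: dist_norm norm_minus_commute)
    have bU: "ball x0 r \<subseteq> U" using r(2) by auto
    have c2: "C2_hess (ball x0 r) (\<lambda>y. \<phi>' y + m) (\<lambda>y. (g y + (2 * \<eta>) *\<^sub>R (y - x0)) + 0) (\<lambda>y. (Hs y + (2 * \<eta>) *\<^sub>R mat 1) + 0)"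
      by (intro C2_hess_add[OF C2_hess_subset[OF C2' open_ball bU]] C2_hess_const) auto
    have "(Hs z + (2 * \<eta>) *\<^sub>R mat 1) + 0 \<in> F"
    proof (rule F_sub_test[OF sub[OF v(1)] zb _ c2])
      show "ball x0 r \<subseteq> X" using bU *(2) by blast
      fix y assume "y \<in> ball x0 r"
      then have "?d y \<le> ereal m" using z(2)[of y] m(1) by simp
      then show "v y \<le> ereal (\<phi>' y + m)" by (cases "v y") auto
    qed (use m in auto)
    then show ?thesis using zb by auto
  qed
  show "Hs x0 \<in> F"
  proof (rule in_cone_if_perturbed[OF F])
    fix e :: real assume e: "0 < e"
    show "Hs x0 + e *\<^sub>R mat 1 \<in> F"
    proof (rule ccontr)
      assume no: "Hs x0 + e *\<^sub>R mat 1 \<notin> F"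
      have "open (- F)" using F by (auto simp: cone_subequation_def)
      then obtain s where s: "0 < s" "ball (Hs x0 + e *\<^sub>R mat 1) s \<subseteq> - F"
        using no open_contains_ball by (metis ComplI)
      have "isCont Hs x0" using *(1,3) oU by (simp add: C2_hess_def continuous_on_eq_continuous_at)
      then obtain q where q: "0 < q" "\<And>y. dist y x0 < q \<Longrightarrow> dist (Hs y) (Hs x0) < s"
        using s(1) unfolding continuous_at_eps_delta by blast
      obtain r0 where r0: "0 < r0" "cball x0 r0 \<subseteq> U" using oU *(1) open_contains_cball by blast
      define r where "r = min q r0"
      have r: "0 < r" "cball x0 r \<subseteq> U" "r \<le> q" using q r0 by (auto simp: r_def)
      obtain z where z: "z \<in> ball x0 r" "Hs z + e *\<^sub>R mat 1 \<in> F"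
        using near[of "e / 2" r] e r by auto
      have "dist (Hs x0 + e *\<^sub>R mat 1) (Hs z + e *\<^sub>R mat 1) < s"
        using q(2)[of z] z(1) r(3) by (simp add: dist_commute dist_norm)
      then have "Hs z + e *\<^sub>R mat 1 \<in> - F" by (intro subsetD[OF s(2)]) (simp only: mem_ball)
      then show False using z(2) by simp
    qed
  qed
qed

subsection \<open>The Perron solution\<close>

lemma continuous_on_minus_ereal:
  "continuous_on V f \<Longrightarrow> continuous_on V (\<lambda>y. - f y :: ereal)"
  by (simp add: continuous_on_def)

locale singular_dirichlet =
  fixes F :: "(real^'n^'n) set" and \<Omega> :: "(real^'n) set"
    and \<phi> :: "real^'n \<Rightarrow> real" and x :: "nat \<Rightarrow> real^'n" and k :: nat
    and h :: "nat \<Rightarrow> real^'n \<Rightarrow> ereal" and U :: "nat \<Rightarrow> (real^'n) set"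
    and \<psi> :: "real^'n \<Rightarrow> ereal"
  assumes cone: "cone_subequation F"
    and negP: "\<forall>e::real^'n. norm e = 1 \<longrightarrow> - proj_line e \<notin> F"
    and dom: "strictly_F_convex_domain F \<Omega>"
    and pts: "\<forall>j<k. x j \<in> \<Omega>"
    and phi_cont: "continuous_on (frontier \<Omega>) \<phi>"
    and polar: "\<forall>j<k. polar_singular F (h j) (U j) (x j)"
    and psi_cont: "continuous_on (closure \<Omega>) \<psi>"
    and psi_sub: "F_sub F \<Omega> \<psi>"
    and psi_lt: "\<forall>y\<in>closure \<Omega>. \<psi> y < \<infinity>"
    and psi_fin: "\<forall>y\<in>closure \<Omega> - x ` {..<k}. \<psi> y \<noteq> -\<infinity>"
    and psi_near: "\<forall>j<k. \<exists>C::real. \<forall>\<^sub>F y in at (x j).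
                      h j y - ereal C \<le> \<psi> y \<and> \<psi> y \<le> h j y + ereal C"
begin

abbreviation S :: "(real^'n) set" where "S \<equiv> x ` {..<k}"
abbreviation D :: "(real^'n) set" where "D \<equiv> closure \<Omega> - S"
abbreviation P :: "(real^'n \<Rightarrow> ereal) set" where "P \<equiv> perron_family F \<Omega> \<phi> x k h"

section \<open>The Perron family and comparison with its members\<close>

lemma \<Omega>: "open \<Omega>" "bounded \<Omega>" "\<Omega> \<noteq> {}"
  using dom by (auto simp: strictly_F_convex_domain_def)

lemma compact_closure: "compact (closure \<Omega>)" and compact_frontier: "compact (frontier \<Omega>)"
  using \<Omega> by (auto simp: compact_frontier_bounded)

lemma S: "finite S" "S \<subseteq> \<Omega>" "closed S"
  using pts by (auto intro: finite_imp_closed)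

lemma frontier_D: "frontier \<Omega> \<subseteq> D"
  using S \<Omega>(1) by (auto simp: frontier_def interior_open)

lemma D_cases: "y \<in> D \<Longrightarrow> y \<in> \<Omega> - S \<or> y \<in> frontier \<Omega>"
  using \<Omega>(1) by (auto simp: frontier_def interior_open)

lemma dual_cone: "cone_subequation (dual F)"
  by (rule dual_cone_subequation[OF cone])

text \<open>A bounded nonempty open set has a frontier point, and strict convexity there exhibits an
  element of \<open>F\<close>.\<close>

lemma zeros: "0 \<in> F" "0 \<in> dual F"
proof -
  have "\<Omega> \<noteq> UNIV" using \<Omega>(2) not_bounded_UNIV by blast
  then obtain x0 where "x0 \<in> frontier \<Omega>" using \<Omega>(3) frontier_eq_empty by blast
  then obtain A where "A \<in> IntF F" using dom unfolding strictly_F_convex_domain_def by blast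
  then show "0 \<in> F" using zero_in_cone[OF cone] IntF_subset by blast
  show "0 \<in> dual F" by (rule zero_in_dual[OF cone negP])
qed

lemma h_props:
  assumes "j < k"
  shows "open (U j)" "x j \<in> U j" "continuous_on (U j) (h j)" "F_harm F (U j - {x j}) (h j)"
    "(h j \<longlongrightarrow> -\<infinity>) (at (x j))" "\<And>y. y \<in> U j - {x j} \<Longrightarrow> \<bar>h j y\<bar> \<noteq> \<infinity>"
proof -
  have p: "polar_singular F (h j) (U j) (x j)" using polar assms by blast
  then show *: "open (U j)" "x j \<in> U j" "continuous_on (U j) (h j)" "F_harm F (U j - {x j}) (h j)"
    by (auto simp: polar_singular_def)
  then show "\<And>y. y \<in> U j - {x j} \<Longrightarrow> \<bar>h j y\<bar> \<noteq> \<infinity>" by (auto simp: F_harm_def)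
  have "(h j \<longlongrightarrow> h j (x j)) (at (x j))"
    using *(1-3) by (simp add: continuous_on_eq_continuous_at continuous_at)
  then show "(h j \<longlongrightarrow> -\<infinity>) (at (x j))" using p by (simp add: polar_singular_def)
qed

lemma phi_bounded: "\<exists>M>0. \<forall>y\<in>frontier \<Omega>. \<bar>\<phi> y\<bar> \<le> M"
proof -
  have "bounded (\<phi> ` frontier \<Omega>)"
    by (intro compact_imp_bounded compact_continuous_image phi_cont compact_frontier)
  then show ?thesis by (auto simp: bounded_pos)
qed

lemma PD:
  assumes "v \<in> P"
  shows "\<And>y. y \<in> closure \<Omega> \<Longrightarrow> v y < \<infinity>" "usc_on (closure \<Omega>) v" "F_sub F \<Omega> v"
    "\<And>y. y \<in> frontier \<Omega> \<Longrightarrow> v y \<le> ereal (\<phi> y)"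
    "\<And>j. j < k \<Longrightarrow> \<exists>C. \<forall>\<^sub>F y in at (x j). v y \<le> h j y + ereal C"
  using assms unfolding perron_family_def by blast+

lemma PI:
  assumes "usc_on (closure \<Omega>) v" "F_sub F \<Omega> v" "\<And>y. y \<in> frontier \<Omega> \<Longrightarrow> v y \<le> ereal (\<phi> y)"
    "\<And>j. j < k \<Longrightarrow> \<exists>C. \<forall>\<^sub>F y in at (x j). v y \<le> h j y + ereal C"
  shows "v \<in> P"
proof -
  have "v y < \<infinity>" if "y \<in> closure \<Omega>" for y
  proof (cases "y \<in> \<Omega>")
    case True then show ?thesis using assms(2) by (simp add: F_sub_def)
  next
    case False
    then have "y \<in> frontier \<Omega>" using that \<Omega>(1) by (auto simp: frontier_def interior_open)
    then show ?thesis using assms(3) by (metis PInfty_neq_ereal(1) ereal_infty_less_eq(1) less_ereal.simps(4) order_le_less_trans)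
  qed
  then show ?thesis using assms by (simp add: perron_family_def)
qed

text \<open>Domination by \<open>h j\<close> forces the limit minus infinity at \<open>x j\<close>,
  which gives semicontinuity of the extension, and no test function touches at that value.
  Membership can thus be checked on the punctured domain.\<close>

lemma P_extend:
  assumes usc: "usc_on D u" and sub: "F_sub F (\<Omega> - S) u"
    and bd: "\<And>y. y \<in> frontier \<Omega> \<Longrightarrow> u y \<le> ereal (\<phi> y)"
    and near: "\<And>j. j < k \<Longrightarrow> \<exists>C. \<forall>\<^sub>F y in at (x j). u y \<le> h j y + ereal C"
  shows "(\<lambda>y. if y \<in> S then -\<infinity> else u y) \<in> P"
proof (rule PI)
  let ?v = "\<lambda>y. if y \<in> S then -\<infinity> else u y"
  have small: "\<forall>\<^sub>F y in at (x j). ?v y < c" if j: "j < k" and c: "-\<infinity> < c" for j c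
  proof -
    obtain C where "\<forall>\<^sub>F y in at (x j). u y \<le> h j y + ereal C" using near[OF j] by blast
    moreover have "\<forall>\<^sub>F y in at (x j). h j y < c - ereal C"
      using h_props(5)[OF j] by (rule order_tendstoD) (use c in \<open>cases c; auto\<close>)
    ultimately show ?thesis
    proof eventually_elim
      case (elim y)
      have "h j y + ereal C < c" using elim(2) by (cases "h j y"; cases c) auto
      then show ?case using elim(1) c by auto
    qed
  qed
  show "usc_on (closure \<Omega>) ?v"
    unfolding usc_on_iff_ball
  proof (intro ballI allI impI)
    fix y c assume y: "y \<in> closure \<Omega>" "?v y < c"
    then have c: "-\<infinity> < c" by (cases c) (auto split: if_splits)
    show "\<exists>e>0. \<forall>z\<in>closure \<Omega>. dist z y < e \<longrightarrow> ?v z < c"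
    proof (cases "y \<in> S")
      case True
      then obtain j where j: "j < k" "y = x j" by auto
      from small[OF j(1) c] obtain e where "0 < e" "\<And>z. z \<noteq> x j \<Longrightarrow> dist z (x j) < e \<Longrightarrow> ?v z < c"
        unfolding eventually_at by auto
      then show ?thesis using y(2) j(2) by (metis (no_types, lifting))
    next
      case False
      then have "y \<in> D" "u y < c" using y by auto
      then obtain e where e: "0 < e" "\<And>z. z \<in> D \<Longrightarrow> dist z y < e \<Longrightarrow> u z < c"
        using usc unfolding usc_on_iff_ball by metis
      then show ?thesis using c by (intro exI[of _ e]) auto
    qed
  qed
  show "F_sub F \<Omega> ?v"
  proof (rule F_subI)
    show "?v y < \<infinity>" if "y \<in> \<Omega>" for y using sub that by (auto simp: F_sub_def)
    show "usc_on \<Omega> ?v" by (rule usc_on_subset[OF \<open>usc_on (closure \<Omega>) ?v\<close> closure_subset])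
    fix x0 V \<xi> g Hs
    assume *: "x0 \<in> V" "V \<subseteq> \<Omega>" "C2_hess V \<xi> g Hs" "\<And>y. y \<in> V \<Longrightarrow> ?v y \<le> ereal (\<xi> y)" "?v x0 = ereal (\<xi> x0)"
    have "x0 \<notin> S" using *(5) by auto
    have "open V" using *(3) by (simp add: C2_hess_def)
    then have c2: "C2_hess (V - S) \<xi> g Hs" using S(3) by (intro C2_hess_subset[OF *(3)]) auto
    show "Hs x0 \<in> F"
    proof (rule F_sub_test[OF sub _ _ c2])
      show "u y \<le> ereal (\<xi> y)" if "y \<in> V - S" for y using *(4)[of y] that by simp
    qed (use * \<open>x0 \<notin> S\<close> in auto)
  qed
  show "?v y \<le> ereal (\<phi> y)" if "y \<in> frontier \<Omega>" for y using bd[OF that] by simp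
  show "\<exists>C. \<forall>\<^sub>F y in at (x j). ?v y \<le> h j y + ereal C" if j: "j < k" for j
  proof -
    obtain C where "\<forall>\<^sub>F y in at (x j). u y \<le> h j y + ereal C" using near[OF j] by blast
    then have "\<forall>\<^sub>F y in at (x j). ?v y \<le> h j y + ereal C" by eventually_elim auto
    then show ?thesis by blast
  qed
qed

lemma P_upper_bound:
  assumes M: "\<And>y. y \<in> frontier \<Omega> \<Longrightarrow> \<phi> y \<le> M" and v: "v \<in> P" and y: "y \<in> closure \<Omega>"
  shows "v y \<le> ereal M"
proof (cases "y \<in> \<Omega>")
  case True
  have "v y + ereal (- M) \<le> 0"
  proof (rule comparison[OF cone zeros \<Omega>(1,2) PD(2,3)[OF v] PD(1)[OF v] _ _ _ _ True])
    show "usc_on (closure \<Omega>) (\<lambda>y. ereal (- M))" by (intro usc_on_continuous continuous_intros)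
    show "F_sub (dual F) \<Omega> (\<lambda>y. ereal (- M))" by (rule F_sub_const[OF dual_cone zeros(2) \<Omega>(1)])
    show "v y + ereal (- M) \<le> 0" if "y \<in> frontier \<Omega>" for y
      using PD(4)[OF v that] M[OF that] by (cases "v y") auto
  qed auto
  then show ?thesis by (cases "v y") auto
next
  case False
  then have f: "y \<in> frontier \<Omega>" using y \<Omega>(1) by (auto simp: frontier_def interior_open)
  have "ereal (\<phi> y) \<le> ereal M" using M[OF f] by simp
  then show ?thesis using PD(4)[OF v f] by (rule order_trans[rotated])
qed

lemma P_bounded: "\<exists>M. \<forall>v\<in>P. \<forall>y\<in>closure \<Omega>. v y \<le> ereal M"
proof -
  obtain M where "\<forall>y\<in>frontier \<Omega>. \<bar>\<phi> y\<bar> \<le> M" using phi_bounded by blast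
  then have "\<And>y. y \<in> frontier \<Omega> \<Longrightarrow> \<phi> y \<le> M" by (auto simp: abs_le_iff)
  then show ?thesis using P_upper_bound by blast
qed

lemma domain_comparison:
  assumes v: "v \<in> P"
    and w: "usc_on D w" "F_sub (dual F) (\<Omega> - S) w" "\<And>y. y \<in> D \<Longrightarrow> w y < \<infinity>"
    and bd: "\<And>y. y \<in> frontier \<Omega> \<Longrightarrow> v y + w y \<le> 0"
    and near: "\<And>j. j < k \<Longrightarrow> \<exists>C. \<forall>\<^sub>F y in at (x j). w y \<le> - h j y + ereal C"
    and y: "y \<in> D"
  shows "v y + w y \<le> 0"
proof (cases "y \<in> frontier \<Omega>")
  case False
  then have y': "y \<in> \<Omega> - S" using D_cases y by blast
  obtain M where M: "\<forall>v\<in>P. \<forall>y\<in>closure \<Omega>. v y \<le> ereal M" using P_bounded by blast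
  show ?thesis
  proof (rule punctured_comparison[OF cone zeros \<Omega>(1,2) S(1,2) _ _ _ w bd _ y', where M=M])
    show "usc_on D v" "F_sub F (\<Omega> - S) v"
      using usc_on_subset[OF PD(2)[OF v]] F_sub_subset[OF PD(3)[OF v]] by auto
    show "v y \<le> ereal M" if "y \<in> D" for y using M v that by blast
    fix s assume "s \<in> S"
    then obtain j where j: "j < k" "s = x j" by auto
    obtain C1 where C1: "\<forall>\<^sub>F y in at s. v y \<le> h j y + ereal C1" using PD(5)[OF v j(1)] j(2) by blast
    obtain C2 where C2: "\<forall>\<^sub>F y in at s. w y \<le> - h j y + ereal C2" using near[OF j(1)] j(2) by blast
    have "\<forall>\<^sub>F y in at s. v y \<le> h j y + ereal (max C1 C2) \<and> w y \<le> - h j y + ereal (max C1 C2)"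
      using C1 C2
    proof eventually_elim
      case (elim y)
      have "h j y + ereal C1 \<le> h j y + ereal (max C1 C2)" "- h j y + ereal C2 \<le> - h j y + ereal (max C1 C2)"
        by (intro add_left_mono; simp)+
      then show ?case using elim by (auto intro: order_trans)
    qed
    then show "\<exists>h C. (h \<longlongrightarrow> -\<infinity>) (at s) \<and> (\<forall>\<^sub>F y in at s. v y \<le> h y + ereal C \<and> w y \<le> - h y + ereal C)"
      using h_props(5)[OF j(1)] j(2) by blast
  qed
qed (rule bd)

lemma le_solution:
  assumes H: "sing_dirichlet_sol F \<Omega> \<phi> x k h H" and v: "v \<in> P" and y: "y \<in> D"
  shows "v y \<le> ereal (H y)"
proof -
  have H': "continuous_on D H" "F_harm F (\<Omega> - S) (\<lambda>y. ereal (H y))" "\<And>y. y \<in> frontier \<Omega> \<Longrightarrow> H y = \<phi> y"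
    using H by (auto simp: sing_dirichlet_sol_def)
  obtain C where C: "\<And>j. j < k \<Longrightarrow> \<forall>\<^sub>F y in at (x j). h j y - ereal C \<le> ereal (H y) \<and> ereal (H y) \<le> h j y + ereal C"
    using H unfolding sing_dirichlet_sol_def by blast
  have "v y + ereal (- H y) \<le> 0"
  proof (rule domain_comparison[OF v _ _ _ _ _ y])
    show "usc_on D (\<lambda>y. ereal (- H y))" by (intro usc_on_continuous continuous_intros H')
    show "F_sub (dual F) (\<Omega> - S) (\<lambda>y. ereal (- H y))" using H'(2) by (simp add: F_harm_def)
    show "v y + ereal (- H y) \<le> 0" if "y \<in> frontier \<Omega>" for y
      using PD(4)[OF v that] H'(3)[OF that] by (cases "v y") auto
    fix j assume "j < k"
    from C[OF this] have "\<forall>\<^sub>F y in at (x j). ereal (- H y) \<le> - h j y + ereal C"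
    proof eventually_elim
      case (elim y) then show ?case by (cases "h j y") auto
    qed
    then show "\<exists>C. \<forall>\<^sub>F y in at (x j). ereal (- H y) \<le> - h j y + ereal C" by blast
  qed auto
  then show ?thesis by (cases "v y") auto
qed

text \<open>A solution, set to minus infinity at the singular points, is itself a member of the
  family, and \<open>le_solution\<close> makes it the largest. As \<open>H\<close> is arbitrary,
  this contains uniqueness.\<close>

lemma solution_eq_SUP:
  assumes H: "sing_dirichlet_sol F \<Omega> \<phi> x k h H" and y: "y \<in> D"
  shows "ereal (H y) = (SUP v\<in>P. v y)"
proof (rule antisym)
  show "(SUP v\<in>P. v y) \<le> ereal (H y)" using le_solution[OF H _ y] by (intro SUP_least)
  have H': "continuous_on D H" "F_harm F (\<Omega> - S) (\<lambda>y. ereal (H y))" "\<And>y. y \<in> frontier \<Omega> \<Longrightarrow> H y = \<phi> y"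
    using H by (auto simp: sing_dirichlet_sol_def)
  have "(\<lambda>y. if y \<in> S then -\<infinity> else ereal (H y)) \<in> P"
  proof (rule P_extend)
    show "usc_on D (\<lambda>y. ereal (H y))" by (intro usc_on_continuous continuous_intros H')
    show "F_sub F (\<Omega> - S) (\<lambda>y. ereal (H y))" using H'(2) by (simp add: F_harm_def)
    show "\<exists>C. \<forall>\<^sub>F y in at (x j). ereal (H y) \<le> h j y + ereal C" if "j < k" for j
      using H that unfolding sing_dirichlet_sol_def by (blast intro: eventually_mono)
  qed (use H' in auto)
  from SUP_upper[OF this, of "\<lambda>v. v y"] show "ereal (H y) \<le> (SUP v\<in>P. v y)" using y by simp
qed

text \<open>A vertical translate of \<open>\<psi>\<close> that belongs to the family. It is finite
  off the singular points and bounds the Perron function from below.\<close>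

definition \<psi>C :: "real^'n \<Rightarrow> ereal" where
  "\<psi>C = (SOME p. \<exists>C. p = (\<lambda>y. \<psi> y + ereal C) \<and> p \<in> P)"

lemma psi_shifted: "\<exists>C. \<psi>C = (\<lambda>y. \<psi> y + ereal C)" "\<psi>C \<in> P"
proof -
  obtain M where M: "M > 0" "\<forall>y\<in>frontier \<Omega>. \<bar>\<phi> y\<bar> \<le> M" using phi_bounded by blast
  have usc: "usc_on (closure \<Omega>) \<psi>" by (rule usc_on_continuous[OF psi_cont])
  obtain N where N: "\<forall>y\<in>closure \<Omega>. \<psi> y \<le> ereal N" using usc_real_bound[OF compact_closure usc] psi_lt by blast
  have inv: "t + ereal c < s \<longleftrightarrow> t < s - ereal c" for t s :: ereal and c
    by (cases t; cases s) auto
  \<comment> \<open>Since \<open>\<psi> \<le> N\<close> and \<open>\<phi> \<ge> - M\<close>, this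
    translate is below the boundary data.\<close>
  have "(\<lambda>y. \<psi> y + ereal (- N - M)) \<in> P"
  proof (rule PI)
    show "usc_on (closure \<Omega>) (\<lambda>y. \<psi> y + ereal (- N - M))" using usc unfolding usc_on_def inv by blast
    show "F_sub F \<Omega> (\<lambda>y. \<psi> y + ereal (- N - M))"
      using F_sub_scale_add[OF cone psi_sub, of 1 "- N - M"] by (simp add: one_ereal_def[symmetric])
    show "\<psi> y + ereal (- N - M) \<le> ereal (\<phi> y)" if "y \<in> frontier \<Omega>" for y
    proof -
      have "\<psi> y \<le> ereal N" "- M \<le> \<phi> y" using N M(2) that frontier_D by (auto simp: abs_le_iff)
      then show ?thesis by (cases "\<psi> y") auto
    qed
    fix j assume "j < k"
    then obtain C where "\<forall>\<^sub>F y in at (x j). h j y - ereal C \<le> \<psi> y \<and> \<psi> y \<le> h j y + ereal C" using psi_near by blast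
    then have "\<forall>\<^sub>F y in at (x j). \<psi> y + ereal (- N - M) \<le> h j y + ereal (C - N - M)"
    proof eventually_elim
      case (elim y) then show ?case by (cases "h j y"; cases "\<psi> y") auto
    qed
    then show "\<exists>C. \<forall>\<^sub>F y in at (x j). \<psi> y + ereal (- N - M) \<le> h j y + ereal C" by blast
  qed
  then have "\<exists>p. \<exists>C. p = (\<lambda>y. \<psi> y + ereal C) \<and> p \<in> P" by blast
  from someI_ex[OF this] show "\<exists>C. \<psi>C = (\<lambda>y. \<psi> y + ereal C)" "\<psi>C \<in> P" by (auto simp: \<psi>C_def)
qed

lemma psiC_real: "y \<in> D \<Longrightarrow> \<bar>\<psi>C y\<bar> \<noteq> \<infinity>"
proof -
  assume y: "y \<in> D"
  obtain C where "\<psi>C = (\<lambda>y. \<psi> y + ereal C)" using psi_shifted(1) by blast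
  moreover have "\<psi> y \<noteq> \<infinity>" "\<psi> y \<noteq> -\<infinity>" using psi_lt psi_fin y by auto
  ultimately show ?thesis by (cases "\<psi> y") auto
qed

lemma usc_minus_psiC: "usc_on D (\<lambda>y. - \<psi>C y)"
proof -
  obtain C where C: "\<psi>C = (\<lambda>y. \<psi> y + ereal C)" using psi_shifted(1) by blast
  have cont: "continuous_on D (\<lambda>y. - \<psi> y)"
    by (intro continuous_on_minus_ereal continuous_on_subset[OF psi_cont]) auto
  have eq: "- \<psi>C y = - \<psi> y + ereal (- C)" for y by (cases "\<psi> y") (auto simp: C)
  have inv: "t + ereal c < s \<longleftrightarrow> t < s - ereal c" for t s :: ereal and c
    by (cases t; cases s) auto
  show ?thesis using usc_on_continuous[OF cont] unfolding usc_on_def eq inv by blast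
qed

lemma psiC_near: "j < k \<Longrightarrow> \<exists>C. \<forall>\<^sub>F y in at (x j). h j y + ereal C \<le> \<psi>C y"
proof -
  assume j: "j < k"
  obtain C where C: "\<psi>C = (\<lambda>y. \<psi> y + ereal C)" using psi_shifted(1) by blast
  obtain C' where "\<forall>\<^sub>F y in at (x j). h j y - ereal C' \<le> \<psi> y \<and> \<psi> y \<le> h j y + ereal C'" using psi_near j by blast
  then have "\<forall>\<^sub>F y in at (x j). h j y + ereal (C - C') \<le> \<psi>C y"
  proof eventually_elim
    case (elim y) then show ?case by (cases "h j y"; cases "\<psi> y") (auto simp: C)
  qed
  then show ?thesis by blast
qed

text \<open>Comparison on a punctured ball with \<open>h\<close> itself makes the upper bound uniform over the family.\<close>

lemma P_uniform_near:
  assumes j: "j < k"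
  shows "\<exists>r C. 0 < r \<and> ball (x j) r \<subseteq> U j \<and> ball (x j) r \<subseteq> \<Omega> \<and> ball (x j) r \<inter> S = {x j} \<and>
    (\<forall>v\<in>P. \<forall>y\<in>ball (x j) r - {x j}. v y \<le> h j y + ereal C)"
proof -
  note hp = h_props[OF j]
  have "open (U j \<inter> (\<Omega> - (S - {x j})))" using hp(1) \<Omega>(1) S(1) by (intro open_Int open_Diff finite_imp_closed) auto
  moreover have "x j \<in> U j \<inter> (\<Omega> - (S - {x j}))" using hp(2) pts j by auto
  ultimately obtain r where r: "0 < r" "cball (x j) r \<subseteq> U j \<inter> (\<Omega> - (S - {x j}))"
    using open_contains_cball by blast
  let ?B = "ball (x j) r"
  have cU: "cball (x j) r \<subseteq> U j" and c\<Omega>: "cball (x j) r \<subseteq> \<Omega>" using r(2) by blast+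
  have cK: "cball (x j) r \<subseteq> closure \<Omega>" using c\<Omega> closure_subset by blast
  have BU: "?B \<subseteq> U j" and B\<Omega>: "?B \<subseteq> \<Omega>" using cU c\<Omega> ball_subset_cball by blast+
  have cB: "closure ?B = cball (x j) r" "frontier ?B = sphere (x j) r" using r(1) by simp_all
  obtain M where M: "\<forall>v\<in>P. \<forall>y\<in>closure \<Omega>. v y \<le> ereal M" using P_bounded by blast
  have hc: "continuous_on (cball (x j) r) (\<lambda>y. - h j y)"
    using r(2) by (intro continuous_on_minus_ereal continuous_on_subset[OF hp(3)]) auto
  have "usc_on (sphere (x j) r) (\<lambda>y. - h j y)"
    by (intro usc_on_continuous continuous_on_subset[OF hc]) auto
  moreover have fin: "\<bar>h j y\<bar> \<noteq> \<infinity>" if "y \<in> cball (x j) r - {x j}" for y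
  proof -
    have "y \<in> U j - {x j}" using that r(2) by blast
    then show ?thesis by (rule hp(6))
  qed
  ultimately obtain N where N: "\<forall>y\<in>sphere (x j) r. - h j y \<le> ereal N"
    using usc_real_bound[of "sphere (x j) r" "\<lambda>y. - h j y"] r(1) by (force simp: abs_eq_infinity_cases)
  have "v y \<le> h j y + ereal (M + N)" if v: "v \<in> P" and y: "y \<in> ?B - {x j}" for v y
  proof -
    \<comment> \<open>\<open>M\<close> bounds the whole family and \<open>N\<close> bounds
      \<open>- h j\<close> on the sphere, so the constant is independent of \<open>v\<close>. The
      constant of \<open>v\<close> itself enters only the hypothesis at the singular point.\<close>
    let ?w = "\<lambda>y. - h j y + ereal (- (M + N))"
    have inv: "t + ereal c < s \<longleftrightarrow> t < s - ereal c" for t s :: ereal and c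
      by (cases t; cases s) auto
    have "v y + ?w y \<le> 0"
    proof (rule punctured_comparison[OF cone zeros, where X="?B" and S="{x j}" and M=M])
      show "usc_on (closure ?B - {x j}) v"
        by (rule usc_on_subset[OF PD(2)[OF v]]) (use cB cK in auto)
      show "F_sub F (?B - {x j}) v" by (rule F_sub_subset[OF PD(3)[OF v]]) (use B\<Omega> in blast)
      show "v z \<le> ereal M" if "z \<in> closure ?B - {x j}" for z
      proof -
        have "z \<in> closure \<Omega>" using that cB cK by auto
        then show ?thesis using M v by blast
      qed
      show "usc_on (closure ?B - {x j}) ?w"
        using usc_on_subset[OF usc_on_continuous[OF hc], of "cball (x j) r - {x j}"] unfolding cB usc_on_def inv by blast
      have "F_sub (dual F) (?B - {x j}) (\<lambda>y. - h j y)"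
        by (rule F_sub_subset[where X="U j - {x j}"]) (use hp(4) BU in \<open>auto simp: F_harm_def\<close>)
      from F_sub_scale_add[OF dual_cone this, of 1 "- (M + N)"]
      show "F_sub (dual F) (?B - {x j}) ?w" by (simp add: one_ereal_def[symmetric])
      show "?w z < \<infinity>" if "z \<in> closure ?B - {x j}" for z
        using fin[of z] that unfolding cB by (cases "h j z") auto
      show "v z + ?w z \<le> 0" if "z \<in> frontier ?B" for z
      proof -
        have "z \<in> sphere (x j) r" using that unfolding cB .
        moreover from this have "z \<in> closure \<Omega>" using cK by auto
        ultimately have "v z \<le> ereal M" "- h j z \<le> ereal N" using M v N by blast+
        then show ?thesis by (cases "v z"; cases "h j z") auto
      qed
      fix s assume s: "s \<in> {x j}"
      obtain C where "\<forall>\<^sub>F y in at s. v y \<le> h j y + ereal C" using PD(5)[OF v j] s by blast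
      then have "\<forall>\<^sub>F y in at s. v y \<le> h j y + ereal (max C (- (M + N))) \<and> ?w y \<le> - h j y + ereal (max C (- (M + N)))"
      proof eventually_elim
        case (elim y)
        have "h j y + ereal C \<le> h j y + ereal (max C (- (M + N)))"
          "- h j y + ereal (- (M + N)) \<le> - h j y + ereal (max C (- (M + N)))"
          by (intro add_left_mono; simp)+
        then show ?case using elim by (auto intro: order_trans)
      qed
      then show "\<exists>h C. (h \<longlongrightarrow> -\<infinity>) (at s) \<and> (\<forall>\<^sub>F y in at s. v y \<le> h y + ereal C \<and> ?w y \<le> - h y + ereal C)"
        using hp(5) s by blast
    qed (use y r in auto)
    then show ?thesis using fin[of y] y by (cases "v y"; cases "h j y") auto
  qed
  moreover have "?B \<inter> S = {x j}" using r j ball_subset_cball[of "x j" r] by force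
  ultimately show ?thesis using r(1) BU B\<Omega> by - (rule exI[of _ r], rule exI[of _ "M + N"], blast)
qed

section \<open>Boundary barriers\<close>

lemma boundary_data:
  assumes "x0 \<in> frontier \<Omega>"
  obtains V \<rho> g Hs where "x0 \<in> V" "C2_hess V \<rho> g Hs" "\<Omega> \<inter> V = {y\<in>V. \<rho> y < 0}" "g x0 \<noteq> 0"
    "\<exists>t0. \<forall>t\<ge>t0. Hs x0 + t *\<^sub>R proj_line (g x0 /\<^sub>R norm (g x0)) \<in> IntF F"
  using assms dom unfolding strictly_F_convex_domain_def by blast

lemma barriers:
  assumes x0: "x0 \<in> frontier \<Omega>" and G: "G = F \<or> G = dual F"
  shows "\<exists>r>0. \<exists>\<beta> g' H' \<delta>. 0 < \<delta> \<and> C2_hess (ball x0 r) \<beta> g' H' \<and> (\<forall>y\<in>ball x0 r. H' y \<in> IntF G) \<and> \<beta> x0 = 0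
     \<and> (\<forall>y\<in>closure \<Omega> \<inter> ball x0 r. \<beta> y \<le> - \<delta> * (norm (y - x0))\<^sup>2)"
proof -
  obtain V \<rho> g Hs where V: "x0 \<in> V" "C2_hess V \<rho> g Hs" "\<Omega> \<inter> V = {y\<in>V. \<rho> y < 0}" "g x0 \<noteq> 0"
    "\<exists>t0. \<forall>t\<ge>t0. Hs x0 + t *\<^sub>R proj_line (g x0 /\<^sub>R norm (g x0)) \<in> IntF F"
    by (rule boundary_data[OF x0])
  have "\<exists>t0. \<forall>t\<ge>t0. Hs x0 + t *\<^sub>R proj_line (g x0 /\<^sub>R norm (g x0)) \<in> IntF (dual F)"
    by (rule add_large_proj_in_dual_interior[OF cone negP]) (use V in \<open>auto intro: C2_hess_symmetric\<close>)
  then have "\<exists>t0. \<forall>t\<ge>t0. Hs x0 + t *\<^sub>R proj_line (g x0 /\<^sub>R norm (g x0)) \<in> IntF G" using V(5) G by blast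
  then show ?thesis using strict_barrier[OF \<Omega>(1) x0 V(1-4)] by blast
qed

lemma phi_near:
  assumes "x0 \<in> frontier \<Omega>" "0 < e"
  shows "\<exists>r>0. \<forall>y\<in>frontier \<Omega>. dist x0 y < r \<longrightarrow> \<bar>\<phi> y - \<phi> x0\<bar> < e"
  using phi_cont assms unfolding continuous_on_iff by (metis dist_commute dist_real_def)

text \<open>The comparison function is \<open>\<phi> x0 + e / 2\<close> minus a multiple of a
  barrier for the dual, so its Hessian avoids \<open>F\<close> and \<open>C2_max_principle\<close>
  applies to all members at once.\<close>

lemma upper_barrier:
  assumes x0: "x0 \<in> frontier \<Omega>" and e: "0 < e"
  shows "\<exists>r>0. \<forall>v\<in>P. \<forall>y\<in>closure \<Omega> \<inter> ball x0 r. v y \<le> ereal (\<phi> x0 + e)"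
proof -
  obtain r1 \<beta> g' H' \<delta> where b: "0 < r1" "0 < \<delta>" "C2_hess (ball x0 r1) \<beta> g' H'"
    "\<And>y. y \<in> ball x0 r1 \<Longrightarrow> H' y \<in> IntF (dual F)" "\<beta> x0 = 0"
    "\<And>y. y \<in> closure \<Omega> \<inter> ball x0 r1 \<Longrightarrow> \<beta> y \<le> - \<delta> * (norm (y - x0))\<^sup>2"
    using barriers[OF x0, of "dual F"] by metis
  obtain r2 where r2: "0 < r2" "\<And>y. y \<in> frontier \<Omega> \<Longrightarrow> dist x0 y < r2 \<Longrightarrow> \<bar>\<phi> y - \<phi> x0\<bar> < e / 2"
    using phi_near[OF x0, of "e / 2"] e by auto
  define r where "r = min r1 r2 / 2"
  have r: "0 < r" "r < r1" "r < r2" using b(1) r2(1) by (auto simp: r_def)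
  obtain M where M: "\<forall>v\<in>P. \<forall>y\<in>closure \<Omega>. v y \<le> ereal M" using P_bounded by blast
  \<comment> \<open>Steep enough for \<open>\<xi>\<close> to exceed the common bound
    \<open>M\<close> on the part of the sphere of radius \<open>r\<close> inside the domain.\<close>
  define C where "C = (\<bar>M\<bar> + \<bar>\<phi> x0\<bar> + 1) / (\<delta> * r\<^sup>2)"
  have C: "0 < C" "C * (\<delta> * r\<^sup>2) = \<bar>M\<bar> + \<bar>\<phi> x0\<bar> + 1" using b(2) r(1) by (auto simp: C_def intro!: divide_pos_pos)
  define \<xi> where "\<xi> y = (\<phi> x0 + e / 2) + - C * \<beta> y" for y
  have C2: "C2_hess (ball x0 r1) \<xi> (\<lambda>y. 0 + - C *\<^sub>R g' y) (\<lambda>y. 0 + - C *\<^sub>R H' y)"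
    unfolding \<xi>_def by (intro C2_hess_add C2_hess_const C2_hess_scale b(3)) auto
  have \<beta>0: "\<beta> y \<le> 0" if "y \<in> closure \<Omega> \<inter> ball x0 r1" for y
  proof -
    have "0 \<le> \<delta> * (norm (y - x0))\<^sup>2" using b(2) by simp
    then show ?thesis using b(6)[OF that] unfolding mult_minus_left by linarith
  qed
  have fr: "v y \<le> ereal (\<phi> x0 + e / 2)" if v: "v \<in> P" and y: "y \<in> frontier \<Omega>" "dist x0 y < r2" for v y
  proof -
    have "\<phi> y - \<phi> x0 < e / 2" using r2(2)[OF y] by (rule order.strict_trans1[OF abs_ge_self])
    then have "ereal (\<phi> y) \<le> ereal (\<phi> x0 + e / 2)" by simp
    then show ?thesis using PD(4)[OF v y(1)] by (rule order_trans[rotated])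
  qed
  let ?X = "\<Omega> \<inter> ball x0 r"
  have bound: "v y \<le> ereal (\<xi> y)" if v: "v \<in> P" and y: "y \<in> ?X" for v y
  proof (rule C2_max_principle[where F=F and X="?X", OF _ _ _ _ _ C2 _ _ _ y])
    have cl: "closure ?X \<subseteq> closure \<Omega> \<inter> cball x0 r"
      using closure_mono[of ?X \<Omega>] closure_mono[of ?X "ball x0 r"] r(1) by auto
    show "open ?X" "bounded ?X" using \<Omega> by auto
    show "usc_on (closure ?X) v" "F_sub F ?X v" "\<And>y. y \<in> closure ?X \<Longrightarrow> v y < \<infinity>"
      using usc_on_subset[OF PD(2)[OF v]] F_sub_subset[OF PD(3)[OF v]] PD(1)[OF v] cl by auto
    show "closure ?X \<subseteq> ball x0 r1" using cl r by auto
    show "0 + - C *\<^sub>R H' z \<notin> F" if z: "z \<in> ?X" for z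
    proof
      assume *: "0 + - C *\<^sub>R H' z \<in> F"
      have "H' z \<in> IntF (dual F)" using b(4) z r by auto
      \<comment> \<open>If the negative of \<open>C *\<^sub>R H' z\<close> were in \<open>F\<close>,
        adding \<open>t\<close> times the identity would move it into the interior. But its
        opposite, an interior element of the dual reduced by the same small amount, is still in the
        dual.\<close>
      from IntF_scale[OF dual_cone this C(1)] obtain s where s: "s > 0"
        "\<And>B. B \<in> Sym2 \<Longrightarrow> dist B (C *\<^sub>R H' z) < s \<Longrightarrow> B \<in> IntF (dual F)" using IntF_open by blast
      have sym: "C *\<^sub>R H' z \<in> Sym2" using \<open>H' z \<in> IntF (dual F)\<close> IntF_Sym2 Sym2_scaleR by blast
      define n where "n = norm (mat 1 :: real^'n^'n) + 1"
      have n: "n > 0" by (simp add: n_def add_nonneg_pos)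
      define t where "t = s / (2 * n)"
      have t: "t > 0" using s(1) n by (simp add: t_def)
      have "t * norm (mat 1 :: real^'n^'n) \<le> t * n" using t by (simp add: n_def)
      also have "\<dots> < s" using n s(1) by (simp add: t_def)
      finally have "C *\<^sub>R H' z - t *\<^sub>R mat 1 \<in> IntF (dual F)"
        using t by (intro s(2) Sym2_intros sym) (simp add: dist_norm)
      then have "C *\<^sub>R H' z - t *\<^sub>R mat 1 \<in> dual F" using IntF_subset by blast
      then have "t *\<^sub>R mat 1 - C *\<^sub>R H' z \<notin> IntF F" by (simp add: dual_def)
      moreover have "- (C *\<^sub>R H' z) \<in> F" using * by simp
      from add_scaled_id_IntF[OF cone this t] have "t *\<^sub>R mat 1 - C *\<^sub>R H' z \<in> IntF F" by simp
      ultimately show False by contradiction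
    qed
    show "v z \<le> ereal (\<xi> z)" if z: "z \<in> frontier ?X" for z
    proof -
      have zc: "z \<in> closure \<Omega>" "dist x0 z \<le> r" "z \<notin> ?X" using z cl \<Omega>(1) by (auto simp: frontier_def interior_open)
      then have zb: "z \<in> closure \<Omega> \<inter> ball x0 r1" using r by auto
      have "0 \<le> C * - \<beta> z" using C(1) \<beta>0[OF zb] by (intro mult_nonneg_nonneg) auto
      then have le: "\<phi> x0 + e / 2 \<le> \<xi> z" by (simp add: \<xi>_def)
      show ?thesis
      proof (cases "z \<in> \<Omega>")
        case False
        then have "z \<in> frontier \<Omega>" using zc(1) \<Omega>(1) by (auto simp: frontier_def interior_open)
        then have "v z \<le> ereal (\<phi> x0 + e / 2)" using fr[OF v] zc(2) r(3) by auto
        also have "\<dots> \<le> ereal (\<xi> z)" using le by simp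
        finally show ?thesis .
      next
        case True
        then have "norm (z - x0) = r" using zc by (auto simp: dist_norm norm_minus_commute)
        then have "\<beta> z \<le> - (\<delta> * r\<^sup>2)" using b(6)[OF zb] by simp
        then have "C * (\<delta> * r\<^sup>2) \<le> C * - \<beta> z" using C(1) by (intro mult_left_mono) auto
        then have "M \<le> \<xi> z" using C(2) e by (simp add: \<xi>_def)
        moreover have "v z \<le> ereal M" using M v zc(1) by blast
        ultimately show ?thesis by (metis ereal_less_eq(3) order_trans)
      qed
    qed
  qed
  have "isCont \<beta> x0" using C2_hess_continuous[OF b(3)] b(1) by (simp add: continuous_on_eq_continuous_at)
  moreover have "0 < e / 2 / C" using e C(1) by simp
  ultimately obtain q where q: "0 < q" "\<And>y. dist y x0 < q \<Longrightarrow> dist (\<beta> y) (\<beta> x0) < e / 2 / C"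
    unfolding continuous_at_eps_delta by blast
  have "v y \<le> ereal (\<phi> x0 + e)" if v: "v \<in> P" and y: "y \<in> closure \<Omega> \<inter> ball x0 (min q r)" for v y
  proof (cases "y \<in> \<Omega>")
    case True
    then have "v y \<le> ereal (\<xi> y)" using bound[OF v] y by auto
    also have "\<bar>\<beta> y\<bar> < e / 2 / C" using q(2)[of y] y by (auto simp: b(5) dist_commute)
    then have "\<bar>\<beta> y\<bar> * C < e / 2" using C(1) by (simp add: pos_less_divide_eq)
    then have "- C * \<beta> y \<le> e / 2" using C(1) abs_ge_minus_self[of "\<beta> y"] mult_right_mono[of "- \<beta> y" "\<bar>\<beta> y\<bar>" C]
      by (simp add: mult.commute)
    then have "ereal (\<xi> y) \<le> ereal (\<phi> x0 + e)" by (simp add: \<xi>_def)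
    finally show ?thesis .
  next
    case False
    then have "y \<in> frontier \<Omega>" using y \<Omega>(1) by (auto simp: frontier_def interior_open)
    then have "v y \<le> ereal (\<phi> x0 + e / 2)" using fr[OF v] y r(3) by auto
    also have "\<dots> \<le> ereal (\<phi> x0 + e)" using e by simp
    finally show ?thesis .
  qed
  then show ?thesis using q(1) r(1) by (intro exI[of _ "min q r"]) auto
qed

lemma glued_in_P:
  assumes a: "a \<in> P" and r: "0 < r" and S': "cball x0 r \<inter> S = {}"
    and b: "usc_on (closure \<Omega> \<inter> ball x0 r) b" "F_sub F (\<Omega> \<inter> ball x0 r) b"
    and le: "\<And>y. y \<in> closure \<Omega> \<Longrightarrow> dist x0 y < r \<Longrightarrow> r / 2 \<le> dist x0 y \<Longrightarrow> b y \<le> a y"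
    and bd: "\<And>y. y \<in> frontier \<Omega> \<Longrightarrow> dist x0 y < r \<Longrightarrow> b y \<le> ereal (\<phi> y)"
  shows "(\<lambda>y. if y \<in> ball x0 r then max (a y) (b y) else a y) \<in> P"
proof -
  have cl: "closure \<Omega> \<union> \<Omega> = closure \<Omega>" using closure_subset by blast
  note glue = glue_subharmonics[OF \<Omega>(1) r PD(2,3)[OF a] b, unfolded cl, OF le]
  show ?thesis
  proof (rule PI[OF glue])
    show "(if y \<in> ball x0 r then max (a y) (b y) else a y) \<le> ereal (\<phi> y)" if "y \<in> frontier \<Omega>" for y
      using PD(4)[OF a that] bd[OF that] by auto
    fix j assume j: "j < k"
    obtain C where "\<forall>\<^sub>F y in at (x j). a y \<le> h j y + ereal C" using PD(5)[OF a j] by blast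
    moreover have "\<forall>\<^sub>F y in at (x j). y \<in> - cball x0 r"
      using S' j by (intro eventually_at_in_open') auto
    ultimately have "\<forall>\<^sub>F y in at (x j). (if y \<in> ball x0 r then max (a y) (b y) else a y) \<le> h j y + ereal C"
      by eventually_elim auto
    then show "\<exists>C. \<forall>\<^sub>F y in at (x j). (if y \<in> ball x0 r then max (a y) (b y) else a y) \<le> h j y + ereal C" by blast
  qed
qed

text \<open>A steep multiple of a barrier for \<open>F\<close>, placed just below
  \<open>\<phi> x0\<close>, drops below \<open>\<psi>C\<close> away from \<open>x0\<close>. Gluing
  it to \<open>\<psi>C\<close> by a maximum gives a member of the family with almost the right
  boundary value.\<close>

lemma lower_barrier:
  assumes x0: "x0 \<in> frontier \<Omega>" and e: "0 < e"
  shows "\<exists>r>0. \<exists>v\<in>P. \<forall>y\<in>closure \<Omega> \<inter> ball x0 r. ereal (\<phi> x0 - e) \<le> v y"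
proof -
  obtain r1 \<beta> g' H' \<delta> where b: "0 < r1" "0 < \<delta>" "C2_hess (ball x0 r1) \<beta> g' H'"
    "\<And>y. y \<in> ball x0 r1 \<Longrightarrow> H' y \<in> IntF F" "\<beta> x0 = 0"
    "\<And>y. y \<in> closure \<Omega> \<inter> ball x0 r1 \<Longrightarrow> \<beta> y \<le> - \<delta> * (norm (y - x0))\<^sup>2"
    using barriers[OF x0, of F] by metis
  obtain r2 where r2: "0 < r2" "\<And>y. y \<in> frontier \<Omega> \<Longrightarrow> dist x0 y < r2 \<Longrightarrow> \<bar>\<phi> y - \<phi> x0\<bar> < e / 2"
    using phi_near[OF x0, of "e / 2"] e by auto
  have "open (- S)" "x0 \<in> - S" using S(3) frontier_D x0 by auto
  then obtain r3 where r3: "0 < r3" "cball x0 r3 \<subseteq> - S" using open_contains_cball by blast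
  define r where "r = min (min r1 r2) r3 / 2"
  have r: "0 < r" "r < r1" "r < r2" "r \<le> r3" using b(1) r2(1) r3(1) by (auto simp: r_def)
  have rS: "cball x0 r \<inter> S = {}" using r3(2) subset_cball[OF r(4), of x0] by blast
  have cD: "closure \<Omega> \<inter> cball x0 r \<subseteq> D" using rS by auto
  obtain N where N: "\<forall>y\<in>closure \<Omega> \<inter> cball x0 r. - \<psi>C y \<le> ereal N"
  proof -
    have "compact (closure \<Omega> \<inter> cball x0 r)" by (intro compact_Int compact_closure) auto
    moreover have "- \<psi>C y < \<infinity>" if "y \<in> closure \<Omega> \<inter> cball x0 r" for y
      using psiC_real[of y] cD that by (cases "\<psi>C y") auto
    ultimately show ?thesis
      using usc_real_bound[of "closure \<Omega> \<inter> cball x0 r" "\<lambda>y. - \<psi>C y"] usc_on_subset[OF usc_minus_psiC cD] that by blast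
  qed
  \<comment> \<open>The radius is \<open>r / 2\<close> because gluing requires the barrier to be
    below \<open>\<psi>C\<close> on the whole annulus; \<open>- N\<close> is a lower bound for
    \<open>\<psi>C\<close> there.\<close>
  define C where "C = (\<bar>N\<bar> + \<bar>\<phi> x0\<bar> + 1) / (\<delta> * (r / 2)\<^sup>2)"
  have C: "0 < C" "C * (\<delta> * (r / 2)\<^sup>2) = \<bar>N\<bar> + \<bar>\<phi> x0\<bar> + 1" using b(2) r(1) by (auto simp: C_def intro!: divide_pos_pos)
  define \<xi> where "\<xi> y = (\<phi> x0 - e / 2) + C * \<beta> y" for y
  have C2: "C2_hess (ball x0 r1) \<xi> (\<lambda>y. 0 + C *\<^sub>R g' y) (\<lambda>y. 0 + C *\<^sub>R H' y)"
    unfolding \<xi>_def by (intro C2_hess_add C2_hess_const C2_hess_scale b(3)) auto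
  have \<xi>le: "\<xi> y \<le> (\<phi> x0 - e / 2) - C * (\<delta> * (norm (y - x0))\<^sup>2)" if "y \<in> closure \<Omega>" "dist x0 y < r1" for y
  proof -
    have "C * \<beta> y \<le> C * (- \<delta> * (norm (y - x0))\<^sup>2)" using b(6)[of y] that C(1) by (intro mult_left_mono) auto
    then show ?thesis by (simp add: \<xi>_def)
  qed
  let ?v = "\<lambda>y. if y \<in> ball x0 r then max (\<psi>C y) (ereal (\<xi> y)) else \<psi>C y"
  have "?v \<in> P"
  proof (rule glued_in_P[OF psi_shifted(2) r(1) rS])
    show "usc_on (closure \<Omega> \<inter> ball x0 r) (\<lambda>y. ereal (\<xi> y))"
      by (intro usc_on_continuous continuous_intros continuous_on_subset[OF C2_hess_continuous[OF C2]]) (use r in auto)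
    have "F_sub F (ball x0 r1) (\<lambda>y. ereal (\<xi> y))"
    proof (rule F_sub_C2[OF cone C2])
      fix y assume "y \<in> ball x0 r1"
      then have "H' y \<in> F" using b(4) IntF_subset by blast
      then show "0 + C *\<^sub>R H' y \<in> F" using cone_scale[OF cone _ C(1)] by simp
    qed
    then show "F_sub F (\<Omega> \<inter> ball x0 r) (\<lambda>y. ereal (\<xi> y))" by (rule F_sub_subset) (use r in auto)
    show "ereal (\<xi> y) \<le> \<psi>C y" if y: "y \<in> closure \<Omega>" "dist x0 y < r" "r / 2 \<le> dist x0 y" for y
    proof -
      have "(r / 2)\<^sup>2 \<le> (norm (y - x0))\<^sup>2" using y(3) r(1) by (intro power_mono) (auto simp: dist_norm norm_minus_commute)
      then have "C * (\<delta> * (r / 2)\<^sup>2) \<le> C * (\<delta> * (norm (y - x0))\<^sup>2)" using C(1) b(2) by (intro mult_left_mono) auto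
      then have "\<xi> y \<le> - N" using \<xi>le[OF y(1)] y(2) r(2) C(2) e by simp
      moreover have "- \<psi>C y \<le> ereal N" using N y by auto
      ultimately show ?thesis by (cases "\<psi>C y") auto
    qed
    show "ereal (\<xi> y) \<le> ereal (\<phi> y)" if y: "y \<in> frontier \<Omega>" "dist x0 y < r" for y
    proof -
      have "0 \<le> C * (\<delta> * (norm (y - x0))\<^sup>2)" using C(1) b(2) by simp
      moreover have "y \<in> closure \<Omega>" using y(1) by (simp add: frontier_def)
      ultimately have "\<xi> y \<le> \<phi> x0 - e / 2" using \<xi>le[of y] y(2) r(2) by simp
      moreover have "\<bar>\<phi> y - \<phi> x0\<bar> < e / 2" using r2(2)[OF y(1)] y(2) r(3) by linarith
      then have "\<phi> x0 - e / 2 < \<phi> y" unfolding abs_less_iff by linarith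
      ultimately show ?thesis by simp
    qed
  qed
  moreover
  have "isCont \<beta> x0" using C2_hess_continuous[OF b(3)] b(1) by (simp add: continuous_on_eq_continuous_at)
  moreover have "0 < e / 2 / C" using e C(1) by simp
  ultimately obtain q where q: "0 < q" "\<And>y. dist y x0 < q \<Longrightarrow> dist (\<beta> y) (\<beta> x0) < e / 2 / C"
    unfolding continuous_at_eps_delta by blast
  have "ereal (\<phi> x0 - e) \<le> ?v y" if y: "y \<in> closure \<Omega> \<inter> ball x0 (min q r)" for y
  proof -
    have "\<bar>\<beta> y\<bar> < e / 2 / C" using q(2)[of y] y by (auto simp: b(5) dist_commute)
    then have "\<bar>\<beta> y\<bar> * C < e / 2" using C(1) by (simp add: pos_less_divide_eq)
    then have "- C * \<beta> y \<le> e / 2" using C(1) abs_ge_minus_self[of "\<beta> y"] mult_right_mono[of "- \<beta> y" "\<bar>\<beta> y\<bar>" C]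
      by (simp add: mult.commute)
    then have "ereal (\<phi> x0 - e) \<le> ereal (\<xi> y)" by (simp add: \<xi>_def)
    then show ?thesis using y by (auto simp: le_max_iff_disj)
  qed
  then show ?thesis using \<open>?v \<in> P\<close> q(1) r(1) by (intro exI[of _ "min q r"] conjI bexI[of _ ?v]) auto
qed

section \<open>The Perron function and its regularizations\<close>

definition H0 :: "real^'n \<Rightarrow> ereal" where "H0 y = (SUP v\<in>P. v y)"

lemma H0_ge: "v \<in> P \<Longrightarrow> v y \<le> H0 y"
  unfolding H0_def by (rule SUP_upper)

lemma H0_near:
  assumes "j < k"
  obtains r C where "0 < r" "ball (x j) r \<subseteq> U j" "ball (x j) r \<subseteq> \<Omega>" "ball (x j) r \<inter> S = {x j}"
    "\<And>y. y \<in> ball (x j) r - {x j} \<Longrightarrow> H0 y \<le> h j y + ereal C"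
proof -
  obtain r C where r: "0 < r" "ball (x j) r \<subseteq> U j" "ball (x j) r \<subseteq> \<Omega>" "ball (x j) r \<inter> S = {x j}"
    "\<forall>v\<in>P. \<forall>y\<in>ball (x j) r - {x j}. v y \<le> h j y + ereal C" using P_uniform_near[OF assms] by blast
  then have "H0 y \<le> h j y + ereal C" if "y \<in> ball (x j) r - {x j}" for y
    unfolding H0_def using that by (intro SUP_least) blast
  then show thesis using that r by blast
qed

lemma continuous_shift_h:
  assumes "j < k" "V \<subseteq> U j - {x j}" "s = 1 \<or> s = -1"
  shows "usc_on V (\<lambda>y. ereal s * h j y + ereal C)"
proof -
  have hc: "continuous_on V (h j)" using assms h_props[OF assms(1)] by (auto intro: continuous_on_subset)
  have inv: "t + ereal c < s \<longleftrightarrow> t < s - ereal c" for t s :: ereal and c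
    by (cases t; cases s) auto
  have "continuous_on V (\<lambda>y. ereal s * h j y)"
  proof -
    have "continuous_on V (\<lambda>y. - h j y)"
      by (rule continuous_on_minus_ereal[OF hc])
    moreover have "ereal (-1) * t = - t" for t by (cases t) auto
    ultimately show ?thesis using assms(3) hc by (auto simp: one_ereal_def[symmetric])
  qed
  from usc_on_continuous[OF this] show ?thesis unfolding usc_on_def inv by blast
qed

text \<open>All bounds on the family are uniform, so they pass to the upper envelope of
  \<open>H0\<close>, which is therefore a member. Being a member it is at most \<open>H0\<close>,
  hence equal to it.\<close>

lemma H0_in_P: "(\<lambda>y. if y \<in> S then -\<infinity> else H0 y) \<in> P"
proof -
  let ?u = "usc_reg D H0"
  obtain M where M: "\<forall>v\<in>P. \<forall>y\<in>closure \<Omega>. v y \<le> ereal M" using P_bounded by blast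
  have H0M: "H0 y \<le> ereal M" if "y \<in> D" for y unfolding H0_def using M that by (intro SUP_least) blast
  have uM: "?u y \<le> ereal M" for y by (rule usc_reg_le[of 1]) (use H0M in auto)
  have "(\<lambda>y. if y \<in> S then -\<infinity> else ?u y) \<in> P"
  proof (rule P_extend)
    show "usc_on D ?u" by (rule usc_on_usc_reg)
    show "F_sub F (\<Omega> - S) ?u"
      unfolding H0_def[abs_def]
    proof (rule F_sub_usc_reg_SUP[OF cone])
      show "open (\<Omega> - S)" using \<Omega>(1) S(3) by auto
      show "\<Omega> - S \<subseteq> D" using closure_subset by blast
      show "F_sub F (\<Omega> - S) v" if "v \<in> P" for v by (rule F_sub_subset[OF PD(3)[OF that]]) auto
      show "usc_reg D (\<lambda>y. SUP v\<in>P. v y) y < \<infinity>" for y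
        using uM[of y] unfolding H0_def[abs_def] by (auto intro: order_le_less_trans)
    qed
    show "?u y \<le> ereal (\<phi> y)" if y: "y \<in> frontier \<Omega>" for y
    proof (rule ereal_le_epsilon2)
      fix e :: real assume "0 < e"
      then obtain r where r: "0 < r" "\<forall>v\<in>P. \<forall>z\<in>closure \<Omega> \<inter> ball y r. v z \<le> ereal (\<phi> y + e)"
        using upper_barrier[OF y] by blast
      have "?u y \<le> ereal (\<phi> y + e)"
        by (rule usc_reg_le[OF r(1)]) (use r(2) in \<open>auto simp: H0_def intro!: SUP_least\<close>)
      then show "?u y \<le> ereal (\<phi> y) + ereal e" by simp
    qed
    fix j assume j: "j < k"
    obtain r C where r: "0 < r" "ball (x j) r \<subseteq> U j" "ball (x j) r \<subseteq> \<Omega>" "ball (x j) r \<inter> S = {x j}"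
      "\<And>y. y \<in> ball (x j) r - {x j} \<Longrightarrow> H0 y \<le> h j y + ereal C" using H0_near[OF j] by blast
    have "?u y \<le> h j y + ereal C" if y: "y \<in> ball (x j) r - {x j}" for y
    proof (rule usc_reg_le_usc[where N="ball (x j) r - {x j}"])
      show "y \<in> D" using y r(3,4) closure_subset[of \<Omega>] by blast
      show "usc_on (D \<inter> (ball (x j) r - {x j})) (\<lambda>y. h j y + ereal C)"
        using continuous_shift_h[OF j, of "D \<inter> (ball (x j) r - {x j})" 1 C] r(2) by (auto simp: one_ereal_def[symmetric])
    qed (use y r(5) in auto)
    then have "\<forall>\<^sub>F y in at (x j). ?u y \<le> h j y + ereal C"
      unfolding eventually_at using r(1) by (intro exI[of _ r]) (auto simp: dist_commute)
    then show "\<exists>C. \<forall>\<^sub>F y in at (x j). ?u y \<le> h j y + ereal C" by blast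
  qed
  from H0_ge[OF this] have le: "?u y \<le> H0 y" if "y \<in> D" for y using that by (metis DiffD2)
  have eq: "?u y = H0 y" if "y \<in> D" for y using le[OF that] usc_reg_ge[OF that, of H0] by (rule antisym)
  show "(\<lambda>y. if y \<in> S then -\<infinity> else H0 y) \<in> P"
  proof (rule P_extend)
    note u = \<open>(\<lambda>y. if y \<in> S then -\<infinity> else ?u y) \<in> P\<close>
    show "usc_on D H0" using usc_on_usc_reg[of D H0] usc_on_cong[of D ?u H0] eq by blast
    show "F_sub F (\<Omega> - S) H0"
      by (rule F_sub_cong[OF _ F_sub_subset[OF PD(3)[OF u]]]) (use eq closure_subset[of \<Omega>] in auto)
    show "H0 y \<le> ereal (\<phi> y)" if "y \<in> frontier \<Omega>" for y
      using PD(4)[OF u that] eq[of y] frontier_D that by auto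
    fix j assume "j < k"
    then obtain r C where "0 < r" "\<And>y. y \<in> ball (x j) r - {x j} \<Longrightarrow> H0 y \<le> h j y + ereal C" using H0_near by metis
    then have "\<forall>\<^sub>F y in at (x j). H0 y \<le> h j y + ereal C"
      unfolding eventually_at by (intro exI[of _ r]) (auto simp: dist_commute)
    then show "\<exists>C. \<forall>\<^sub>F y in at (x j). H0 y \<le> h j y + ereal C" by blast
  qed
qed

lemma H0_real: assumes "y \<in> D" shows "\<bar>H0 y\<bar> \<noteq> \<infinity>"
proof -
  have "\<psi>C y \<le> H0 y" by (rule H0_ge[OF psi_shifted(2)])
  moreover have "H0 y < \<infinity>" using PD(1)[OF H0_in_P, of y] assms by simp
  ultimately show ?thesis using psiC_real[OF assms] by (cases "\<psi>C y"; cases "H0 y") auto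
qed

text \<open>\<open>- W\<close> is the lower semicontinuous regularization of the Perron function on
  \<open>D\<close>.\<close>

definition W :: "real^'n \<Rightarrow> ereal" where "W = usc_reg D (\<lambda>y. - H0 y)"

lemma W_le_psi: "y \<in> D \<Longrightarrow> W y \<le> - \<psi>C y"
  unfolding W_def
  by (rule usc_reg_le_usc[where N=UNIV]) (use usc_minus_psiC H0_ge[OF psi_shifted(2)] in auto)

lemma W_ge: "y \<in> D \<Longrightarrow> - H0 y \<le> W y"
  unfolding W_def by (rule usc_reg_ge)

lemma W_less: "y \<in> D \<Longrightarrow> W y < \<infinity>"
  using W_le_psi[of y] psiC_real[of y] by (cases "\<psi>C y") (auto intro: order_le_less_trans)

text \<open>If the lower regularization of the Perron function failed to be a supersolution, a small
  bump would push a member of the family above it.\<close>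

lemma W_dual_sub: "F_sub (dual F) (\<Omega> - S) W"
proof (rule F_subI)
  have XD: "\<Omega> - S \<subseteq> D" using closure_subset by blast
  show "W y < \<infinity>" if "y \<in> \<Omega> - S" for y using W_less XD that by blast
  show "usc_on (\<Omega> - S) W" unfolding W_def by (rule usc_on_subset[OF usc_on_usc_reg XD])
  fix x0 V \<xi> g Hs
  assume *: "x0 \<in> V" "V \<subseteq> \<Omega> - S" "C2_hess V \<xi> g Hs" "\<And>y. y \<in> V \<Longrightarrow> W y \<le> ereal (\<xi> y)" "W x0 = ereal (\<xi> x0)"
  have oV: "open V" using *(3) by (simp add: C2_hess_def)
  have sym: "Hs y \<in> Sym2" if "y \<in> V" for y using C2_hess_symmetric[OF *(3) that] .
  show "Hs x0 \<in> dual F"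
  proof (rule ccontr)
    assume "Hs x0 \<notin> dual F"
    then have "- Hs x0 \<in> IntF F" using sym[OF *(1)] by (auto simp: dual_def)
    then obtain e where e: "0 < e" "\<And>B. B \<in> Sym2 \<Longrightarrow> dist B (- Hs x0) < e \<Longrightarrow> B \<in> IntF F" using IntF_open by blast
    define n where "n = norm (mat 1 :: real^'n^'n) + 1"
    have n: "n > 0" by (simp add: n_def add_nonneg_pos)
    \<comment> \<open>Half of the radius \<open>e\<close> pays for the bump's Hessian, the other
      half for the variation of \<open>Hs\<close>.\<close>
    define \<eta> where "\<eta> = e / (4 * n)"
    have \<eta>: "\<eta> > 0" using e n by (simp add: \<eta>_def)
    have \<eta>n: "norm ((2 * \<eta>) *\<^sub>R (mat 1 :: real^'n^'n)) \<le> e / 2"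
    proof -
      have "2 * \<eta> * norm (mat 1 :: real^'n^'n) \<le> 2 * \<eta> * n" using \<eta> by (simp add: n_def)
      also have "\<dots> = e / 2" using n by (simp add: \<eta>_def)
      finally show ?thesis using \<eta> by simp
    qed
    have "isCont Hs x0" using *(1,3) oV by (simp add: C2_hess_def continuous_on_eq_continuous_at)
    then obtain q where q: "0 < q" "\<And>y. dist y x0 < q \<Longrightarrow> dist (Hs y) (Hs x0) < e / 2"
      using e(1) unfolding continuous_at_eps_delta by (metis half_gt_zero)
    obtain r0 where r0: "0 < r0" "cball x0 r0 \<subseteq> V" using oV *(1) open_contains_cball by blast
    define r where "r = min q r0"
    have r: "0 < r" "cball x0 r \<subseteq> V" "r \<le> q" using q r0 by (auto simp: r_def)
    \<comment> \<open>The bump \<open>b\<close> exceeds \<open>- \<xi>\<close> by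
      \<open>\<sigma>\<close> at \<open>x0\<close> and is no longer above \<open>- \<xi>\<close>
      from distance \<open>r / 2\<close> on, as gluing requires.\<close>
    define \<sigma> where "\<sigma> = \<eta> * (r / 2)\<^sup>2"
    have \<sigma>: "\<sigma> > 0" using \<eta> r by (simp add: \<sigma>_def)
    define b where "b y = - \<xi> y + (\<sigma> + - \<eta> * (norm (y - x0))\<^sup>2)" for y
    have C2: "C2_hess V b (\<lambda>y. - g y + (2 * - \<eta>) *\<^sub>R (y - x0)) (\<lambda>y. - Hs y + (2 * - \<eta>) *\<^sub>R mat 1)"
      unfolding b_def by (intro C2_hess_add C2_hess_minus *(3) C2_hess_norm_square oV)
    have bV: "ball x0 r \<subseteq> V" using r(2) by auto
    have sub: "F_sub F (ball x0 r) (\<lambda>y. ereal (b y))"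
    proof (rule F_sub_C2[OF cone C2_hess_subset[OF C2 open_ball bV]])
      fix y assume y: "y \<in> ball x0 r"
      have "dist (- Hs y + (2 * - \<eta>) *\<^sub>R mat 1) (- Hs x0) \<le> norm (Hs x0 - Hs y) + norm ((2 * \<eta>) *\<^sub>R (mat 1 :: real^'n^'n))"
      proof -
        have eq: "(- Hs y + (2 * - \<eta>) *\<^sub>R mat 1) - (- Hs x0) = (Hs x0 - Hs y) - (2 * \<eta>) *\<^sub>R mat 1" by simp
        show ?thesis unfolding dist_norm eq by (rule norm_triangle_ineq4)
      qed
      also have "norm (Hs x0 - Hs y) < e / 2" using q(2)[of y] y r(3) by (simp add: dist_norm norm_minus_commute)
      finally have "dist (- Hs y + (2 * - \<eta>) *\<^sub>R mat 1) (- Hs x0) < e" using \<eta>n by simp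
      moreover have "- Hs y + (2 * - \<eta>) *\<^sub>R mat 1 \<in> Sym2" using sym[of y] bV y by (intro Sym2_intros) auto
      ultimately show "- Hs y + (2 * - \<eta>) *\<^sub>R mat 1 \<in> F" using e(2) IntF_subset by blast
    qed
    have V\<Omega>: "y \<in> \<Omega>" "y \<notin> S" "y \<in> D" if "y \<in> V" for y using *(2) that XD by auto
    have H0\<xi>: "ereal (- \<xi> y) \<le> H0 y" if "y \<in> V" for y
      using *(4)[OF that] W_ge[OF V\<Omega>(3)[OF that]] H0_real[OF V\<Omega>(3)[OF that]] by (cases "H0 y"; cases "W y") auto
    let ?a = "\<lambda>y. if y \<in> S then -\<infinity> else H0 y"
    let ?v = "\<lambda>y. if y \<in> ball x0 r then max (?a y) (ereal (b y)) else ?a y"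
    have "?v \<in> P"
    proof (rule glued_in_P[OF H0_in_P r(1)])
      show "cball x0 r \<inter> S = {}" using r(2) V\<Omega>(2) by blast
      show "usc_on (closure \<Omega> \<inter> ball x0 r) (\<lambda>y. ereal (b y))"
        by (intro usc_on_continuous continuous_intros continuous_on_subset[OF C2_hess_continuous[OF C2]]) (use bV in auto)
      show "F_sub F (\<Omega> \<inter> ball x0 r) (\<lambda>y. ereal (b y))" by (rule F_sub_subset[OF sub]) auto
      show "ereal (b y) \<le> ?a y" if y: "dist x0 y < r" "r / 2 \<le> dist x0 y" for y
      proof -
        have yV: "y \<in> V" using y(1) bV by auto
        have "(r / 2)\<^sup>2 \<le> (norm (y - x0))\<^sup>2" using y(2) r(1) by (intro power_mono) (auto simp: dist_norm norm_minus_commute)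
        then have "\<sigma> \<le> \<eta> * (norm (y - x0))\<^sup>2" unfolding \<sigma>_def using \<eta> by (intro mult_left_mono) auto
        then have "ereal (b y) \<le> ereal (- \<xi> y)" by (simp add: b_def)
        also have "\<dots> \<le> H0 y" by (rule H0\<xi>[OF yV])
        finally show ?thesis using V\<Omega>(2)[OF yV] by simp
      qed
      show "ereal (b y) \<le> ereal (\<phi> y)" if "y \<in> frontier \<Omega>" "dist x0 y < r" for y
        using V\<Omega>(1)[of y] bV that \<Omega>(1) by (auto simp: frontier_def interior_open subset_iff)
    qed
    then have ge: "- H0 y \<le> ereal (- b y)" if "y \<in> ball x0 r" for y
    proof -
      have "ereal (b y) \<le> ?v y" using that by simp
      also have "\<dots> \<le> H0 y" by (rule H0_ge[OF \<open>?v \<in> P\<close>])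
      finally show ?thesis by (cases "H0 y") auto
    qed
    \<comment> \<open>The bound \<open>- H0 \<le> - b\<close> on a whole neighbourhood passes to the
      envelope because \<open>b\<close> is continuous, and it contradicts the contact
      \<open>W x0 = \<xi> x0\<close> by the amount \<open>\<sigma>\<close>.\<close>
    have "W x0 \<le> ereal (- b x0)"
      unfolding W_def
    proof (rule usc_reg_le_usc[where N="ball x0 r"])
      show "usc_on (D \<inter> ball x0 r) (\<lambda>y. ereal (- b y))"
        by (intro usc_on_continuous continuous_intros continuous_on_subset[OF C2_hess_continuous[OF C2]]) (use bV in auto)
    qed (use V\<Omega>(3)[OF *(1)] r(1) ge in auto)
    then show False using *(5) \<sigma> by (simp add: b_def)
  qed
qed

lemma W_boundary:
  assumes y: "y \<in> frontier \<Omega>" shows "W y \<le> ereal (- \<phi> y)"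
proof (rule ereal_le_epsilon2)
  fix e :: real assume "0 < e"
  then obtain r v where r: "0 < r" "v \<in> P" "\<forall>z\<in>closure \<Omega> \<inter> ball y r. ereal (\<phi> y - e) \<le> v z"
    using lower_barrier[OF y] by blast
  have "W y \<le> ereal (- \<phi> y + e)"
    unfolding W_def
  proof (rule usc_reg_le[OF r(1)])
    fix z assume "z \<in> D" "dist y z < r"
    then have "ereal (\<phi> y - e) \<le> v z" using r(3) by auto
    also have "\<dots> \<le> H0 z" by (rule H0_ge[OF r(2)])
    finally show "- H0 z \<le> ereal (- \<phi> y + e)" by (cases "H0 z") auto
  qed
  then show "W y \<le> ereal (- \<phi> y) + ereal e" by simp
qed

lemma W_near:
  assumes j: "j < k" shows "\<exists>C. \<forall>\<^sub>F y in at (x j). W y \<le> - h j y + ereal C"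
proof -
  obtain C where "\<forall>\<^sub>F y in at (x j). h j y + ereal C \<le> \<psi>C y" using psiC_near[OF j] by blast
  moreover have "\<forall>\<^sub>F y in at (x j). y \<in> D"
  proof -
    have "open (\<Omega> - (S - {x j}))" using \<Omega>(1) S(1) by (intro open_Diff finite_imp_closed) auto
    then have "\<forall>\<^sub>F y in at (x j). y \<in> (\<Omega> - (S - {x j})) - {x j}" using pts j by (intro eventually_at_in_open) auto
    then show ?thesis by eventually_elim (use closure_subset in auto)
  qed
  ultimately have "\<forall>\<^sub>F y in at (x j). W y \<le> - h j y + ereal (- C)"
  proof eventually_elim
    case (elim y)
    then show ?case using W_le_psi[of y] psiC_real[of y] by (cases "h j y"; cases "\<psi>C y"; cases "W y") auto
  qed
  then show ?thesis by blast
qed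

text \<open>The nontrivial half is comparison of the Perron function with the dual subharmonic
  \<open>W\<close>. Equality makes both \<open>H0\<close> and \<open>- H0\<close> upper
  semicontinuous, which is its continuity.\<close>

lemma W_eq: assumes y: "y \<in> D" shows "W y = - H0 y"
proof (rule antisym[OF _ W_ge[OF y]])
  let ?a = "\<lambda>y. if y \<in> S then -\<infinity> else H0 y"
  have "?a y + W y \<le> 0"
  proof (rule domain_comparison[OF H0_in_P _ W_dual_sub W_less _ W_near y])
    show "usc_on D W" unfolding W_def by (rule usc_on_usc_reg)
    show "?a z + W z \<le> 0" if z: "z \<in> frontier \<Omega>" for z
      using PD(4)[OF H0_in_P z] W_boundary[OF z] by (cases "?a z"; cases "W z") auto
  qed auto
  then show "W y \<le> - H0 y" using y H0_real[OF y] by (cases "H0 y"; cases "W y") auto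
qed

lemma exists_solution: "sing_dirichlet_sol F \<Omega> \<phi> x k h (\<lambda>y. real_of_ereal (H0 y))"
proof -
  let ?H = "\<lambda>y. real_of_ereal (H0 y)"
  have He: "ereal (?H y) = H0 y" if "y \<in> D" for y using H0_real[OF that] by (simp add: ereal_real')
  have XD: "\<Omega> - S \<subseteq> D" using closure_subset by blast
  have usc1: "usc_on D (\<lambda>y. ereal (?H y))"
    using usc_on_subset[OF PD(2)[OF H0_in_P], of D] usc_on_cong[of D "\<lambda>y. ereal (?H y)" "\<lambda>y. if y \<in> S then -\<infinity> else H0 y"] He
    by simp
  have usc2: "usc_on D (\<lambda>y. ereal (- ?H y))"
    using usc_on_usc_reg[of D "\<lambda>y. - H0 y"] usc_on_cong[of D "\<lambda>y. ereal (- ?H y)" W] W_eq He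
    by (metis W_def uminus_ereal.simps(1))
  have cont: "continuous_on D ?H"
    unfolding continuous_on_def
  proof
    fix y assume y: "y \<in> D"
    show "(?H \<longlongrightarrow> ?H y) (at y within D)"
    proof (rule order_tendstoI)
      fix a assume "a < ?H y"
      then have "ereal (- ?H y) < ereal (- a)" by simp
      then have "\<forall>\<^sub>F z in at y within D. ereal (- ?H z) < ereal (- a)" using usc2 y unfolding usc_on_def by blast
      then show "\<forall>\<^sub>F z in at y within D. a < ?H z" by eventually_elim simp
    next
      fix a assume "?H y < a"
      then have "ereal (?H y) < ereal a" by simp
      then have "\<forall>\<^sub>F z in at y within D. ereal (?H z) < ereal a" using usc1 y unfolding usc_on_def by blast
      then show "\<forall>\<^sub>F z in at y within D. ?H z < a" by eventually_elim simp
    qed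
  qed
  have harm: "F_harm F (\<Omega> - S) (\<lambda>y. ereal (?H y))"
    unfolding F_harm_def
  proof (intro conjI)
    show "continuous_on (\<Omega> - S) (\<lambda>y. ereal (?H y))" by (intro continuous_intros continuous_on_subset[OF cont XD])
    show "F_sub F (\<Omega> - S) (\<lambda>y. ereal (?H y))"
      by (rule F_sub_cong[OF _ F_sub_subset[OF PD(3)[OF H0_in_P]]]) (use He XD in auto)
    show "F_sub (dual F) (\<Omega> - S) (\<lambda>y. - ereal (?H y))"
    proof (rule F_sub_cong[OF _ W_dual_sub])
      fix y assume "y \<in> \<Omega> - S"
      then have yD: "y \<in> D" using XD by blast
      show "W y = - ereal (?H y)" unfolding He[OF yD] by (rule W_eq[OF yD])
    qed
  qed auto
  have bd: "?H y = \<phi> y" if y: "y \<in> frontier \<Omega>" for y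
  proof -
    have yD: "y \<in> D" using y frontier_D by blast
    have "H0 y \<le> ereal (\<phi> y)" using PD(4)[OF H0_in_P y] yD by simp
    moreover have "- H0 y \<le> ereal (- \<phi> y)" using W_boundary[OF y] W_eq[OF yD] by simp
    ultimately show ?thesis by (cases "H0 y") auto
  qed
  have near: "\<exists>C. \<forall>\<^sub>F y in at (x j). h j y - ereal C \<le> ereal (?H y) \<and> ereal (?H y) \<le> h j y + ereal C" if j: "j < k" for j
  proof -
    obtain C1 where C1: "\<forall>\<^sub>F y in at (x j). h j y + ereal C1 \<le> \<psi>C y" using psiC_near[OF j] by blast
    obtain r C2 where r: "0 < r" "ball (x j) r \<subseteq> U j" "ball (x j) r \<subseteq> \<Omega>" "ball (x j) r \<inter> S = {x j}"
      "\<And>y. y \<in> ball (x j) r - {x j} \<Longrightarrow> H0 y \<le> h j y + ereal C2" using H0_near[OF j] by blast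
    define m where "m = max (- C1) C2"
    have m: "- m \<le> C1" "C2 \<le> m" by (auto simp: m_def)
    have "\<forall>\<^sub>F y in at (x j). y \<in> ball (x j) r - {x j}" using r(1) by (intro eventually_at_in_open) auto
    then have "\<forall>\<^sub>F y in at (x j). h j y - ereal m \<le> ereal (?H y) \<and> ereal (?H y) \<le> h j y + ereal m"
      using C1
    proof eventually_elim
      case (elim y)
      have yD: "y \<in> D" using elim(1) r(3,4) closure_subset[of \<Omega>] by blast
      have "h j y + ereal C1 \<le> H0 y" using elim(2) H0_ge[OF psi_shifted(2), of y] by (rule order_trans)
      moreover have "H0 y \<le> h j y + ereal C2" using r(5) elim(1) by blast
      ultimately show ?case unfolding He[OF yD] using m H0_real[OF yD] by (cases "h j y"; cases "H0 y") auto
    qed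
    then show ?thesis by blast
  qed
  have "\<forall>j. \<exists>C. j < k \<longrightarrow> (\<forall>\<^sub>F y in at (x j). h j y - ereal C \<le> ereal (?H y) \<and> ereal (?H y) \<le> h j y + ereal C)"
    using near by auto
  from choice[OF this] obtain C
    where C: "\<And>j. j < k \<Longrightarrow> \<forall>\<^sub>F y in at (x j). h j y - ereal (C j) \<le> ereal (?H y) \<and> ereal (?H y) \<le> h j y + ereal (C j)"
    by auto
  \<comment> \<open>One constant for all singular points; the summand 1 makes it positive.\<close>
  define C' where "C' = 1 + (\<Sum>j<k. \<bar>C j\<bar>)"
  have C': "0 < C'" "\<And>j. j < k \<Longrightarrow> C j \<le> C'"
  proof -
    show "0 < C'" unfolding C'_def by (intro add_pos_nonneg sum_nonneg) auto
    show "C j \<le> C'" if "j < k" for j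
      using member_le_sum[of j "{..<k}" "\<lambda>j. \<bar>C j\<bar>"] that by (simp add: C'_def)
  qed
  have "\<forall>\<^sub>F y in at (x j). h j y - ereal C' \<le> ereal (?H y) \<and> ereal (?H y) \<le> h j y + ereal C'" if j: "j < k" for j
    using C[OF j]
  proof eventually_elim
    case (elim y)
    then show ?case using C'(2)[OF j] by (cases "h j y") auto
  qed
  then show ?thesis unfolding sing_dirichlet_sol_def using cont harm bd C'(1) by blast
qed

end

theorem theorem1p4:
  fixes F :: "(real^'n^'n) set" and \<Omega> :: "(real^'n) set"
    and \<phi> :: "real^'n \<Rightarrow> real" and x :: "nat \<Rightarrow> real^'n" and k :: nat
    and h :: "nat \<Rightarrow> real^'n \<Rightarrow> ereal" and U :: "nat \<Rightarrow> (real^'n) set"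
    and \<psi> :: "real^'n \<Rightarrow> ereal"
  assumes cone: "cone_subequation F"
    and negP: "\<forall>e::real^'n. norm e = 1 \<longrightarrow> - proj_line e \<notin> F"
    and dom: "strictly_F_convex_domain F \<Omega>"
    and k_pos: "1 \<le> k"
    and pts: "\<forall>j<k. x j \<in> \<Omega>" and dist_pts: "inj_on x {..<k}"
    and phi_cont: "continuous_on (frontier \<Omega>) \<phi>"
    and polar: "\<forall>j<k. polar_singular F (h j) (U j) (x j)"
    and psi_cont: "continuous_on (closure \<Omega>) \<psi>"
    and psi_sub: "F_sub F \<Omega> \<psi>"
    and psi_lt: "\<forall>y\<in>closure \<Omega>. \<psi> y < \<infinity>"
    and psi_fin: "\<forall>y\<in>closure \<Omega> - x ` {..<k}. \<psi> y \<noteq> -\<infinity>"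
    and psi_near: "\<forall>j<k. \<exists>C::real. \<forall>\<^sub>F y in at (x j).
                      h j y - ereal C \<le> \<psi> y \<and> \<psi> y \<le> h j y + ereal C"
  shows "\<exists>H. sing_dirichlet_sol F \<Omega> \<phi> x k h H
           \<and> (\<forall>H'. sing_dirichlet_sol F \<Omega> \<phi> x k h H' \<longrightarrow>
                  (\<forall>y\<in>closure \<Omega> - x ` {..<k}. H' y = H y))
           \<and> (\<forall>y\<in>closure \<Omega> - x ` {..<k}.
                  ereal (H y) = (SUP v\<in>perron_family F \<Omega> \<phi> x k h. v y))"
proof -
  interpret singular_dirichlet F \<Omega> \<phi> x k h U \<psi>
    by unfold_locales (fact cone negP dom pts phi_cont polar psi_cont psi_sub psi_lt psi_fin psi_near)+
  show ?thesis
  proof (intro exI[of _ "\<lambda>y. real_of_ereal (H0 y)"] conjI allI impI ballI)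
    show "sing_dirichlet_sol F \<Omega> \<phi> x k h (\<lambda>y. real_of_ereal (H0 y))" by (rule exists_solution)
    fix y assume y: "y \<in> closure \<Omega> - x ` {..<k}"
    show eq: "ereal (real_of_ereal (H0 y)) = (SUP v\<in>perron_family F \<Omega> \<phi> x k h. v y)"
      by (rule solution_eq_SUP[OF exists_solution y])
    fix H' assume "sing_dirichlet_sol F \<Omega> \<phi> x k h H'"
    \<comment> \<open>The supremum formula holds for every solution, so any two agree.\<close>
    from trans[OF solution_eq_SUP[OF this y] eq[symmetric]] show "H' y = real_of_ereal (H0 y)"
      by (simp only: ereal.inject)
  qed
qed

end
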